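(* Let $\mathcal S=\{1,2\}$ and let $T\ge 3$ be an integer. Let $\mathcal Z$ be the set consisting of all type I degree one moves, all crossing path swappings, all 2 by 2 swaps, all moves of type (iv) (these last are included only when $T\ge 4$), all type II degree one moves, and all degree 3 sliding moves (as defined in the context). Then $\mathcal Z$ is a Markov basis for the two-state toric homogeneous Markov chain model without initial parameters, $p(s_1,\dots,s_T)=c\,\beta_{s_1s_2}\beta_{s_2s_3}\cdots\beta_{s_{T-1}s_T}$. That is, for every $\mathbf b=(b_{11},b_{12},b_{21},b_{22})$ and every pair $\mathbf x,\mathbf y$ in the fiber $\mathcal F_{\mathbf b}$ there exist $K\ge 0$ and $\mathbf z_1,\dots,\mathbf z_K\in\mathcal Z$ such that $\mathbf y=\mathbf x+\sum_{k=1}^K\mathbf z_k$ and $\mathbf x+\sum_{k=1}^{l}\mathbf z_k\ge 0$ (entrywise) for $l=1,\dots,K$.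
   Context: Paths and tables. A path is $\omega=(s_1,\dots,s_T)\in\{1,2\}^T$, also written $s_1\dots s_T$; $i^m$ denotes $i$ repeated $m$ times. A contingency table is $\mathbf x=\{x(\omega)\}_{\omega\in\{1,2\}^T}$ with $x(\omega)\in\mathbb Z_{\ge0}$. Let $x^t_{ij}=\sum_{\omega:\,s_t=i,\,s_{t+1}=j}x(\omega)$ and $x^+_{ij}=\sum_{t=1}^{T-1}x^t_{ij}$. The sufficient statistic is $\mathbf b=(b_{11},b_{12},b_{21},b_{22})$ with $b_{ij}=x^+_{ij}$. Equivalently $\mathbf b=A\mathbf x$, where $A$ is the $4\times 2^T$ matrix whose $((i,j),\omega)$ entry is the number of transitions $i\to j$ in $\omega$. The fiber is $\mathcal F_{\mathbf b}=\{\mathbf x\in\mathbb Z_{\ge0}^{2^T}: A\mathbf x=\mathbf b\}$. A move is an integer array $\mathbf z$ with $A\mathbf z=0$. Let $e_\omega$ be the unit table at $\omega$. A swapping $\{\omega_1,\dots,\omega_d\}\leftrightarrow\{\tilde\omega_1,\dots,\tilde\omega_d\}$ of multisets of paths denotes the moves $\pm\big(\sum_k e_{\omega_k}-\sum_k e_{\tilde\omega_k}\big)$. Write $\mathbf s_{t:t'}=s_t\dots s_{t'}$ (empty if $t>t'$). Type I degree one moves: for a path $\omega=(s_1,\dots,s_T)$ and $1\le t_0<t_1<t_2\le T$ with $s_{t_0}=s_{t_1}=s_{t_2}=i$ and $s_t\ne i$ for some $t_0<t<t_2$, the swapping $\omega=(\mathbf s_{1:t_0-1},\mathbf s_{t_0:t_2},\mathbf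 s_{t_2+1:T})\leftrightarrow(\mathbf s_{1:t_0-1},\mathbf s_{t_1:t_2-1},\mathbf s_{t_0:t_1},\mathbf s_{t_2+1:T})$. Crossing path swappings: for two paths $\omega,\omega'$ with $s_t=s'_t=i$ for some $t$, the swapping $\{(\mathbf s_{1:t-1},i,\mathbf s_{t+1:T}),(\mathbf s'_{1:t-1},i,\mathbf s'_{t+1:T})\}\leftrightarrow\{(\mathbf s_{1:t-1},i,\mathbf s'_{t+1:T}),(\mathbf s'_{1:t-1},i,\mathbf s_{t+1:T})\}$. 2 by 2 swaps: let $t_0\ne t_1$ in $\{1,\dots,T-1\}$, and let $\omega=(s_t)$, $\omega'=(s'_t)$ be two paths with $(s_{t_0},s_{t_0+1})=(1,1)$, $(s'_{t_0},s'_{t_0+1})=(2,2)$, and with either $(s_{t_1},s_{t_1+1})=(1,2)$, $(s'_{t_1},s'_{t_1+1})=(2,1)$, or $(s_{t_1},s_{t_1+1})=(2,1)$, $(s'_{t_1},s'_{t_1+1})=(1,2)$. The swap replaces $\{\omega,\omega'\}$ by the two paths obtained by exchanging the segments of $\omega$ and $\omega'$ at times $\min(t_0,t_1)+1,\dots,\max(t_0,t_1)$ (and conversely). Moves of type (iv) ($T\ge4$): for $1\le t_0,t_1\le T-2$, the swapping $\{(\mathbf s_{1:t_0-1},1,1,2,\mathbf s_{t_0+3:T}),(\mathbf s'_{1:t_1-1},1,2,2,\mathbf s'_{t_1+3:T})\}\leftrightarrow\{(\mathbf s_{1:t_0-1},1,2,2,\mathbf s_{t_0+3:T}),(\mathbf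 s'_{1:t_1-1},1,1,2,\mathbf s'_{t_1+3:T})\}$, together with the moves obtained from these by interchanging the two state labels $1$ and $2$. Type II degree one moves: for a path $\omega=(s_1,\dots,s_T)$ with $s_1=s_T=i$ and $s_t=j\ne i$ for some $1<t<T$, the swapping $\omega\leftrightarrow(s_t,\dots,s_{T-1},s_1,\dots,s_t)$. Degree 3 sliding moves: for integers $1\le a\le b\le T-1$ with $a+b\le T-1$ and $u$ with $b\le u\le T-1-a$, put $a'=a+u$, $b'=b+T-1-u$; the swapping of multisets $\{1^T,\ 1^a2^{T-a},\ 1^b2^{T-b}\}\leftrightarrow\{2^T,\ 1^{a'}2^{T-a'},\ 1^{b'}2^{T-b'}\}$, together with the time reversals of these moves (every path $s_1\dots s_T$ replaced by $s_T\dots s_1$), which involve single-step paths from $2$ to $1$. *)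

theory Defs
  imports Complex_Main "HOL-Library.Multiset"
begin

type_synonym path = "nat list"
type_synonym table = "path \<Rightarrow> int"

definition paths :: "nat \<Rightarrow> path set" where
  "paths T = {\<omega>. length \<omega> = T \<and> set \<omega> \<subseteq> {1, 2}}"

(* Times run from 1 to T, so s_t is the list entry with index t - 1. *)
definition st :: "path \<Rightarrow> nat \<Rightarrow> nat" where
  "st \<omega> t = \<omega> ! (t - 1)"

(* seg \<omega> t t' is s_t ... s_t' (for t \<ge> 1), both ends included, and [] if t > t'. *)
definition seg :: "path \<Rightarrow> nat \<Rightarrow> nat \<Rightarrow> path" where
  "seg \<omega> t t' = take (t' + 1 - t) (drop (t - 1) \<omega>)"

definition transitions :: "nat \<Rightarrow> nat \<Rightarrow> path \<Rightarrow> nat" where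
  "transitions i j \<omega> = card {t \<in> {1..<length \<omega>}. st \<omega> t = i \<and> st \<omega> (t + 1) = j}"

(* The (i,j) entry of A x. Tables are functions on all lists, so that fibers and moves below
   carry the condition of vanishing off paths T. *)
definition A_mult :: "nat \<Rightarrow> table \<Rightarrow> nat \<Rightarrow> nat \<Rightarrow> int" where
  "A_mult T x i j = (\<Sum>\<omega>\<in>paths T. int (transitions i j \<omega>) * x \<omega>)"

definition integer_arrays :: "nat \<Rightarrow> table set" where
  "integer_arrays T = {x. \<forall>\<omega>. \<omega> \<notin> paths T \<longrightarrow> x \<omega> = 0}"

definition fiber :: "nat \<Rightarrow> (nat \<Rightarrow> nat \<Rightarrow> int) \<Rightarrow> table set" where
  "fiber T b = {x \<in> integer_arrays T. (\<forall>\<omega>. 0 \<le> x \<omega>) \<and>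
      (\<forall>i\<in>{1, 2}. \<forall>j\<in>{1, 2}. A_mult T x i j = b i j)}"

definition moves :: "nat \<Rightarrow> table set" where
  "moves T = {z \<in> integer_arrays T. \<forall>i\<in>{1, 2}. \<forall>j\<in>{1, 2}. A_mult T z i j = 0}"

definition markov_basis :: "nat \<Rightarrow> table set \<Rightarrow> bool" where
  "markov_basis T Z \<longleftrightarrow> Z \<subseteq> moves T \<and>
     (\<forall>b. \<forall>x\<in>fiber T b. \<forall>y\<in>fiber T b.
        \<exists>(K::nat) (z :: nat \<Rightarrow> table).
          (\<forall>k\<in>{1..K}. z k \<in> Z) \<and>
          (\<forall>\<omega>. y \<omega> = x \<omega> + (\<Sum>k=1..K. z k \<omega>)) \<and>
          (\<forall>l\<in>{1..K}. \<forall>\<omega>. 0 \<le> x \<omega> + (\<Sum>k=1..l. z k \<omega>)))"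

definition unit_table :: "path \<Rightarrow> table" where
  "unit_table \<omega> = (\<lambda>\<eta>. if \<eta> = \<omega> then 1 else 0)"

definition table_of :: "path multiset \<Rightarrow> table" where
  "table_of M = (\<lambda>\<eta>. \<Sum>\<omega>\<in>#M. unit_table \<omega> \<eta>)"

definition swapping :: "path multiset \<Rightarrow> path multiset \<Rightarrow> table set" where
  "swapping M N = {\<lambda>\<eta>. table_of M \<eta> - table_of N \<eta>, \<lambda>\<eta>. table_of N \<eta> - table_of M \<eta>}"

definition type1_moves :: "nat \<Rightarrow> table set" where
  "type1_moves T = \<Union> {swapping {#\<omega>#}
        {#seg \<omega> 1 (t0 - 1) @ seg \<omega> t1 (t2 - 1) @ seg \<omega> t0 t1 @ seg \<omega> (t2 + 1) T#}
      | \<omega> t0 t1 t2 i. \<omega> \<in> paths T \<and> 1 \<le> t0 \<and> t0 < t1 \<and> t1 < t2 \<and> t2 \<le> T \<and>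
          st \<omega> t0 = i \<and> st \<omega> t1 = i \<and> st \<omega> t2 = i \<and>
          (\<exists>t. t0 < t \<and> t < t2 \<and> st \<omega> t \<noteq> i)}"

definition crossing_swappings :: "nat \<Rightarrow> table set" where
  "crossing_swappings T = \<Union> {swapping {#\<omega>, \<omega>'#}
        {#seg \<omega> 1 (t - 1) @ [i] @ seg \<omega>' (t + 1) T, seg \<omega>' 1 (t - 1) @ [i] @ seg \<omega> (t + 1) T#}
      | \<omega> \<omega>' t i. \<omega> \<in> paths T \<and> \<omega>' \<in> paths T \<and> 1 \<le> t \<and> t \<le> T \<and>
          st \<omega> t = i \<and> st \<omega>' t = i}"

(* \<omega> with its segment at times a+1, ..., b replaced by that of \<omega>' *)
definition exchange :: "nat \<Rightarrow> nat \<Rightarrow> path \<Rightarrow> path \<Rightarrow> path" where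
  "exchange a b \<omega> \<omega>' = seg \<omega> 1 a @ seg \<omega>' (a + 1) b @ seg \<omega> (b + 1) (length \<omega>)"

definition two_by_two_swaps :: "nat \<Rightarrow> table set" where
  "two_by_two_swaps T = \<Union> {swapping {#\<omega>, \<omega>'#}
        {#exchange (min t0 t1) (max t0 t1) \<omega> \<omega>', exchange (min t0 t1) (max t0 t1) \<omega>' \<omega>#}
      | \<omega> \<omega>' t0 t1. \<omega> \<in> paths T \<and> \<omega>' \<in> paths T \<and>
          t0 \<in> {1..T - 1} \<and> t1 \<in> {1..T - 1} \<and> t0 \<noteq> t1 \<and>
          (st \<omega> t0, st \<omega> (t0 + 1)) = (1, 1) \<and> (st \<omega>' t0, st \<omega>' (t0 + 1)) = (2, 2) \<and>
          ((st \<omega> t1, st \<omega> (t1 + 1)) = (1, 2) \<and> (st \<omega>' t1, st \<omega>' (t1 + 1)) = (2, 1) \<or>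
           (st \<omega> t1, st \<omega> (t1 + 1)) = (2, 1) \<and> (st \<omega>' t1, st \<omega>' (t1 + 1)) = (1, 2))}"

(* The entries of \<omega> at times t, t+1, t+2 are overwritten, so the two paths passed below
   only supply the segments outside these three times. *)
definition overwrite3 :: "nat \<Rightarrow> path \<Rightarrow> path \<Rightarrow> path" where
  "overwrite3 t u \<omega> = seg \<omega> 1 (t - 1) @ u @ seg \<omega> (t + 3) (length \<omega>)"

definition flip_states :: "path \<Rightarrow> path" where
  "flip_states \<omega> = map (\<lambda>i. if i = 1 then 2 else 1) \<omega>"

definition type4_pairs :: "nat \<Rightarrow> (path multiset \<times> path multiset) set" where
  "type4_pairs T =
     {({#overwrite3 t0 [1, 1, 2] \<omega>, overwrite3 t1 [1, 2, 2] \<omega>'#},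
       {#overwrite3 t0 [1, 2, 2] \<omega>, overwrite3 t1 [1, 1, 2] \<omega>'#})
      | \<omega> \<omega>' t0 t1. \<omega> \<in> paths T \<and> \<omega>' \<in> paths T \<and> t0 \<in> {1..T - 2} \<and> t1 \<in> {1..T - 2}}"

definition type4_moves :: "nat \<Rightarrow> table set" where
  "type4_moves T = (if 4 \<le> T then
     (\<Union>(M, N)\<in>type4_pairs T. swapping M N) \<union>
     (\<Union>(M, N)\<in>type4_pairs T.
        swapping (image_mset flip_states M) (image_mset flip_states N))
   else {})"

definition type2_moves :: "nat \<Rightarrow> table set" where
  "type2_moves T = \<Union> {swapping {#\<omega>#} {#seg \<omega> t (T - 1) @ seg \<omega> 1 t#}
      | \<omega> t i j. \<omega> \<in> paths T \<and> st \<omega> 1 = i \<and> st \<omega> T = i \<and> 1 < t \<and> t < T \<and>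
          st \<omega> t = j \<and> j \<noteq> i}"

(* single_step T a is the path 1^a 2^(T-a) *)
definition single_step :: "nat \<Rightarrow> nat \<Rightarrow> path" where
  "single_step T a = replicate a 1 @ replicate (T - a) 2"

definition sliding_pairs :: "nat \<Rightarrow> (path multiset \<times> path multiset) set" where
  "sliding_pairs T =
     {({#replicate T 1, single_step T a, single_step T b#},
       {#replicate T 2, single_step T a', single_step T b'#})
      | a b u a' b'. 1 \<le> a \<and> a \<le> b \<and> b \<le> T - 1 \<and> a + b \<le> T - 1 \<and>
          b \<le> u \<and> u \<le> T - 1 - a \<and> a' = a + u \<and> b' = b + T - 1 - u}"

definition sliding_moves :: "nat \<Rightarrow> table set" where
  "sliding_moves T =
     (\<Union>(M, N)\<in>sliding_pairs T. swapping M N) \<union>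
     (\<Union>(M, N)\<in>sliding_pairs T. swapping (image_mset rev M) (image_mset rev N))"

definition thmc_moves :: "nat \<Rightarrow> table set" where
  "thmc_moves T = type1_moves T \<union> crossing_swappings T \<union> two_by_two_swaps T \<union>
     type4_moves T \<union> type2_moves T \<union> sliding_moves T"

lemma finite_paths: "finite (paths T)"
  using finite_lists_length_eq[of "{1, 2::nat}" T] by (simp add: paths_def conj_commute)

(* A x is the vector of the totals x^+_ij of the tables x^t_ij. *)
lemma A_mult_eq_transition_totals:
  "A_mult T x i j =
     (\<Sum>t=1..T - 1. \<Sum>\<omega> | \<omega> \<in> paths T \<and> st \<omega> t = i \<and> st \<omega> (t + 1) = j. x \<omega>)"
proof -
  have *: "int (transitions i j \<omega>) * x \<omega> =
      (\<Sum>t=1..T - 1. if st \<omega> t = i \<and> st \<omega> (t + 1) = j then x \<omega> else 0)"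
    if "\<omega> \<in> paths T" for \<omega>
  proof -
    have "{1..<length \<omega>} = {1..T - 1}" using that by (auto simp: paths_def)
    then show ?thesis by (simp add: transitions_def sum.If_cases Int_def)
  qed
  have "A_mult T x i j = (\<Sum>\<omega>\<in>paths T. \<Sum>t=1..T - 1.
      if st \<omega> t = i \<and> st \<omega> (t + 1) = j then x \<omega> else 0)"
    unfolding A_mult_def by (rule sum.cong[OF refl *])
  also have "\<dots> = (\<Sum>t=1..T - 1. \<Sum>\<omega>\<in>paths T.
      if st \<omega> t = i \<and> st \<omega> (t + 1) = j then x \<omega> else 0)"
    by (rule sum.swap)
  finally show ?thesis
    by (simp add: sum.If_cases[OF finite_paths] Int_def)
qed

(* A is the exponent matrix of the monomials beta_{s_1 s_2} ... beta_{s_{T-1} s_T} of the model. *)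
lemma monomial_eq_prod_transitions:
  fixes \<beta> :: "nat \<Rightarrow> nat \<Rightarrow> real"
  assumes "\<omega> \<in> paths T"
  shows "(\<Prod>t=1..T - 1. \<beta> (st \<omega> t) (st \<omega> (t + 1))) =
     (\<Prod>(i, j)\<in>{1, 2} \<times> {1, 2}. \<beta> i j ^ transitions i j \<omega>)"
proof -
  let ?g = "\<lambda>t. (st \<omega> t, st \<omega> (t + 1))"
  have len: "{1..<length \<omega>} = {1..T - 1}" using assms by (auto simp: paths_def)
  have st12: "st \<omega> t \<in> {1, 2}" if "1 \<le> t" "t \<le> T" for t
    using assms that nth_mem[of "t - 1" \<omega>] unfolding paths_def st_def by fastforce
  have sub: "?g ` {1..T - 1} \<subseteq> {1, 2} \<times> {1, 2}"
  proof (rule image_subsetI)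
    fix t assume "t \<in> {1..T - 1}"
    then have "1 \<le> t" "t \<le> T" "1 \<le> t + 1" "t + 1 \<le> T" by auto
    then show "?g t \<in> {1, 2} \<times> {1, 2}" using st12 by blast
  qed
  have "(\<Prod>t=1..T - 1. \<beta> (st \<omega> t) (st \<omega> (t + 1))) =
      (\<Prod>p\<in>{1, 2} \<times> {1, 2}. \<Prod>t | t \<in> {1..T - 1} \<and> ?g t = p. \<beta> (st \<omega> t) (st \<omega> (t + 1)))"
    by (rule prod.group[symmetric, OF _ _ sub]) auto
  also have "\<dots> = (\<Prod>(i, j)\<in>{1, 2} \<times> {1, 2}. \<beta> i j ^ transitions i j \<omega>)"
    by (rule prod.cong[OF refl]) (auto simp: transitions_def len simp del: One_nat_def)
  finally show ?thesis .
qed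

end

theory Submission
  imports Defs
begin

text \<open>
  Cutting a path at a repeated state and swapping the pieces (type I) or rotating a closed path
  (type II) changes a path into any other path with the same four transition counts. Hence a table
  is, up to moves, a multiset of count vectors (b11, b12, b21, b22), where b12 - b21 lies in
  {-1, 0, 1} according to the endpoints, and where b12 = b21 = 0 forces a constant path. Crossings,
  2 by 2 swaps and moves of type (iv) exchange, between two paths, a loop 11 of one for a loop 22
  of the other, or transfer a round trip 1 -> 2 -> 1 from one to the other; crossing a path from 1
  to 2 with one from 2 to 1 yields two paths with b12 = b21.

  Assume b12 >= b21 in total and choose in a class a table with the fewest paths from 2 to 1. If there are
  none, transfers of round trips make either all paths nonconstant, and then round trips and loops
  can be redistributed freely, or all paths have at most one transition 1 -> 2, and then the number
  of constant paths 2...2 can be adjusted, by a sliding move if only single-step paths are present.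
  Otherwise no path from 1 to 2 crosses a path from 2 to 1 in any rearrangement; this leaves two rigid
  families: one complementary pair 1^a 2^(T-a), 2^a 1^(T-a) next to constant paths (or to paths
  121, 212 if T = 3), or T even and all loops used up, one for each path with b12 = b21. The total counts
  tell the three situations apart.
\<close>

section \<open>Words and transition counts\<close>

text \<open>The obstacle is a complementary pair: two paths in different states at every time admit
  no crossing. Taking the number of paths from 2 to 1 minimal turns this into rigidity, because an
  exchange with a third path that spoils the complementary counts would make a crossing possible and
  lower that number.

  How the totals separate the families: modulo T - 1, constant paths contribute no loops 22, while a
  complementary pair of single steps contributes T - 2 of them, more than a closed nonconstant path
  can hold. For even T, a path with b12 = b21 has an odd number of loops; a table with one loop on
  each such path and no other loop therefore has the least possible loop total, and this total
  forces the same shape on the table it is compared with.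

  Words have letters of an arbitrary type: the two-state arguments use truth values, where
  interchanging the states is negation, while the invariance of the counts is also applied to paths
  over the labels 1 and 2.\<close>

fun tr :: "'a \<Rightarrow> 'a \<Rightarrow> 'a list \<Rightarrow> nat" where
  "tr a b (x # y # w) = of_bool (x = a \<and> y = b) + tr a b (y # w)"
| "tr a b [x] = 0"
| "tr a b [] = 0"

lemma tr_Cons: "w \<noteq> [] \<Longrightarrow> tr a b (x # w) = of_bool (x = a \<and> hd w = b) + tr a b w"
  by (cases w) auto

lemma tr_append:
  "u \<noteq> [] \<Longrightarrow> v \<noteq> [] \<Longrightarrow>
     tr a b (u @ v) = tr a b u + of_bool (last u = a \<and> hd v = b) + tr a b v"
  by (induction u) (auto simp: tr_Cons hd_append)

text \<open>Cutting at a letter that both pieces keep makes the count additive without a junction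
  term. Most rearrangements below are cut in this way.\<close>

lemma tr_split: "tr a b (u @ x # v) = tr a b (u @ [x]) + tr a b (x # v)"
  by (cases "u = []"; cases "v = []") (auto simp: tr_append tr_Cons)

lemma tr_map_inj: "inj f \<Longrightarrow> tr (f a) (f b) (map f w) = tr a b w"
  by (induction a b w rule: tr.induct) (auto simp: inj_eq)

lemma tr_rev: "tr a b (rev w) = tr b a w"
proof (induction w)
  case (Cons x w)
  then show ?case by (cases "w = []") (auto simp: tr_append tr_Cons last_rev)
qed simp

lemma tr_replicate: "tr a b (replicate n x) = of_bool (a = x \<and> b = x) * (n - 1)"
proof (induction n)
  case (Suc n)
  then show ?case by (cases n) auto
qed simp

lemma tr_pos: "tr a b w \<ge> 1 \<Longrightarrow> \<exists>u v. w = u @ a # b # v"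
proof (induction a b w rule: tr.induct)
  case (1 a b x y w)
  show ?case
  proof (cases "x = a \<and> y = b")
    case True then show ?thesis by (metis append_Nil)
  next
    case False
    then have "tr a b (y # w) \<ge> 1" using "1.prems" by auto
    then obtain u v where "y # w = u @ a # b # v" using "1.IH" by blast
    then show ?thesis by (metis append_Cons)
  qed
qed auto

text \<open>The states 1 and 2 are written True and False.\<close>

abbreviation up :: "bool list \<Rightarrow> nat" where "up \<equiv> tr True False"
abbreviation dn :: "bool list \<Rightarrow> nat" where "dn \<equiv> tr False True"
abbreviation l1 :: "bool list \<Rightarrow> nat" where "l1 \<equiv> tr True True"
abbreviation l2 :: "bool list \<Rightarrow> nat" where "l2 \<equiv> tr False False"

lemma tr_total: "w \<noteq> [] \<Longrightarrow> Suc (l1 w + up w + dn w + l2 w) = length w"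
proof (induction w)
  case (Cons x w)
  then show ?case by (cases "w = []") (auto simp: tr_Cons)
qed simp

text \<open>Switches alternate in direction, so their difference is fixed by the two end states
  alone.\<close>

lemma up_dn: "w \<noteq> [] \<Longrightarrow> up w + of_bool (last w) = dn w + of_bool (hd w)"
proof (induction w)
  case (Cons x w)
  then show ?case by (cases "w = []") (auto simp: tr_Cons split: if_splits)
qed simp

lemma up_le: "w \<noteq> [] \<Longrightarrow> up w \<le> dn w + 1" and dn_le: "w \<noteq> [] \<Longrightarrow> dn w \<le> up w + 1"
  using up_dn[of w] by (auto split: if_splits simp: of_bool_def)

lemma no_switch:
  "up w = 0 \<Longrightarrow> dn w = 0 \<Longrightarrow> w \<noteq> [] \<Longrightarrow> w = replicate (length w) (hd w)"
proof (induction w)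
  case (Cons x w)
  show ?case
  proof (cases w)
    case w: (Cons y s)
    have "y = x" using Cons.prems unfolding w by (cases x; cases y) simp_all
    moreover have "w = replicate (length w) (hd w)"
      using Cons.prems w by (intro Cons.IH) simp_all
    ultimately have "w = replicate (length w) x" using w by simp
    then show ?thesis by (metis length_Cons list.sel(1) replicate_Suc)
  qed simp
qed simp

lemma tr_flip: "tr a b (map Not w) = tr (\<not> a) (\<not> b) w"
  using tr_map_inj[of Not "\<not> a" "\<not> b" w] by (simp add: inj_def)

lemma tr_replicate_append:
  "0 < a \<Longrightarrow> 0 < b \<Longrightarrow>
     tr p q (replicate a i @ replicate b j) =
       of_bool (p = i \<and> q = i) * (a - 1) + of_bool (i = p \<and> j = q) + of_bool (p = j \<and> q = j) * (b - 1)"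
  by (simp add: tr_append tr_replicate)

text \<open>The hypotheses are the constraints on a word that starts in state 1: its switches
  alternate beginning with 12, and loops 22 need a visit to state 2. The word is built by prepending
  round trips.\<close>

lemma ex_word_from_True:
  assumes "q = p \<or> p = q + 1" "p = 0 \<Longrightarrow> n = 0"
  shows "\<exists>v. l1 (True # v) = m \<and> up (True # v) = p \<and> dn (True # v) = q \<and> l2 (True # v) = n"
  using assms
proof (induction q arbitrary: p)
  case 0
  show ?case
  proof (cases "p = 0")
    case True
    have "tr a b (True # replicate m True) = of_bool (a \<and> b) * m" for a b
      using tr_replicate[of a b "Suc m" True] by simp
    then show ?thesis using 0 True by (intro exI[of _ "replicate m True"]) simp
  next
    case False
    have "tr a b (True # replicate m True @ replicate (Suc n) False) =
        of_bool (a \<and> b) * m + of_bool (a \<and> \<not> b) + of_bool (\<not> a \<and> \<not> b) * n" for a b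
      using tr_replicate_append[of "Suc m" "Suc n" a b True False] by simp
    then show ?thesis using 0 False
      by (intro exI[of _ "replicate m True @ replicate (Suc n) False"]) simp
  qed
next
  case (Suc q)
  show ?case
  \<comment> \<open>For \<open>p = 1\<close> no round trip can be split off: the remainder would
    never visit state 2 and could not carry the \<open>n\<close> loops there.\<close>
  proof (cases "p = 1")
    case True
    have "tr a b (True # replicate m True @ replicate (Suc n) False @ [True]) =
        of_bool (a \<and> b) * m + of_bool (a \<and> \<not> b) + of_bool (\<not> a \<and> \<not> b) * n + of_bool (\<not> a \<and> b)" for a b
      using tr_replicate_append[of "Suc m" "Suc n" a b True False]
        tr_append[of "replicate (Suc m) True @ replicate (Suc n) False" "[True]" a b] by simp
    then show ?thesis using Suc.prems True
      by (intro exI[of _ "replicate m True @ replicate (Suc n) False @ [True]"]) simp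
  next
    case False
    then have "\<exists>v. l1 (True # v) = m \<and> up (True # v) = p - 1 \<and> dn (True # v) = q \<and> l2 (True # v) = n"
      using Suc.prems by (intro Suc.IH) auto
    then obtain v where "l1 (True # v) = m" "up (True # v) = p - 1" "dn (True # v) = q" "l2 (True # v) = n"
      by blast
    then show ?thesis using Suc.prems False by (intro exI[of _ "False # True # v"]) auto
  qed
qed

lemma ex_word_from_False:
  assumes "q = p \<or> p = q + 1" "p = 0 \<Longrightarrow> n = 0"
  shows "\<exists>v. l2 (False # v) = m \<and> dn (False # v) = p \<and> up (False # v) = q \<and> l1 (False # v) = n"
proof -
  obtain v where v: "l1 (True # v) = m" "up (True # v) = p" "dn (True # v) = q" "l2 (True # v) = n"
    using ex_word_from_True[OF assms] by blast
  then show ?thesis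
    using tr_flip[of _ _ "True # v"] by (intro exI[of _ "map Not v"]) simp
qed

lemma ex_word_to_False:
  assumes "q = p \<or> p = q + 1" "p = 0 \<Longrightarrow> n = 0"
  shows "\<exists>v. l2 (v @ [False]) = m \<and> up (v @ [False]) = p \<and> dn (v @ [False]) = q \<and> l1 (v @ [False]) = n"
proof -
  obtain v where v: "l2 (False # v) = m" "dn (False # v) = p" "up (False # v) = q" "l1 (False # v) = n"
    using ex_word_from_False[OF assms] by blast
  then show ?thesis
    using tr_rev[of _ _ "False # v"] by (intro exI[of _ "rev v"]) simp
qed

section \<open>The equivalence generated by the moves\<close>

text \<open>The rule eqv_square is the 2 by 2 swap at two adjacent times.\<close>

inductive eqv :: "nat \<Rightarrow> 'a list multiset \<Rightarrow> 'a list multiset \<Rightarrow> bool" for T where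
  eqv_refl: "eqv T M M"
| eqv_sym: "eqv T M N \<Longrightarrow> eqv T N M"
| eqv_trans: "eqv T M N \<Longrightarrow> eqv T N P \<Longrightarrow> eqv T M P"
| eqv_add: "eqv T M N \<Longrightarrow> eqv T (M + K) (N + K)"
| eqv_loops: "length (u @ (i # x) @ (i # y) @ (i # v)) = T \<Longrightarrow>
    eqv T {#u @ (i # x) @ (i # y) @ (i # v)#} {#u @ (i # y) @ (i # x) @ (i # v)#}"
| eqv_rotate: "length ((i # x) @ (j # y) @ [i]) = T \<Longrightarrow> i \<noteq> j \<Longrightarrow>
    eqv T {#(i # x) @ (j # y) @ [i]#} {#(j # y) @ (i # x) @ [j]#}"
| eqv_cross: "length (u @ i # v) = T \<Longrightarrow> length u' = length u \<Longrightarrow> length v' = length v \<Longrightarrow>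
    eqv T {#u @ i # v, u' @ i # v'#} {#u @ i # v', u' @ i # v#}"
| eqv_square: "length (u @ [i, i, j] @ v) = T \<Longrightarrow> length u' = length u \<Longrightarrow> length v' = length v \<Longrightarrow> i \<noteq> j \<Longrightarrow>
    eqv T {#u @ [i, i, j] @ v, u' @ [j, j, i] @ v'#} {#u @ [i, j, j] @ v, u' @ [j, i, i] @ v'#}"
| eqv_exchange: "length (u @ [i, i, j] @ v) = T \<Longrightarrow> length (u' @ [i, j, j] @ v') = T \<Longrightarrow> 4 \<le> T \<Longrightarrow> i \<noteq> j \<Longrightarrow>
    eqv T {#u @ [i, i, j] @ v, u' @ [i, j, j] @ v'#} {#u @ [i, j, j] @ v, u' @ [i, i, j] @ v'#}"
| eqv_slide: "0 < a \<Longrightarrow> 0 < b \<Longrightarrow> 0 < c \<Longrightarrow> 0 < d \<Longrightarrow> a < T \<Longrightarrow> b < T \<Longrightarrow> c < T \<Longrightarrow> d < T \<Longrightarrow>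
    c + d + 1 = a + b + T \<Longrightarrow> i \<noteq> j \<Longrightarrow>
    eqv T {#replicate T i, replicate a i @ replicate (T - a) j, replicate b i @ replicate (T - b) j#}
          {#replicate T j, replicate c i @ replicate (T - c) j, replicate d i @ replicate (T - d) j#}"

lemma eqv_add_mset: "eqv T M N \<Longrightarrow> eqv T (add_mset w M) (add_mset w N)"
  using eqv_add[of T M N "{#w#}"] by simp

text \<open>Every generator is stated for arbitrary states \<open>i\<close> and \<open>j\<close>, so
  its image under interchange of the states is again an instance. This is what reduces the final
  statement to the case b12 >= b21.\<close>

lemma eqv_flip: "eqv T (M :: bool list multiset) N \<Longrightarrow> eqv T (image_mset (map Not) M) (image_mset (map Not) N)"
proof (induction rule: eqv.induct)
  case (eqv_loops u i x y v)
  then show ?case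
    using eqv.eqv_loops[of "map Not u" "\<not> i" "map Not x" "map Not y" "map Not v" T] by simp
next
  case (eqv_rotate i x j y)
  then show ?case using eqv.eqv_rotate[of "\<not> i" "map Not x" "\<not> j" "map Not y" T] by simp
next
  case (eqv_cross u i v u' v')
  then show ?case
    using eqv.eqv_cross[of "map Not u" "\<not> i" "map Not v" T "map Not u'" "map Not v'"] by simp
next
  case (eqv_square u i j v u' v')
  then show ?case
    using eqv.eqv_square[of "map Not u" "\<not> i" "\<not> j" "map Not v" T "map Not u'" "map Not v'"] by simp
next
  case (eqv_exchange u i j v u' v')
  then show ?case
    using eqv.eqv_exchange[of "map Not u" "\<not> i" "\<not> j" "map Not v" T "map Not u'" "map Not v'"] by simp
next
  case (eqv_slide a b c d i j)
  then show ?case using eqv.eqv_slide[of a b c d T "\<not> i" "\<not> j"] by simp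
qed (auto intro: eqv_refl eqv_sym eqv_trans eqv_add)

lemma eqv_tr: "eqv T M N \<Longrightarrow> (\<Sum>w\<in>#M. tr a b w) = (\<Sum>w\<in>#N. tr a b w)"
proof (induction rule: eqv.induct)
  case (eqv_loops u i x y v)
  have "tr a b (u @ (i # x) @ (i # y) @ (i # v)) =
      tr a b (u @ [i]) + (tr a b (i # x @ [i]) + (tr a b (i # y @ [i]) + tr a b (i # v)))" for x y
    using tr_split[of a b u i "x @ i # y @ i # v"] tr_split[of a b "i # x" i "y @ i # v"]
      tr_split[of a b "i # y" i v] by simp
  then show ?case by simp
next
  case (eqv_rotate i x j y)
  have "tr a b ((i # x) @ (j # y) @ [i]) = tr a b (i # x @ [j]) + tr a b (j # y @ [i])" for x y i j
    using tr_split[of a b "i # x" j "y @ [i]"] by simp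
  then show ?case by simp
next
  case (eqv_cross u i v u' v')
  show ?case
    by (simp add: tr_split[of a b u i v] tr_split[of a b u i v'] tr_split[of a b u' i v]
      tr_split[of a b u' i v'] del: tr.simps)
next
  case (eqv_square u i j v u' v')
  have "tr a b (w @ [x, y, z] @ t) = tr a b (w @ [x]) + tr a b [x, y, z] + tr a b (z # t)" for w t x y z
    using tr_split[of a b w x "y # z # t"] by simp
  then show ?case by (simp)
next
  case (eqv_exchange u i j v u' v')
  have "tr a b (w @ [x, y, z] @ t) = tr a b (w @ [x]) + tr a b [x, y, z] + tr a b (z # t)" for w t x y z
    using tr_split[of a b w x "y # z # t"] by simp
  then show ?case by (simp)
next
  case (eqv_slide c d e f i j)
  \<comment> \<open>\<open>R k\<close> is the count in the step word with \<open>k\<close> letters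
    \<open>i\<close>. The relation between the four lengths says that the \<open>T - 1\<close> loops
    \<open>ii\<close> of the constant word are absorbed by the two step words.\<close>
  define R where "R k = of_bool (a = i \<and> b = i) * (k - 1) + of_bool (i = a \<and> j = b) +
      of_bool (a = j \<and> b = j) * (T - k - 1)" for k
  have step: "tr a b (replicate k i @ replicate (T - k) j) = R k" if "k \<in> {c, d, e, f}" for k
    unfolding R_def using that eqv_slide(1-8) by (intro tr_replicate_append) auto
  have "of_bool (a = i \<and> b = i) * (T - 1) + (R c + R d) = of_bool (a = j \<and> b = j) * (T - 1) + (R e + R f)"
    unfolding R_def using eqv_slide(1-9) eqv_slide(10) by (cases "a = i"; cases "b = i"; cases "a = j"; cases "b = j") auto
  then show ?case by (simp add: step tr_replicate)
qed auto
lemma eqv_length: "eqv T M N \<Longrightarrow> (\<forall>w\<in>#M. length w = T) = (\<forall>w\<in>#N. length w = T)"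
  by (induction rule: eqv.induct) (auto simp: ac_simps)

lemma eqv_size: "eqv T M N \<Longrightarrow> size M = size N"
  by (induction rule: eqv.induct) auto

section \<open>Rearranging a single path with prescribed transition counts\<close>

lemma loop_front:
  assumes "tr i i (i # v) \<ge> 1" "length (u @ i # v) = T"
  shows "\<exists>v'. eqv T {#u @ i # v#} {#u @ i # i # v'#} \<and> length v = Suc (length v')"
proof -
  obtain p q where pq: "i # v = p @ i # i # q" using tr_pos[OF assms(1)] by blast
  show ?thesis
  proof (cases p)
    case Nil
    then show ?thesis using pq by (auto intro: eqv_refl)
  next
    case (Cons k p')
    then have [simp]: "k = i" "v = p' @ i # i # q" using pq by auto
    \<comment> \<open>The part before the loop and the loop itself are consecutive cycles at
      \<open>i\<close>, so they can be interchanged.\<close>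
    have "eqv T {#u @ (i # p') @ (i # []) @ (i # q)#} {#u @ (i # []) @ (i # p') @ (i # q)#}"
      using assms(2) by (intro eqv_loops) simp
    then show ?thesis by (intro exI[of _ "p' @ i # q"]) simp
  qed
qed

text \<open>Induction on the part that may still differ. With two states, words that disagree right
  after \<open>i\<close> continue with \<open>i\<close> in one case and with the other state in the
  other. Equal counts provide the second word with a loop \<open>ii\<close> further on, and bringing
  it forward makes the next letters agree.\<close>

lemma eqv_same_start:
  fixes i :: bool
  assumes "length (u @ i # v) = T" "length v' = length v"
    "\<And>a b. tr a b (i # v) = tr a b (i # v')"
  shows "eqv T {#u @ i # v#} {#u @ i # v'#}"
  using assms
proof (induction "length v" arbitrary: u i v v')
  case 0 show ?case using 0(1,3) by (simp add: eqv_refl)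
next
  case (Suc n)
  obtain x s where v: "v = x # s" using Suc.hyps(2) by (cases v) auto
  obtain x' s' where v': "v' = x' # s'" using Suc.hyps(2) Suc.prems(2) by (cases v') auto
  have step: "eqv T {#u @ i # y # z#} {#u @ i # y # z'#}"
    if "length (u @ i # y # z) = T" "length z' = length z" "length z = n"
      "\<And>a b. tr a b (i # y # z) = tr a b (i # y # z')" for y z z'
  proof -
    have "tr a b (y # z) = tr a b (y # z')" for a b using that(4)[of a b] by simp
    then have "eqv T {#(u @ [i]) @ y # z#} {#(u @ [i]) @ y # z'#}"
      by (rule Suc.hyps(1)[OF that(3)[symmetric] _ that(2), rotated]) (use that(1) in simp)
    then show ?thesis by simp
  qed
  have main: "eqv T {#u @ i # y # z#} {#u @ i # y' # z'#}"
    if "length (u @ i # y # z) = T" "length z' = length z" "length z = n" "y = i" "y' \<noteq> i"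
      "\<And>a b. tr a b (i # y # z) = tr a b (i # y' # z')" for y y' z z'
  proof -
    note prem = that
    have "tr i i (i # y' # z') = tr i i (i # y # z)" by (rule prem(6)[symmetric])
    also have "\<dots> \<ge> 1" using prem(4) by simp
    finally have pos: "tr i i (i # y' # z') \<ge> 1" .
    have len: "length (u @ i # y' # z') = T" using prem(1,2) by simp
    obtain t where "eqv T {#u @ i # y' # z'#} {#u @ i # i # t#} \<and> length (y' # z') = Suc (length t)"
      by (rule exE[OF loop_front[OF pos len]])
    note t = conjunct1[OF this] conjunct2[OF this]
    have tt: "tr a b (u @ i # i # t) = tr a b (u @ i # y' # z')" for a b
      using eqv_tr[OF t(1), of a b] by simp
    have tt': "tr a b (i # i # t) = tr a b (i # y' # z')" for a b
      using tt[of a b] tr_split[of a b u i "i # t"] tr_split[of a b u i "y' # z'"] by simp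
    have "eqv T {#u @ i # i # z#} {#u @ i # i # t#}"
    proof (rule step)
      show "length (u @ i # i # z) = T" using prem(1,4) by simp
      show "length t = length z" using prem(2) t(2) by simp
      show "length z = n" using prem(3) .
      show "tr a b (i # i # z) = tr a b (i # i # t)" for a b using prem(6)[of a b] tt'[of a b] unfolding prem(4) by (rule trans[OF _ sym])
    qed
    then show ?thesis unfolding prem(4) by (rule eqv_trans[OF _ eqv_sym[OF t(1)]])
  qed
  have len: "length (u @ i # x # s) = T" "length s' = length s" "length s = n"
    "length (u @ i # x' # s') = T" "length s = length s'" "length s' = n"
    using Suc.prems(1,2) Suc.hyps(2) unfolding v v' by simp_all
  note eq = Suc.prems(3)[unfolded v v']
  show ?case unfolding v v'
  proof (cases "x = x'")
    case True
    then show "eqv T {#u @ i # x # s#} {#u @ i # x' # s'#}"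
      using step[OF len(1-3) eq[folded True]] by (simp only:)
  next
    case False
    show "eqv T {#u @ i # x # s#} {#u @ i # x' # s'#}"
    proof (cases "x = i")
      case True
      with False show ?thesis by (intro main[OF len(1-3) _ _ eq]) simp_all
    next
      case x: False
      with False have "x' = i" by blast
      then show ?thesis using x by (intro eqv_sym[OF main[OF len(4-6) _ _ eq[symmetric]]]) simp_all
    qed
  qed
qed

lemma eqv_rotate_start:
  assumes "length (i # v) = T" "last (i # v) = i" "j \<in> set v" "j \<noteq> i"
  shows "\<exists>v'. eqv T {#i # v#} {#j # v'#} \<and> length v' = length v"
proof -
  obtain x y where v: "v = x @ j # y" using assms(3) by (meson split_list)
  have y: "y \<noteq> []" using assms(2,4) unfolding v by (intro notI) simp
  then have "last y = i" using assms(2) unfolding v by simp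
  then obtain z where "y = z @ [i]" using y by (metis append_butlast_last_id)
  then have "eqv T {#i # v#} {#(j # z) @ (i # x) @ [j]#}"
    using eqv.eqv_rotate[of i x j z T] assms v by simp
  then show ?thesis using v \<open>y = z @ [i]\<close> by (intro exI[of _ "z @ (i # x) @ [j]"]) simp
qed

text \<open>When the initial states differ, equality of the switch counts forces both words to be
  closed, so one of them can be rotated to start like the other.\<close>

lemma eqv_same_transitions:
  fixes w :: "bool list"
  assumes len: "length w = T" "length w' = T" and eq: "\<And>a b. tr a b w = tr a b w'" and T2: "2 \<le> T"
  shows "eqv T {#w#} {#w'#}"
proof -
  obtain i v where w: "w = i # v" using len T2 by (cases w) auto
  obtain j v' where w': "w' = j # v'" using len T2 by (cases w') auto
  have same: "eqv T {#i # v#} {#i # v'#}" if "length (i # v) = T" "length (i # v') = T"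
    "\<And>a b. tr a b (i # v) = tr a b (i # v')" for i :: bool and v v'
    using eqv_same_start[of "[]" i v T v', OF _ _ that(3)] that(1,2) by simp
  show ?thesis
  proof (cases "i = j")
    case True
    then have w'': "w' = i # v'" using w' by simp
    show ?thesis using same[OF len[unfolded w w''] eq[unfolded w w'']] unfolding w w'' .
  next
    case ij: False
    have "up w + of_bool (last w) = dn w + of_bool i" "up w + of_bool (last w') = dn w + of_bool j"
      using up_dn[of w] up_dn[of w'] eq[of True False] eq[of False True]
      by (simp_all add: w w')
    then have last: "last w = i" using ij by (cases i; cases j; cases "last w"; cases "last w'"; simp)
    \<comment> \<open>If \<open>w\<close> avoided \<open>j\<close>, both words would be constant in
      different states, and their loops \<open>ii\<close> would number \<open>T - 1\<close> and
      0.\<close>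
    have j: "j \<in> set v"
    proof (rule ccontr)
      assume "j \<notin> set v"
      then have "x = i" if "x \<in> set v" for x using that ij by (cases "x = j") auto
      then have "set w \<subseteq> {i}" unfolding w by auto
      then have wi: "w = replicate T i" using len(1) by (metis replicate_eqI singletonD subsetD)
      then have "up w = 0" "dn w = 0" by (simp_all add: tr_replicate)
      then have "up w' = 0" "dn w' = 0" using eq by simp_all
      then have wj: "w' = replicate T j" using no_switch[of w'] len(2) w' by (metis list.distinct(1) list.sel(1))
      have "tr i i w = T - 1" "tr i i w' = 0" using ij unfolding wi wj by (simp_all add: tr_replicate)
      then show False using T2 eq[of i i] by simp
    qed
    obtain s where s: "eqv T {#w#} {#j # s#}" "length s = length v"
      using eqv_rotate_start[OF len(1)[unfolded w] last[unfolded w] j] ij unfolding w by metis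
    have "tr a b (j # s) = tr a b (j # v')" for a b
      using eqv_tr[OF s(1), of a b] eq[of a b] unfolding w' by simp
    then have "eqv T {#j # s#} {#w'#}"
      unfolding w' using len s(2) unfolding w w' by (intro same) simp_all
    then show ?thesis by (rule eqv_trans[OF s(1)])
  qed
qed

lemma eqv_same_type:
  assumes "length w = T" "length w' = T" "up w = up w'" "dn w = dn w'" "l2 w = l2 w'" "2 \<le> T"
  shows "eqv T {#w#} {#w'#}"
proof (rule eqv_same_transitions)
  have "w \<noteq> []" "w' \<noteq> []" using assms by auto
  then have "l1 w = l1 w'" using tr_total[of w] tr_total[of w'] assms by simp
  then show "tr a b w = tr a b w'" for a b using assms by (cases a; cases b) auto
qed (use assms in auto)

lemma eqv_pair:
  assumes "eqv T {#v#} {#v'#}" "eqv T {#w#} {#w'#}"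
  shows "eqv T {#v, w#} {#v', w'#}"
proof -
  have "eqv T {#v, w#} {#v', w#}"
    using eqv_add[OF assms(1), of "{#w#}"] by (simp add: add_mset_commute)
  moreover have "eqv T {#v', w#} {#v', w'#}"
    using eqv_add[OF assms(2), of "{#v'#}"] by (simp add: add_mset_commute)
  ultimately show ?thesis by (rule eqv_trans)
qed

section \<open>Exchanges between two words\<close>

text \<open>One letter of a loop \<open>ii\<close> is taken out and put back in front of an
  occurrence of \<open>ij\<close>. The loop moves, the counts stay.\<close>

lemma rep_first_double:
  assumes "tr i i w \<ge> 1" "tr i j w \<ge> 1" "i \<noteq> j"
  shows "\<exists>u v. (\<forall>a b. tr a b (u @ [i, i, j] @ v) = tr a b w) \<and> length (u @ [i, i, j] @ v) = length w"
proof -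
  obtain p q where w: "w = p @ i # i # q" using tr_pos[OF assms(1)] by blast
  have w0: "tr a b w = tr a b (p @ i # q) + of_bool (i = a \<and> i = b)" for a b
    unfolding w using tr_split[of a b p i "i # q"] tr_split[of a b p i q] by simp
  then have "tr i j (p @ i # q) \<ge> 1" using assms by simp
  then obtain u v where uv: "p @ i # q = u @ i # j # v" using tr_pos by metis
  have "tr a b (u @ [i, i, j] @ v) = tr a b (u @ i # j # v) + of_bool (i = a \<and> i = b)" for a b
    using tr_split[of a b u i "i # j # v"] tr_split[of a b u i "j # v"] by simp
  moreover have "length (u @ [i, i, j] @ v) = length w"
    using arg_cong[OF uv, of length] unfolding w by simp
  ultimately show ?thesis using w0 uv by metis
qed

lemma rep_second_double:
  assumes "tr j j w \<ge> 1" "tr i j w \<ge> 1" "i \<noteq> j"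
  shows "\<exists>u v. (\<forall>a b. tr a b (u @ [i, j, j] @ v) = tr a b w) \<and> length (u @ [i, j, j] @ v) = length w"
proof -
  obtain p q where w: "w = p @ j # j # q" using tr_pos[OF assms(1)] by blast
  have w0: "tr a b w = tr a b (p @ j # q) + of_bool (j = a \<and> j = b)" for a b
    unfolding w using tr_split[of a b p j "j # q"] tr_split[of a b p j q] by simp
  then have "tr i j (p @ j # q) \<ge> 1" using assms by simp
  then obtain u v where uv: "p @ j # q = u @ i # j # v" using tr_pos by metis
  have "tr a b (u @ [i, j, j] @ v) = tr a b (u @ i # j # v) + of_bool (j = a \<and> j = b)" for a b
    using tr_split[of a b u i "j # j # v"] tr_split[of a b u i "j # v"] by simp
  moreover have "length (u @ [i, j, j] @ v) = length w"
    using arg_cong[OF uv, of length] unfolding w by simp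
  ultimately show ?thesis using w0 uv by metis
qed

lemma tr_first_second:
  "i \<noteq> j \<Longrightarrow> tr a b (u @ [i, j, j] @ v) + of_bool (i = a \<and> i = b) =
     tr a b (u @ [i, i, j] @ v) + of_bool (j = a \<and> j = b)"
  using tr_split[of a b u i "j # j # v"] tr_split[of a b u i "i # j # v"] by simp

text \<open>Both words are rearranged so that the loop to be given away sits next to a switch
  \<open>ij\<close>; there a move of type (iv) applies, whatever the times of the two
  windows.\<close>

lemma loop_exchange_same_direction:
  fixes i j :: bool
  assumes "4 \<le> T" "length \<alpha> = T" "length \<beta> = T" "i \<noteq> j"
    "tr i i \<alpha> \<ge> 1" "tr i j \<alpha> \<ge> 1" "tr j j \<beta> \<ge> 1" "tr i j \<beta> \<ge> 1"
  shows "\<exists>\<alpha>' \<beta>'. eqv T {#\<alpha>, \<beta>#} {#\<alpha>', \<beta>'#} \<and> length \<alpha>' = T \<and> length \<beta>' = T \<and>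
    tr i j \<alpha>' = tr i j \<alpha> \<and> tr j i \<alpha>' = tr j i \<alpha> \<and> tr i i \<alpha> = tr i i \<alpha>' + 1 \<and> tr j j \<alpha>' = tr j j \<alpha> + 1 \<and>
    tr i j \<beta>' = tr i j \<beta> \<and> tr j i \<beta>' = tr j i \<beta> \<and> tr i i \<beta>' = tr i i \<beta> + 1 \<and> tr j j \<beta> = tr j j \<beta>' + 1"
proof -
  obtain u v where uv: "\<And>a b. tr a b (u @ [i, i, j] @ v) = tr a b \<alpha>" "length (u @ [i, i, j] @ v) = T"
    using rep_first_double[of i \<alpha> j] assms by metis
  obtain u' v' where uv': "\<And>a b. tr a b (u' @ [i, j, j] @ v') = tr a b \<beta>" "length (u' @ [i, j, j] @ v') = T"
    using rep_second_double[of j \<beta> i] assms by metis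
  have "eqv T {#\<alpha>, \<beta>#} {#u @ [i, i, j] @ v, u' @ [i, j, j] @ v'#}"
    using assms uv uv' by (intro eqv_pair eqv_same_transitions) simp_all
  then have "eqv T {#\<alpha>, \<beta>#} {#u @ [i, j, j] @ v, u' @ [i, i, j] @ v'#}"
    by (rule eqv_trans) (rule eqv_exchange[OF uv(2) uv'(2) assms(1,4)])
  note E = this
  have "tr a b (u @ [i, j, j] @ v) + of_bool (i = a \<and> i = b) = tr a b \<alpha> + of_bool (j = a \<and> j = b)" for a b
    using tr_first_second[OF assms(4), of a b u v] uv(1)[of a b] by simp
  note \<alpha> = this[of i i] this[of i j] this[of j i] this[of j j]
  have "tr a b (u' @ [i, i, j] @ v') + of_bool (j = a \<and> j = b) = tr a b \<beta> + of_bool (i = a \<and> i = b)" for a b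
    using tr_first_second[OF assms(4), of a b u' v'] uv'(1)[of a b] by simp
  note \<beta> = this[of i i] this[of i j] this[of j i] this[of j j]
  have "length (u @ [i, j, j] @ v) = T" "length (u' @ [i, i, j] @ v') = T"
    using uv(2) uv'(2) by simp_all
  then show ?thesis using E \<alpha> \<beta> assms(4)
    by (intro exI[of _ "u @ [i, j, j] @ v"] exI[of _ "u' @ [i, i, j] @ v'"]) simp
qed

text \<open>Since \<open>a < b\<close>, both words are in state \<open>j\<close> at time
  \<open>b\<close> and cross there.\<close>

lemma cross_opposite:
  assumes "0 < a" "a < b" "b < T"
  shows "eqv T {#replicate a i @ replicate (T - a) j, replicate b j @ replicate (T - b) i#}
    {#replicate a i @ replicate (b - a) j @ replicate (T - b) i, replicate T j#}"
proof -
  let ?u = "replicate a i @ replicate (b - a - 1) j" and ?u' = "replicate (b - 1) j"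
  have join: "replicate m x @ replicate n x = replicate (m + n) x" for m n and x :: 'a
    by (simp add: replicate_add)
  have rep_Suc: "x # replicate (n - Suc k) x = replicate (n - k) x" if "k < n" for k n and x :: 'a
    using that by (metis Suc_diff_Suc replicate_Suc)
  have one: "x # r = replicate 1 x @ r" for x :: 'a and r by simp
  have eqs: "?u @ j # replicate (T - b) j = replicate a i @ replicate (T - a) j"
    "?u' @ j # replicate (T - b) j = replicate T j"
    "?u' @ j # replicate (T - b) i = replicate b j @ replicate (T - b) i"
    "?u @ j # replicate (T - b) i = replicate a i @ replicate (b - a) j @ replicate (T - b) i"
    using assms unfolding one[of j] append_assoc
    by (simp_all only: join append_assoc[symmetric]) (simp_all only: join append_assoc, simp_all add: rep_Suc)
  have "eqv T {#?u @ j # replicate (T - b) j, ?u' @ j # replicate (T - b) i#}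
      {#?u @ j # replicate (T - b) i, ?u' @ j # replicate (T - b) j#}"
    using assms by (intro eqv_cross) simp_all
  then show ?thesis unfolding eqs .
qed

lemma tr_replicate_append3:
  "0 < a \<Longrightarrow> 0 < b \<Longrightarrow> 0 < c \<Longrightarrow>
     tr p q (replicate a i @ replicate b j @ replicate c k) =
       of_bool (p = i \<and> q = i) * (a - 1) + of_bool (i = p \<and> j = q) + of_bool (p = j \<and> q = j) * (b - 1) +
       of_bool (j = p \<and> k = q) + of_bool (p = k \<and> q = k) * (c - 1)"
  by (simp add: tr_append tr_replicate tr_replicate_append)

text \<open>Crossing yields a constant word and a closed word whose counts depend on
  \<open>a\<close> and \<open>b\<close> only through \<open>b - a\<close>. Lowering both by one
  therefore leads to an equivalent merged pair, which is then split again.\<close>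

lemma shorten_opposite_crossing:
  fixes i j :: bool
  assumes "2 \<le> a" "a < b" "b < T" "i \<noteq> j"
  shows "eqv T {#replicate a i @ replicate (T - a) j, replicate b j @ replicate (T - b) i#}
    {#replicate (a - 1) i @ replicate (T - (a - 1)) j, replicate (b - 1) j @ replicate (T - (b - 1)) i#}"
proof -
  have j: "j = (\<not> i)" using assms(4) by blast
  have "eqv T {#replicate a i @ replicate (b - a) j @ replicate (T - b) i, replicate T j#}
      {#replicate (a - 1) i @ replicate ((b - 1) - (a - 1)) j @ replicate (T - (b - 1)) i, replicate T j#}"
  proof (rule eqv_pair[OF eqv_same_type eqv_refl])
    let ?w = "replicate a i @ replicate (b - a) j @ replicate (T - b) i"
    let ?w' = "replicate (a - 1) i @ replicate ((b - 1) - (a - 1)) j @ replicate (T - (b - 1)) i"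
    have "tr p q ?w = of_bool (p = i \<and> q = i) * (a - 1) + of_bool (i = p \<and> j = q) + of_bool (p = j \<and> q = j) * (b - a - 1) +
       of_bool (j = p \<and> i = q) + of_bool (p = i \<and> q = i) * (T - b - 1)" for p q
      using assms by (intro tr_replicate_append3) simp_all
    moreover have "tr p q ?w' = of_bool (p = i \<and> q = i) * (a - 1 - 1) + of_bool (i = p \<and> j = q) +
       of_bool (p = j \<and> q = j) * ((b - 1) - (a - 1) - 1) +
       of_bool (j = p \<and> i = q) + of_bool (p = i \<and> q = i) * (T - (b - 1) - 1)" for p q
      using assms by (intro tr_replicate_append3) simp_all
    ultimately show "up ?w = up ?w'" "dn ?w = dn ?w'" "l2 ?w = l2 ?w'"
      using assms by (cases i; simp)+
  qed (use assms in simp_all)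
  moreover have "eqv T {#replicate a i @ replicate (T - a) j, replicate b j @ replicate (T - b) i#}
      {#replicate a i @ replicate (b - a) j @ replicate (T - b) i, replicate T j#}"
    using assms by (intro cross_opposite) simp_all
  moreover have "eqv T {#replicate (a - 1) i @ replicate (T - (a - 1)) j, replicate (b - 1) j @ replicate (T - (b - 1)) i#}
      {#replicate (a - 1) i @ replicate ((b - 1) - (a - 1)) j @ replicate (T - (b - 1)) i, replicate T j#}"
    using assms by (intro cross_opposite) simp_all
  ultimately show ?thesis by (blast intro: eqv_trans eqv_sym)
qed

lemma shorten_opposite:
  fixes i j :: bool
  assumes "2 \<le> a" "a < T" "2 \<le> b" "b < T" "i \<noteq> j"
  shows "eqv T {#replicate a i @ replicate (T - a) j, replicate b j @ replicate (T - b) i#}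
    {#replicate (a - 1) i @ replicate (T - (a - 1)) j, replicate (b - 1) j @ replicate (T - (b - 1)) i#}"
proof -
  consider "a < b" | "b < a" | "a = b" by linarith
  then show ?thesis
  proof cases
    case 1
    then show ?thesis using assms by (intro shorten_opposite_crossing)
  next
    case 2
    then show ?thesis using shorten_opposite_crossing[of b a T j i] assms by (simp add: add_mset_commute)
  next
    case 3
    \<comment> \<open>Complementary words have no state in common, so no crossing is possible. The 2
      by 2 swap at times \<open>a - 1\<close> and \<open>a\<close> moves both switches at
      once.\<close>
    define c d where "c = a - 2" and "d = T - a - 1"
    have cd: "a = c + 2" "a - 1 = c + 1" "T - a = Suc d" "T - (a - 1) = Suc (Suc d)" "T = c + d + 3"
      using assms(1,2) unfolding c_def d_def by simp_all
    have "replicate a x = replicate c x @ [x, x]" "replicate (a - 1) x = replicate c x @ [x]"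
      "replicate (T - a) x = x # replicate d x" "replicate (T - (a - 1)) x = [x, x] @ replicate d x" for x :: bool
      using replicate_add[of c 2 x] replicate_add[of c 1 x] 
      by (simp_all add: cd(1,5) numeral_2_eq_2 numeral_3_eq_3)
    then have "replicate a x @ replicate (T - a) y = replicate c x @ [x, x, y] @ replicate d y"
      "replicate (a - 1) x @ replicate (T - (a - 1)) y = replicate c x @ [x, y, y] @ replicate d y" for x y :: bool
      by simp_all
    then have eqs: "replicate a i @ replicate (T - a) j = replicate c i @ [i, i, j] @ replicate d j"
      "replicate b j @ replicate (T - b) i = replicate c j @ [j, j, i] @ replicate d i"
      "replicate (a - 1) i @ replicate (T - (a - 1)) j = replicate c i @ [i, j, j] @ replicate d j"
      "replicate (b - 1) j @ replicate (T - (b - 1)) i = replicate c j @ [j, i, i] @ replicate d i"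
      unfolding 3[symmetric] by blast+
    show ?thesis unfolding eqs using assms(5) by (intro eqv_square) (simp_all add: cd(5))
  qed
qed

text \<open>With a single switch, the number of loops 22 fixes the time of the switch. The exponent
  \<open>T - (T - Suc (l2 w))\<close> keeps the form i^a j^(T-a) that
  \<open>shorten_opposite\<close> and \<open>cross_opposite\<close> expect.\<close>

lemma rep_up:
  assumes "length w = T" "up w = 1" "dn w = 0" "2 \<le> T"
  shows "eqv T {#w#} {#replicate (T - Suc (l2 w)) True @ replicate (T - (T - Suc (l2 w))) False#}"
    "l1 w + l2 w + 2 = T"
proof -
  show eq: "l1 w + l2 w + 2 = T" using tr_total[of w] assms by (cases "w = []") simp_all
  have "tr p q (replicate (T - Suc (l2 w)) True @ replicate (T - (T - Suc (l2 w))) False) =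
      of_bool (p = True \<and> q = True) * (T - Suc (l2 w) - 1) + of_bool (True = p \<and> False = q) + of_bool (p = False \<and> q = False) * (T - (T - Suc (l2 w)) - 1)" for p q
    using eq by (intro tr_replicate_append) simp_all
  then show "eqv T {#w#} {#replicate (T - Suc (l2 w)) True @ replicate (T - (T - Suc (l2 w))) False#}"
    using eq assms by (intro eqv_same_type) simp_all
qed

lemma rep_dn:
  assumes "length w = T" "up w = 0" "dn w = 1" "2 \<le> T"
  shows "eqv T {#w#} {#replicate (Suc (l2 w)) False @ replicate (T - Suc (l2 w)) True#}"
    "l1 w + l2 w + 2 = T"
proof -
  show eq: "l1 w + l2 w + 2 = T" using tr_total[of w] assms by (cases "w = []") simp_all
  have "tr p q (replicate (Suc (l2 w)) False @ replicate (T - Suc (l2 w)) True) =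
      of_bool (p = False \<and> q = False) * (Suc (l2 w) - 1) + of_bool (False = p \<and> True = q) + of_bool (p = True \<and> q = True) * (T - Suc (l2 w) - 1)" for p q
    using eq by (intro tr_replicate_append) simp_all
  then show "eqv T {#w#} {#replicate (Suc (l2 w)) False @ replicate (T - Suc (l2 w)) True#}"
    using eq assms by (intro eqv_same_type) simp_all
qed

lemma loop_exchange_opposite_up:
  assumes "length \<alpha> = T" "length \<beta> = T" "up \<alpha> = 1" "dn \<alpha> = 0" "up \<beta> = 0" "dn \<beta> = 1"
    "l1 \<alpha> \<ge> 1" "l2 \<beta> \<ge> 1"
  shows "\<exists>\<alpha>' \<beta>'. eqv T {#\<alpha>, \<beta>#} {#\<alpha>', \<beta>'#} \<and> length \<alpha>' = T \<and> length \<beta>' = T \<and>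
    up \<alpha>' = 1 \<and> dn \<alpha>' = 0 \<and> l2 \<alpha>' = l2 \<alpha> + 1 \<and> up \<beta>' = 0 \<and> dn \<beta>' = 1 \<and> l2 \<beta> = l2 \<beta>' + 1"
proof -
  have T: "2 \<le> T" using tr_total[of \<alpha>] assms by (cases "\<alpha> = []") simp_all
  note ra = rep_up[OF assms(1,3,4) T] and rb = rep_dn[OF assms(2,5,6) T]
  let ?a = "T - Suc (l2 \<alpha>)" and ?b = "Suc (l2 \<beta>)"
  let ?\<alpha> = "replicate (?a - 1) True @ replicate (T - (?a - 1)) False"
  let ?\<beta> = "replicate (?b - 1) False @ replicate (T - (?b - 1)) True"
  have ab: "2 \<le> ?a" "?a < T" "2 \<le> ?b" "?b < T" using ra(2) rb(2) assms by linarith+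
  have "eqv T {#\<alpha>, \<beta>#} {#?\<alpha>, ?\<beta>#}"
    by (rule eqv_trans[OF eqv_pair[OF ra(1) rb(1)] shorten_opposite]) (use ab in simp_all)
  moreover have "tr p q ?\<alpha> = of_bool (p = True \<and> q = True) * (?a - 1 - 1) + of_bool (True = p \<and> False = q) +
      of_bool (p = False \<and> q = False) * (T - (?a - 1) - 1)" for p q
    using ab by (intro tr_replicate_append) simp_all
  then have "up ?\<alpha> = 1" "dn ?\<alpha> = 0" "l2 ?\<alpha> = l2 \<alpha> + 1" using ab by simp_all
  moreover have "tr p q ?\<beta> = of_bool (p = False \<and> q = False) * (?b - 1 - 1) + of_bool (False = p \<and> True = q) +
      of_bool (p = True \<and> q = True) * (T - (?b - 1) - 1)" for p q
    using ab by (intro tr_replicate_append) simp_all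
  then have "up ?\<beta> = 0" "dn ?\<beta> = 1" "l2 \<beta> = l2 ?\<beta> + 1" using ab by simp_all
  moreover have "length ?\<alpha> = T" "length ?\<beta> = T" using ab by simp_all
  ultimately show ?thesis by blast
qed

lemma loop_exchange_opposite_dn:
  assumes "length \<alpha> = T" "length \<beta> = T" "up \<alpha> = 0" "dn \<alpha> = 1" "up \<beta> = 1" "dn \<beta> = 0"
    "l1 \<alpha> \<ge> 1" "l2 \<beta> \<ge> 1"
  shows "\<exists>\<alpha>' \<beta>'. eqv T {#\<alpha>, \<beta>#} {#\<alpha>', \<beta>'#} \<and> length \<alpha>' = T \<and> length \<beta>' = T \<and>
    up \<alpha>' = 0 \<and> dn \<alpha>' = 1 \<and> l2 \<alpha>' = l2 \<alpha> + 1 \<and> up \<beta>' = 1 \<and> dn \<beta>' = 0 \<and> l2 \<beta> = l2 \<beta>' + 1"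
proof -
  have T: "2 \<le> T" using tr_total[of \<alpha>] assms by (cases "\<alpha> = []") simp_all
  note ra = rep_dn[OF assms(1,3,4) T] and rb = rep_up[OF assms(2,5,6) T]
  let ?a = "Suc (l2 \<alpha>)" and ?b = "T - Suc (l2 \<beta>)"
  let ?\<alpha> = "replicate (?a + 1) False @ replicate (T - (?a + 1)) True"
  let ?\<beta> = "replicate (?b + 1) True @ replicate (T - (?b + 1)) False"
  have ab: "1 \<le> ?a" "?a + 1 < T" "1 \<le> ?b" "?b + 1 < T" using ra(2) rb(2) assms by linarith+
  \<comment> \<open>Here both switches have to occur later, so the shortening is applied to the
    target words and read backwards.\<close>
  have "eqv T {#?\<alpha>, ?\<beta>#} {#replicate ?a False @ replicate (T - ?a) True, replicate ?b True @ replicate (T - ?b) False#}"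
    using shorten_opposite[of "?a + 1" T "?b + 1" False True] ab by simp
  from eqv_trans[OF eqv_pair[OF ra(1) rb(1)] eqv_sym[OF this]]
  have "eqv T {#\<alpha>, \<beta>#} {#?\<alpha>, ?\<beta>#}" .
  moreover have "tr p q ?\<beta> = of_bool (p = True \<and> q = True) * (?b + 1 - 1) + of_bool (True = p \<and> False = q) +
      of_bool (p = False \<and> q = False) * (T - (?b + 1) - 1)" for p q
    using ab by (intro tr_replicate_append) simp_all
  then have "up ?\<beta> = 1" "dn ?\<beta> = 0" "l2 \<beta> = l2 ?\<beta> + 1" using ab by simp_all
  moreover have "tr p q ?\<alpha> = of_bool (p = False \<and> q = False) * (?a + 1 - 1) + of_bool (False = p \<and> True = q) +
      of_bool (p = True \<and> q = True) * (T - (?a + 1) - 1)" for p q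
    using ab by (intro tr_replicate_append) simp_all
  then have "up ?\<alpha> = 0" "dn ?\<alpha> = 1" "l2 ?\<alpha> = l2 \<alpha> + 1" using ab by simp_all
  moreover have "length ?\<alpha> = T" "length ?\<beta> = T" using ab by simp_all
  ultimately show ?thesis by blast
qed

text \<open>Nonconstant words either share a direction of switching, or switch exactly once each and
  in opposite directions; the exchanges established for these two situations cover
  everything.\<close>

lemma loop_exchange:
  assumes T: "3 \<le> T" and len: "length \<alpha> = T" "length \<beta> = T"
    and sw: "up \<alpha> + dn \<alpha> \<ge> 1" "up \<beta> + dn \<beta> \<ge> 1" and l: "l1 \<alpha> \<ge> 1" "l2 \<beta> \<ge> 1"
  shows "\<exists>\<alpha>' \<beta>'. eqv T {#\<alpha>, \<beta>#} {#\<alpha>', \<beta>'#} \<and> length \<alpha>' = T \<and> length \<beta>' = T \<and>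
    up \<alpha>' = up \<alpha> \<and> dn \<alpha>' = dn \<alpha> \<and> l2 \<alpha>' = l2 \<alpha> + 1 \<and>
    up \<beta>' = up \<beta> \<and> dn \<beta>' = dn \<beta> \<and> l2 \<beta> = l2 \<beta>' + 1"
proof -
  have ne: "\<alpha> \<noteq> []" "\<beta> \<noteq> []" using T len by auto
  note tot = tr_total[OF ne(1)] tr_total[OF ne(2)]
  note bal = up_le[OF ne(1)] up_le[OF ne(2)] dn_le[OF ne(1)] dn_le[OF ne(2)]
  \<comment> \<open>Moves of type (iv) start at T = 4. For T = 3 each word has one switch and one
    loop, and the exchange merely interchanges the roles of the two words.\<close>
  have short: ?thesis if "T = 3" "up \<alpha> = up \<beta>" "dn \<alpha> = dn \<beta>"
  proof -
    have "l1 \<alpha> = 1" "l2 \<alpha> = 0" "l1 \<beta> = 0" "l2 \<beta> = 1" using tot len sw l that by linarith+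
    then show ?thesis using that len
      by (intro exI[of _ \<beta>] exI[of _ \<alpha>]) (simp add: add_mset_commute eqv_refl)
  qed
  consider (up) "up \<alpha> \<ge> 1" "up \<beta> \<ge> 1" | (dn) "dn \<alpha> \<ge> 1" "dn \<beta> \<ge> 1"
    | (opp_up) "up \<alpha> \<ge> 1" "dn \<alpha> = 0" "up \<beta> = 0" "dn \<beta> \<ge> 1"
    | (opp_dn) "up \<alpha> = 0" "dn \<alpha> \<ge> 1" "up \<beta> \<ge> 1" "dn \<beta> = 0"
    using sw by (metis add_cancel_right_left less_one not_le)
  then show ?thesis
  proof cases
    case up
    show ?thesis
    proof (cases "T = 3")
      case True
      have "up \<alpha> = 1" "up \<beta> = 1" "dn \<alpha> = 0" "dn \<beta> = 0" using up tot l len True by linarith+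
      then show ?thesis using short True by simp
    next
      case False
      then have "\<exists>\<alpha>' \<beta>'. eqv T {#\<alpha>, \<beta>#} {#\<alpha>', \<beta>'#} \<and> length \<alpha>' = T \<and> length \<beta>' = T \<and>
        up \<alpha>' = up \<alpha> \<and> dn \<alpha>' = dn \<alpha> \<and> l1 \<alpha> = l1 \<alpha>' + 1 \<and> l2 \<alpha>' = l2 \<alpha> + 1 \<and>
        up \<beta>' = up \<beta> \<and> dn \<beta>' = dn \<beta> \<and> l1 \<beta>' = l1 \<beta> + 1 \<and> l2 \<beta> = l2 \<beta>' + 1"
        using T len up l by (intro loop_exchange_same_direction) simp_all
      then show ?thesis by (elim exE conjE) (intro exI conjI; assumption)
    qed
  next
    case dn
    show ?thesis
    proof (cases "T = 3")
      case True
      have "up \<alpha> = 0" "up \<beta> = 0" "dn \<alpha> = 1" "dn \<beta> = 1" using dn tot l len True by linarith+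
      then show ?thesis using short True by simp
    next
      case False
      then have "\<exists>\<beta>' \<alpha>'. eqv T {#\<beta>, \<alpha>#} {#\<beta>', \<alpha>'#} \<and> length \<beta>' = T \<and> length \<alpha>' = T \<and>
        dn \<beta>' = dn \<beta> \<and> up \<beta>' = up \<beta> \<and> l2 \<beta> = l2 \<beta>' + 1 \<and> l1 \<beta>' = l1 \<beta> + 1 \<and>
        dn \<alpha>' = dn \<alpha> \<and> up \<alpha>' = up \<alpha> \<and> l2 \<alpha>' = l2 \<alpha> + 1 \<and> l1 \<alpha> = l1 \<alpha>' + 1"
        using T len dn l by (intro loop_exchange_same_direction) simp_all
      then obtain \<beta>' \<alpha>' where *: "eqv T {#\<beta>, \<alpha>#} {#\<beta>', \<alpha>'#}"
        "length \<beta>' = T \<and> length \<alpha>' = T \<and>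
        dn \<beta>' = dn \<beta> \<and> up \<beta>' = up \<beta> \<and> l2 \<beta> = l2 \<beta>' + 1 \<and> l1 \<beta>' = l1 \<beta> + 1 \<and>
        dn \<alpha>' = dn \<alpha> \<and> up \<alpha>' = up \<alpha> \<and> l2 \<alpha>' = l2 \<alpha> + 1 \<and> l1 \<alpha> = l1 \<alpha>' + 1" by blast
      then show ?thesis by (intro exI[of _ \<alpha>'] exI[of _ \<beta>']) (simp add: add_mset_commute)
    qed
  next
    case opp_up
    then have "up \<alpha> = 1" "dn \<beta> = 1" using bal by linarith+
    then show ?thesis using loop_exchange_opposite_up[OF len] l opp_up by simp
  next
    case opp_dn
    then have "dn \<alpha> = 1" "up \<beta> = 1" using bal by linarith+
    then show ?thesis using loop_exchange_opposite_dn[OF len] l opp_dn by simp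
  qed
qed

section \<open>Transfer of a round trip between two words\<close>

lemma constant_loops:
  assumes "up w = 0" "dn w = 0" "w \<noteq> []"
  shows "l1 w = 0 \<and> l2 w = length w - 1 \<or> l2 w = 0 \<and> l1 w = length w - 1"
proof -
  have w: "w = replicate (length w) (hd w)" using no_switch assms by blast
  have "l1 w = of_bool (hd w) * (length w - 1)" "l2 w = of_bool (\<not> hd w) * (length w - 1)"
    by (subst w, subst tr_replicate, simp)+
  then show ?thesis by (cases "hd w") simp_all
qed

lemma word_length: "length (i # v) = Suc (l1 (i # v) + up (i # v) + dn (i # v) + l2 (i # v))"
  using tr_total[of "i # v"] by simp

lemma word_length_snoc: "length (v @ [i]) = Suc (l1 (v @ [i]) + up (v @ [i]) + dn (v @ [i]) + l2 (v @ [i]))"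
  using tr_total[of "v @ [i]"] by simp

text \<open>Rearranged to begin with 121 and with 111, the words meet in state 1 at time 3, and
  crossing there exchanges these beginnings. After 12 is cut off, \<open>w\<close> still has
  \<open>p + 1\<close> switches 12, so its loops 22 find a place in the remainder.\<close>

lemma cycle_transfer_l1:
  assumes len: "length w = T" "length w' = T"
    and w: "up w = p + 2" "dn w = q + 1" "q = p \<or> p + 1 = q" "l1 w = m" "l2 w = n"
    and w': "up w' = p'" "dn w' = q'" "q' = p' \<or> p' = q' + 1" "p' = 0 \<Longrightarrow> n' = 0" "l1 w' = m' + 2" "l2 w' = n'"
  shows "\<exists>\<eta> \<eta>'. eqv T {#w, w'#} {#\<eta>, \<eta>'#} \<and> length \<eta> = T \<and> length \<eta>' = T \<and>
    up w = up \<eta> + 1 \<and> dn w = dn \<eta> + 1 \<and> up \<eta>' = up w' + 1 \<and> dn \<eta>' = dn w' + 1"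
proof -
  have "\<exists>v. l1 (True # v) = m \<and> up (True # v) = p + 1 \<and> dn (True # v) = q \<and> l2 (True # v) = n"
    using w(3) by (intro ex_word_from_True) auto
  then obtain v where v: "l1 (True # v) = m" "up (True # v) = p + 1" "dn (True # v) = q" "l2 (True # v) = n"
    by blast
  have "\<exists>v. l1 (True # v) = m' \<and> up (True # v) = p' \<and> dn (True # v) = q' \<and> l2 (True # v) = n'"
    using w'(3,4) by (intro ex_word_from_True) auto
  then obtain v' where v': "l1 (True # v') = m'" "up (True # v') = p'" "dn (True # v') = q'" "l2 (True # v') = n'"
    by blast
  have T: "T = m + p + q + n + 4" "T = m' + p' + q' + n' + 3"
    using tr_total[of w] tr_total[of w'] len w w' by (cases "w = []"; cases "w' = []"; simp)+
  have "length v = m + (p + 1) + q + n" "length v' = m' + p' + q' + n'"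
    using word_length[of True v] word_length[of True v'] unfolding v v' by simp_all
  then have lv: "T = Suc (Suc (Suc (length v)))" "length v' = length v" using T by linarith+
  have "eqv T {#w, w'#} {#[True, False] @ True # v, [True, True] @ True # v'#}"
    by (intro eqv_pair eqv_same_type) (simp_all add: v v' w w' len lv)
  moreover have "eqv T {#[True, False] @ True # v, [True, True] @ True # v'#}
      {#[True, False] @ True # v', [True, True] @ True # v#}"
    using lv by (intro eqv_cross) simp_all
  ultimately have "eqv T {#w, w'#} {#[True, False] @ True # v', [True, True] @ True # v#}"
    by (rule eqv_trans)
  then show ?thesis
    by (intro exI[of _ "[True, True] @ True # v"] exI[of _ "[True, False] @ True # v'"])
      (simp add: v v' w w' lv add_mset_commute)
qed

text \<open>The time-reversed construction with endings 212 and 222. It works from the end because a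
  path from 1 to 2 can end, but not start, in state 2.\<close>

lemma cycle_transfer_l2:
  assumes len: "length w = T" "length w' = T"
    and w: "up w = p + 2" "dn w = q + 1" "q = p \<or> q = p + 1" "l1 w = m" "l2 w = n"
    and w': "up w' = p'" "dn w' = q'" "q' = p' \<or> p' = q' + 1" "p' = 0 \<Longrightarrow> m' = 0" "l1 w' = m'" "l2 w' = n' + 2"
  shows "\<exists>\<eta> \<eta>'. eqv T {#w, w'#} {#\<eta>, \<eta>'#} \<and> length \<eta> = T \<and> length \<eta>' = T \<and>
    up w = up \<eta> + 1 \<and> dn w = dn \<eta> + 1 \<and> up \<eta>' = up w' + 1 \<and> dn \<eta>' = dn w' + 1"
proof -
  have "\<exists>v. l2 (v @ [False]) = n \<and> up (v @ [False]) = p + 1 \<and> dn (v @ [False]) = q \<and> l1 (v @ [False]) = m"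
    using w(3) by (intro ex_word_to_False) auto
  then obtain v where v: "l2 (v @ [False]) = n" "up (v @ [False]) = p + 1" "dn (v @ [False]) = q" "l1 (v @ [False]) = m"
    by blast
  have "\<exists>v. l2 (v @ [False]) = n' \<and> up (v @ [False]) = p' \<and> dn (v @ [False]) = q' \<and> l1 (v @ [False]) = m'"
    using w'(3,4) by (intro ex_word_to_False) auto
  then obtain v' where v': "l2 (v' @ [False]) = n'" "up (v' @ [False]) = p'" "dn (v' @ [False]) = q'" "l1 (v' @ [False]) = m'"
    by blast
  have T: "T = m + p + q + n + 4" "T = m' + p' + q' + n' + 3"
    using tr_total[of w] tr_total[of w'] len w w' by (cases "w = []"; cases "w' = []"; simp)+
  have "length v = m + (p + 1) + q + n" "length v' = m' + p' + q' + n'"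
    using word_length_snoc[of v False] word_length_snoc[of v' False] unfolding v v' by simp_all
  then have lv: "T = Suc (Suc (Suc (length v)))" "length v' = length v" using T by linarith+
  have s: "tr a b (v @ [False, x, False]) = tr a b (v @ [False]) + tr a b [False, x, False]"
    "tr a b (v' @ [False, x, False]) = tr a b (v' @ [False]) + tr a b [False, x, False]" for a b x
    by (rule tr_split)+
  have "eqv T {#w, w'#} {#v @ [False, True, False], v' @ [False, False, False]#}"
    by (intro eqv_pair eqv_same_type) (simp_all add: s v v' w w' len lv)
  moreover have "eqv T {#v @ [False, True, False], v' @ [False, False, False]#}
      {#v @ [False, False, False], v' @ [False, True, False]#}"
    using lv by (intro eqv_cross) simp_all
  ultimately have "eqv T {#w, w'#} {#v @ [False, False, False], v' @ [False, True, False]#}"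
    by (rule eqv_trans)
  then show ?thesis
    by (intro exI[of _ "v @ [False, False, False]"] exI[of _ "v' @ [False, True, False]"])
      (simp add: s v v' w w' lv)
qed

text \<open>The condition \<open>up w' + dn w' + 2 < T\<close> says that \<open>w'\<close> has at
  least two loops, which is the room a round trip takes; \<open>2 \<le> up w\<close> keeps the donor
  nonconstant.\<close>

lemma cycle_transfer:
  assumes T: "3 \<le> T" and len: "length w = T" "length w' = T"
    and d: "dn w \<le> up w" "dn w' \<le> up w'" and v: "2 \<le> up w" "up w' + dn w' + 2 < T"
  shows "\<exists>\<eta> \<eta>'. eqv T {#w, w'#} {#\<eta>, \<eta>'#} \<and> length \<eta> = T \<and> length \<eta>' = T \<and>
    up w = up \<eta> + 1 \<and> dn w = dn \<eta> + 1 \<and> up \<eta>' = up w' + 1 \<and> dn \<eta>' = dn w' + 1"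
proof -
  have main: "\<exists>\<eta> \<eta>'. eqv T {#w, w'#} {#\<eta>, \<eta>'#} \<and> length \<eta> = T \<and> length \<eta>' = T \<and>
    up w = up \<eta> + 1 \<and> dn w = dn \<eta> + 1 \<and> up \<eta>' = up w' + 1 \<and> dn \<eta>' = dn w' + 1"
    if len: "length w = T" "length w' = T"
      and d: "dn w \<le> up w" "dn w' \<le> up w'" and v: "2 \<le> up w" and l: "2 \<le> l1 w' \<or> 2 \<le> l2 w'" for w w'
  proof -
    have ne: "w \<noteq> []" "w' \<noteq> []" using T len by auto
    obtain p where p: "up w = p + 2" using v le_Suc_ex by (metis add.commute)
    then obtain q where q: "dn w = q + 1" using up_le[OF ne(1)] by (cases "dn w") simp_all
    have pq: "q = p \<or> p + 1 = q" "q = p \<or> q = p + 1" using p q d(1) up_le[OF ne(1)] by linarith+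
    have pq': "dn w' = up w' \<or> up w' = dn w' + 1" using d(2) up_le[OF ne(2)] by linarith
    have c: "l1 w' = 0 \<or> l2 w' = 0" if "up w' = 0"
      using constant_loops[of w'] that d(2) ne by linarith
    show ?thesis
    proof (cases "2 \<le> l1 w'")
      case True
      then obtain k where k: "l1 w' = k + 2" using le_Suc_ex by (metis add.commute)
      have "up w' = 0 \<Longrightarrow> l2 w' = 0" using c k by simp
      from cycle_transfer_l1[OF len p q pq(1) HOL.refl HOL.refl HOL.refl HOL.refl pq' this k HOL.refl]
      show ?thesis .
    next
      case False
      then obtain k where k: "l2 w' = k + 2" using l le_Suc_ex by (metis add.commute)
      have "up w' = 0 \<Longrightarrow> l1 w' = 0" using c k by simp
      from cycle_transfer_l2[OF len p q pq(2) HOL.refl HOL.refl HOL.refl HOL.refl pq' this HOL.refl k]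
      show ?thesis .
    qed
  qed
  show ?thesis
  proof (cases "2 \<le> l1 w' \<or> 2 \<le> l2 w'")
    case True
    then show ?thesis using main[OF len d v(1)] by blast
  next
    case False
    \<comment> \<open>One loop of each kind: a loop exchange with w reduces to the previous case, and if w has no loop
      then the transfer only swaps the types of w and w'.\<close>
    have ne: "w \<noteq> []" "w' \<noteq> []" using T len by auto
    note tot = tr_total[OF ne(1)] tr_total[OF ne(2)]
    have one: "l1 w' = 1" "l2 w' = 1" "up w' + dn w' + 3 = T" using False tot v len by linarith+
    then have v': "up w' + dn w' \<ge> 1"
      using constant_loops[of w'] ne by (cases "up w' + dn w' = 0") (simp_all add: Suc_le_eq)
    consider "l1 w \<ge> 1" | "l2 w \<ge> 1" | "l1 w = 0" "l2 w = 0" by linarith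
    then show ?thesis
    proof cases
      case 1
      have "up w + dn w \<ge> 1" "l2 w' \<ge> 1" using v one by linarith+
      from loop_exchange[OF T len this(1) v' 1 this(2)] obtain \<alpha> \<beta> where
        *: "eqv T {#w, w'#} {#\<alpha>, \<beta>#}" "length \<alpha> = T" "length \<beta> = T" and
        **: "up \<alpha> = up w" "dn \<alpha> = dn w" "l2 \<alpha> = l2 w + 1" "up \<beta> = up w'" "dn \<beta> = dn w'" "l2 w' = l2 \<beta> + 1"
        by blast
      have "\<beta> \<noteq> []" using *(3) T by auto
      then have "l1 \<beta> = 2" using tr_total[of \<beta>] *(3) ** one T by linarith
      then have "2 \<le> l1 \<beta> \<or> 2 \<le> l2 \<beta>" by simp
      from main[OF *(2,3) _ _ _ this] obtain \<eta> \<eta>' where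
        "eqv T {#\<alpha>, \<beta>#} {#\<eta>, \<eta>'#}" "length \<eta> = T \<and> length \<eta>' = T \<and>
          up \<alpha> = up \<eta> + 1 \<and> dn \<alpha> = dn \<eta> + 1 \<and> up \<eta>' = up \<beta> + 1 \<and> dn \<eta>' = dn \<beta> + 1"
        using d v unfolding ** by blast
      from eqv_trans[OF *(1) this(1)] this(2) show ?thesis unfolding ** by blast
    next
      case 2
      have "up w + dn w \<ge> 1" "l1 w' \<ge> 1" using v one by linarith+
      from loop_exchange[OF T len(2,1) v' this(1) this(2) 2] obtain \<beta> \<alpha> where
        *: "eqv T {#w', w#} {#\<beta>, \<alpha>#}" "length \<beta> = T" "length \<alpha> = T" and
        **: "up \<alpha> = up w" "dn \<alpha> = dn w" "up \<beta> = up w'" "dn \<beta> = dn w'" "l2 \<beta> = l2 w' + 1"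
        by blast
      have "2 \<le> l1 \<beta> \<or> 2 \<le> l2 \<beta>" using ** one by simp
      from main[OF *(3,2) _ _ _ this] obtain \<eta> \<eta>' where
        "eqv T {#\<alpha>, \<beta>#} {#\<eta>, \<eta>'#}" "length \<eta> = T \<and> length \<eta>' = T \<and>
          up \<alpha> = up \<eta> + 1 \<and> dn \<alpha> = dn \<eta> + 1 \<and> up \<eta>' = up \<beta> + 1 \<and> dn \<eta>' = dn \<beta> + 1"
        using d v unfolding ** by blast
      from eqv_trans[OF *(1)[unfolded add_mset_commute[of w'] add_mset_commute[of \<beta>]] this(1)] this(2)
      show ?thesis unfolding ** by blast
    next
      case 3
      have "up w + dn w + 1 = T" using 3 tot len by linarith
      then have "up w = up w' + 1" "dn w = dn w' + 1"
        using one(3) d up_le[OF ne(1)] up_le[OF ne(2)] by linarith+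
      then show ?thesis using len
        by (intro exI[of _ w'] exI[of _ w]) (simp add: eqv_refl add_mset_commute)
    qed
  qed
qed

section \<open>Pairs of paths in opposite directions\<close>

lemma cross_complementary_ends:
  assumes len: "length w = T" "length w' = T"
    and ends: "hd w = True" "last w = False" "hd w' = False" "last w' = True"
    and ne: "w' \<noteq> map Not w"
  shows "\<exists>\<eta> \<eta>'. eqv T {#w, w'#} {#\<eta>, \<eta>'#} \<and> length \<eta> = T \<and> length \<eta>' = T \<and>
    up \<eta> = dn \<eta> \<and> up \<eta>' = dn \<eta>'"
proof -
  \<comment> \<open>Over two states, words that agree at no time are complementary. At a common
    state, crossing combines the start of each word with the end of the other, so both results are
    closed.\<close>
  have "\<exists>k < T. w ! k = w' ! k"
  proof (rule ccontr)
    assume "\<not> ?thesis"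
    then have "w' = map Not w" using len by (intro nth_equalityI) auto
    then show False using ne by simp
  qed
  then obtain k where k: "k < T" "w ! k = w' ! k" by blast
  let ?u = "take k w" and ?v = "drop (Suc k) w" and ?u' = "take k w'" and ?v' = "drop (Suc k) w'"
  have w: "w = ?u @ w ! k # ?v" "w' = ?u' @ w ! k # ?v'"
    using id_take_nth_drop[of k w] id_take_nth_drop[of k w'] k len by simp_all
  define e e' where "e = ?u @ w ! k # ?v'" and "e' = ?u' @ w ! k # ?v"
  have "eqv T {#?u @ w ! k # ?v, ?u' @ w ! k # ?v'#} {#e, e'#}"
    unfolding e_def e'_def using k len by (intro eqv_cross) simp_all
  then have eqv: "eqv T {#w, w'#} {#e, e'#}" unfolding w[symmetric] .
  have h: "hd e = hd w" "hd e' = hd w'" unfolding e_def e'_def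
    using k len by (cases k; cases w; cases w'; simp)+
  have "last w = last (w ! k # ?v)" "last w' = last (w ! k # ?v')"
    using arg_cong[OF w(1), of last] arg_cong[OF w(2), of last] by simp_all
  then have l: "last e = last w'" "last e' = last w" unfolding e_def e'_def by simp_all
  have ne: "e \<noteq> []" "e' \<noteq> []" unfolding e_def e'_def by simp_all
  have "up e = dn e" "up e' = dn e'"
    using up_dn[OF ne(1)] up_dn[OF ne(2)] unfolding h l ends by simp_all
  moreover have "length e = T" "length e' = T" unfolding e_def e'_def using k len by simp_all
  ultimately show ?thesis using eqv by blast
qed

text \<open>A round trip and a loop can be arranged in different orders: one word starts with 121,
  the other with 11 or 122 according to the kind of loop at hand.\<close>

lemma two_words:
  assumes len: "length w = T" and d: "up w = dn w + 1" "dn w \<ge> 1" "l1 w + l2 w \<ge> 1"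
  shows "\<exists>x y. x \<noteq> y \<and> length x = T \<and> length y = T \<and> up x = up w \<and> up y = up w \<and> dn x = dn w \<and> dn y = dn w \<and>
    l2 x = l2 w \<and> l2 y = l2 w"
proof -
  obtain q where q: "dn w = q + 1" using d(2) by (metis add.commute le_Suc_ex One_nat_def)
  then have p: "up w = q + 2" using d(1) by simp
  obtain m n where mn: "l1 w = m" "l2 w = n" by blast
  have "w \<noteq> []" using d(2) by auto
  then have T: "T = m + n + 2 * q + 4" using tr_total[of w] len p q mn by simp
  have "\<exists>v. l1 (True # v) = m \<and> up (True # v) = q + 1 \<and> dn (True # v) = q \<and> l2 (True # v) = n"
    by (intro ex_word_from_True) auto
  then obtain v where v: "l1 (True # v) = m" "up (True # v) = q + 1" "dn (True # v) = q" "l2 (True # v) = n" by blast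
  have lv: "T = Suc (Suc (Suc (length v)))" using word_length[of True v] unfolding v T by simp
  show ?thesis
  proof (cases m)
    case (Suc m')
    have "\<exists>v. l1 (True # v) = m' \<and> up (True # v) = q + 2 \<and> dn (True # v) = q + 1 \<and> l2 (True # v) = n"
      by (intro ex_word_from_True) auto
    then obtain v' where v': "l1 (True # v') = m'" "up (True # v') = q + 2" "dn (True # v') = q + 1" "l2 (True # v') = n" by blast
    have lv': "T = Suc (Suc (length v'))" using word_length[of True v'] Suc unfolding v' T by simp
    show ?thesis
      using lv lv' by (rule_tac exI[of _ "[True, False] @ True # v"], rule_tac exI[of _ "[True] @ True # v'"])
        (simp add: v v' p q mn)
  next
    case 0
    then obtain n' where n: "n = Suc n'" using d(3) mn by (cases n) auto
    have "\<exists>v. l2 (False # v) = n' \<and> dn (False # v) = q + 1 \<and> up (False # v) = q + 1 \<and> l1 (False # v) = m"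
      by (intro ex_word_from_False) auto
    then obtain v' where v': "l2 (False # v') = n'" "dn (False # v') = q + 1" "up (False # v') = q + 1" "l1 (False # v') = m" by blast
    have lv': "T = Suc (Suc (Suc (length v')))" using word_length[of False v'] n unfolding v' T by simp
    show ?thesis
      using lv lv' by (rule_tac exI[of _ "[True, False] @ True # v"], rule_tac exI[of _ "[True, False] @ False # v'"])
        (simp add: v v' p q mn n)
  qed
qed

text \<open>Exactly one word is complementary to \<open>w'\<close>. If the counts are not
  complementary, \<open>w\<close> is not that word; if they are, a loop and a round trip give
  \<open>w\<close> two arrangements, of which at least one differs from it and can be crossed with
  \<open>w'\<close>.\<close>

lemma opposite_to_balanced:
  assumes len: "length w = T" "length w' = T" and d: "up w = dn w + 1" "dn w' = up w' + 1"
    and good: "\<not> (up w' = dn w \<and> l2 w' = l1 w \<and> l1 w' = l2 w \<and> (dn w = 0 \<or> l1 w + l2 w = 0))"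
  shows "\<exists>\<eta> \<eta>'. eqv T {#w, w'#} {#\<eta>, \<eta>'#} \<and> length \<eta> = T \<and> length \<eta>' = T \<and>
    up \<eta> = dn \<eta> \<and> up \<eta>' = dn \<eta>'"
proof -
  have ne: "w \<noteq> []" "w' \<noteq> []" using d by auto
  have T: "2 \<le> T" using tr_total[OF ne(1)] len d by linarith
  have ends: "hd x = True" "last x = False" if "up x = dn x + 1" for x
  proof -
    have "x \<noteq> []" using that by auto
    from up_dn[OF this] that show "hd x = True" "last x = False" by (cases "hd x"; cases "last x"; simp)+
  qed
  have ends': "hd w' = False" "last w' = True"
    using up_dn[OF ne(2)] d(2) by (cases "hd w'"; cases "last w'"; simp)+
  have main: ?thesis if x: "length x = T" "up x = up w" "dn x = dn w" "l2 x = l2 w" "w' \<noteq> map Not x" for x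
  proof -
    have "eqv T {#w, w'#} {#x, w'#}"
      using x len T by (intro eqv_pair eqv_refl eqv_same_type) simp_all
    moreover obtain \<eta> \<eta>' where "eqv T {#x, w'#} {#\<eta>, \<eta>'#}"
      "length \<eta> = T \<and> length \<eta>' = T \<and> up \<eta> = dn \<eta> \<and> up \<eta>' = dn \<eta>'"
      using cross_complementary_ends[OF x(1) len(2) ends(1)[of x] ends(2)[of x] ends' x(5)] x d(1) by auto
    ultimately show ?thesis using eqv_trans by blast
  qed
  show ?thesis
  proof (cases "up w' = dn w \<and> l2 w' = l1 w \<and> l1 w' = l2 w")
    case True
    then have "dn w \<ge> 1" "l1 w + l2 w \<ge> 1" using good by linarith+
    from two_words[OF len(1) d(1) this] obtain x y where xy: "x \<noteq> y"
      "length x = T" "up x = up w" "dn x = dn w" "l2 x = l2 w"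
      "length y = T" "up y = up w" "dn y = dn w" "l2 y = l2 w" by blast
    have "map Not x \<noteq> map Not y" using xy(1) by (simp add: inj_map_eq_map inj_def)
    then have "w' \<noteq> map Not x \<or> w' \<noteq> map Not y" by blast
    then show ?thesis using main[OF xy(2-5)] main[OF xy(6-9)] by blast
  next
    case False
    have "w' \<noteq> map Not w" using False by (auto simp: tr_flip)
    then show ?thesis using main[OF len(1)] by blast
  qed
qed

section \<open>Redistribution of loops and round trips\<close>

abbreviation sw :: "bool list \<Rightarrow> nat \<times> nat" where "sw w \<equiv> (up w, dn w)"

lemma length_eq_transitions: "length w = T \<Longrightarrow> 1 \<le> T \<Longrightarrow> Suc (l1 w + up w + dn w + l2 w) = T"
  using tr_total[of w] by fastforce

text \<open>The first bound on \<open>j\<close> expresses that \<open>w\<close> has \<open>j\<close>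
  loops 11 to give away, the second that the other words have \<open>j\<close> loops 22 to
  offer.\<close>

lemma raise_l2:
  assumes T: "3 \<le> T" and w: "length w = T" "up w + dn w \<ge> 1"
    and X: "\<forall>x\<in>#X. length x = T \<and> up x + dn x \<ge> 1"
    and j: "l2 w + j + up w + dn w < T" "j \<le> (\<Sum>x\<in>#X. l2 x)"
  shows "\<exists>w' X'. eqv T (add_mset w X) (add_mset w' X') \<and> length w' = T \<and> sw w' = sw w \<and> l2 w' = l2 w + j \<and>
    (\<forall>x\<in>#X'. length x = T \<and> up x + dn x \<ge> 1) \<and> image_mset sw X' = image_mset sw X"
  using w X j
proof (induction j arbitrary: w X)
  case 0
  then show ?case by (intro exI[of _ w] exI[of _ X]) (auto intro: eqv_refl)
next
  case (Suc j)
  have "\<exists>x\<in>#X. l2 x \<ge> 1"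
  proof (rule ccontr)
    assume "\<not> ?thesis"
    then have "\<forall>x\<in>#X. l2 x = 0" by (auto simp: not_le)
    then have "(\<Sum>x\<in>#X. l2 x) = 0" by simp
    then show False using Suc.prems(5) by linarith
  qed
  then obtain x R where x: "l2 x \<ge> 1" and X: "X = add_mset x R" by (metis multi_member_split)
  have lx: "length x = T" "up x + dn x \<ge> 1" using Suc.prems(3) X by simp_all
  have "l1 w \<ge> 1" using length_eq_transitions[of w T] Suc.prems(1,4) T by linarith
  from loop_exchange[OF T Suc.prems(1) lx(1) Suc.prems(2) lx(2) this x] obtain a b where
    ab: "eqv T {#w, x#} {#a, b#}" "length a = T" "length b = T" "up a = up w" "dn a = dn w" "l2 a = l2 w + 1"
      "up b = up x" "dn b = dn x" "l2 x = l2 b + 1" by blast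
  have e1: "eqv T (add_mset w X) (add_mset a (add_mset b R))"
    using eqv_add[OF ab(1), of R] X by simp
  have "\<exists>w' X'. eqv T (add_mset a (add_mset b R)) (add_mset w' X') \<and> length w' = T \<and> sw w' = sw a \<and> l2 w' = l2 a + j \<and>
    (\<forall>x\<in>#X'. length x = T \<and> up x + dn x \<ge> 1) \<and> image_mset sw X' = image_mset sw (add_mset b R)"
  proof (rule Suc.IH)
    show "length a = T" "1 \<le> up a + dn a" "l2 a + j + up a + dn a < T" using ab Suc.prems by simp_all
    show "\<forall>x\<in>#add_mset b R. length x = T \<and> up x + dn x \<ge> 1" using ab lx Suc.prems(3) X by auto
    show "j \<le> (\<Sum>x\<in>#add_mset b R. l2 x)" using Suc.prems(5) ab(9) X by simp
  qed
  then obtain w' X' where *: "eqv T (add_mset a (add_mset b R)) (add_mset w' X')" "length w' = T" "sw w' = sw a" "l2 w' = l2 a + j"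
    "\<forall>x\<in>#X'. length x = T \<and> up x + dn x \<ge> 1" "image_mset sw X' = image_mset sw (add_mset b R)" by blast
  have "eqv T (add_mset w X) (add_mset w' X')" by (rule eqv_trans[OF e1 *(1)])
  moreover have "image_mset sw X' = image_mset sw X" using *(6) ab X by simp
  ultimately show ?case using * ab by (intro exI[of _ w'] exI[of _ X']) simp
qed

text \<open>Words with the same switches are matched one by one. Of each matched pair, the word with
  fewer loops 22 is filled up from the rest of its own multiset, which holds enough of them because
  the totals agree.\<close>

lemma eqv_same_switches:
  assumes T: "3 \<le> T" and X: "\<forall>x\<in>#X. length x = T \<and> up x + dn x \<ge> 1"
    and Y: "\<forall>x\<in>#Y. length x = T \<and> up x + dn x \<ge> 1"
    and sw: "image_mset sw X = image_mset sw Y" and l: "(\<Sum>x\<in>#X. l2 x) = (\<Sum>x\<in>#Y. l2 x)"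
  shows "eqv T X Y"
  using X Y sw l
proof (induction "size X" arbitrary: X Y)
  case 0
  then show ?case by (simp add: eqv_refl)
next
  case (Suc n)
  obtain w X0 where X0: "X = add_mset w X0" using Suc.hyps(2) by (metis size_eq_Suc_imp_eq_union)
  have "sw w \<in># image_mset sw Y" unfolding Suc.prems(3)[symmetric] X0 by simp
  then obtain y where y: "y \<in># Y" "sw y = sw w" by (metis (no_types, lifting) image_iff set_image_mset)
  then obtain Y0 where Y0: "Y = add_mset y Y0" by (metis multi_member_split)
  have lw: "length w = T" "up w + dn w \<ge> 1" "\<forall>x\<in>#X0. length x = T \<and> up x + dn x \<ge> 1"
    using Suc.prems(1) X0 by simp_all
  have ly: "length y = T" "up y + dn y \<ge> 1" "\<forall>x\<in>#Y0. length x = T \<and> up x + dn x \<ge> 1"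
    using Suc.prems(2) Y0 by simp_all
  have sw0: "image_mset sw X0 = image_mset sw Y0" using Suc.prems(3) X0 Y0 y(2) by simp
  have l0: "l2 w + (\<Sum>x\<in>#X0. l2 x) = l2 y + (\<Sum>x\<in>#Y0. l2 x)" using Suc.prems(4) X0 Y0 by simp
  have n: "n = size X0" using Suc.hyps(2) X0 by simp
  have tw: "l2 y + up w + dn w < T" "l2 w + up y + dn y < T"
    using length_eq_transitions[OF lw(1)] length_eq_transitions[OF ly(1)] y(2) T by simp_all
  show ?case
  proof (cases "l2 w \<le> l2 y")
    case True
    then obtain j where j: "l2 y = l2 w + j" using le_Suc_ex by blast
    have "l2 w + j + up w + dn w < T" "j \<le> (\<Sum>x\<in>#X0. l2 x)" using tw l0 j by linarith+
    from raise_l2[OF T lw this] obtain w' X' where *: "eqv T X (add_mset w' X')" "length w' = T" "sw w' = sw w" "l2 w' = l2 w + j"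
      "\<forall>x\<in>#X'. length x = T \<and> up x + dn x \<ge> 1" "image_mset sw X' = image_mset sw X0" unfolding X0 by blast
    have "(\<Sum>x\<in>#X'. l2 x) = (\<Sum>x\<in>#Y0. l2 x)"
      using eqv_tr[OF *(1), of False False] Suc.prems(4) *(4) j unfolding Y0 by simp
    moreover have "n = size X'" using n *(6) by (metis size_image_mset)
    ultimately have "eqv T X' Y0" using *(5,6) ly(3) sw0 by (intro Suc.hyps(1)) simp_all
    then have "eqv T (add_mset w' X') (add_mset w' Y0)" by (rule eqv_add_mset)
    moreover have "eqv T {#w'#} {#y#}" using * ly y(2) j T by (intro eqv_same_type) simp_all
    from eqv_add[OF this, of Y0] have "eqv T (add_mset w' Y0) Y" unfolding Y0 by simp
    ultimately show ?thesis using *(1) eqv_trans by blast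
  next
    case False
    then obtain j where j: "l2 w = l2 y + j" using le_Suc_ex nat_le_linear by metis
    have "l2 y + j + up y + dn y < T" "j \<le> (\<Sum>x\<in>#Y0. l2 x)" using tw l0 j by linarith+
    from raise_l2[OF T ly this] obtain w' X' where *: "eqv T Y (add_mset w' X')" "length w' = T" "sw w' = sw y" "l2 w' = l2 y + j"
      "\<forall>x\<in>#X'. length x = T \<and> up x + dn x \<ge> 1" "image_mset sw X' = image_mset sw Y0" unfolding Y0 by blast
    have "(\<Sum>x\<in>#X0. l2 x) = (\<Sum>x\<in>#X'. l2 x)"
      using eqv_tr[OF *(1), of False False] Suc.prems(4) *(4) j unfolding X0 by simp
    then have "eqv T X0 X'" using *(5,6) lw(3) sw0 n by (intro Suc.hyps(1)) simp_all
    then have "eqv T (add_mset w X0) (add_mset w X')" by (rule eqv_add_mset)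
    moreover have "eqv T {#w#} {#w'#}" using * lw y(2) j T by (intro eqv_same_type) simp_all
    from eqv_add[OF this, of X'] have "eqv T (add_mset w X') (add_mset w' X')" by simp
    ultimately show ?thesis using *(1) eqv_trans eqv_sym unfolding X0 by blast
  qed
qed

lemma sum_mset_add_one: "(\<Sum>x\<in>#X. f x + 1) = (\<Sum>x\<in>#X. f x) + size X" for f :: "'a \<Rightarrow> nat"
  by (induction X) auto

text \<open>Each received round trip costs \<open>w\<close> two loops, whence \<open>2 * j\<close>.
  The bound with \<open>size X + j\<close> leaves every donor one switch 12 of its own, so no word
  becomes constant.\<close>

lemma raise_cycles:
  assumes T: "3 \<le> T" and w: "length w = T" "dn w \<le> up w"
    and X: "\<forall>x\<in>#X. length x = T \<and> dn x \<le> up x \<and> up x \<ge> 1"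
    and j: "up w + dn w + 2 * j < T" "size X + j \<le> (\<Sum>x\<in>#X. up x)"
  shows "\<exists>w' X'. eqv T (add_mset w X) (add_mset w' X') \<and> length w' = T \<and> up w' = up w + j \<and> dn w' = dn w + j \<and>
    (\<forall>x\<in>#X'. length x = T \<and> dn x \<le> up x \<and> up x \<ge> 1)"
  using w X j
proof (induction j arbitrary: w X)
  case 0
  then show ?case by (intro exI[of _ w] exI[of _ X]) (auto intro: eqv_refl)
next
  case (Suc j)
  have "\<exists>x\<in>#X. up x \<ge> 2"
  proof (rule ccontr)
    assume "\<not> ?thesis"
    then have "(\<Sum>x\<in>#X. up x) \<le> (\<Sum>x\<in>#X. 1)" by (intro sum_mset_mono) auto
    then show False using Suc.prems(5) by (simp add: size_eq_sum_mset[symmetric])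
  qed
  then obtain x R where x: "up x \<ge> 2" and X: "X = add_mset x R" by (metis multi_member_split)
  have lx: "length x = T" "dn x \<le> up x" using Suc.prems(3) X by simp_all
  have "up w + dn w + 2 < T" using Suc.prems(4) by simp
  from cycle_transfer[OF T lx(1) Suc.prems(1) lx(2) Suc.prems(2) x this] obtain a b where
    ab: "eqv T {#x, w#} {#a, b#}" "length a = T" "length b = T" "up x = up a + 1" "dn x = dn a + 1"
      "up b = up w + 1" "dn b = dn w + 1" by blast
  have e1: "eqv T (add_mset w X) (add_mset b (add_mset a R))"
    using eqv_add[OF ab(1), of R] X by (simp add: add_mset_commute)
  have "\<exists>w' X'. eqv T (add_mset b (add_mset a R)) (add_mset w' X') \<and> length w' = T \<and> up w' = up b + j \<and> dn w' = dn b + j \<and>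
    (\<forall>x\<in>#X'. length x = T \<and> dn x \<le> up x \<and> up x \<ge> 1)"
  proof (rule Suc.IH)
    show "length b = T" "dn b \<le> up b" "up b + dn b + 2 * j < T" using ab Suc.prems by simp_all
    show "\<forall>x\<in>#add_mset a R. length x = T \<and> dn x \<le> up x \<and> up x \<ge> 1" using ab lx x Suc.prems(3) X by auto
    show "size (add_mset a R) + j \<le> (\<Sum>x\<in>#add_mset a R. up x)" using Suc.prems(5) ab(4) X by simp
  qed
  then obtain w' X' where *: "eqv T (add_mset b (add_mset a R)) (add_mset w' X')" "length w' = T" "up w' = up b + j" "dn w' = dn b + j"
    "\<forall>x\<in>#X'. length x = T \<and> dn x \<le> up x \<and> up x \<ge> 1" by blast
  have "eqv T (add_mset w X) (add_mset w' X')" by (rule eqv_trans[OF e1 *(1)])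
  then show ?case using * ab by (intro exI[of _ w'] exI[of _ X']) simp
qed

lemma equalize_switches:
  assumes T: "3 \<le> T" and X: "\<forall>x\<in>#X. length x = T \<and> dn x \<le> up x \<and> up x \<ge> 1"
    and Y: "\<forall>x\<in>#Y. length x = T \<and> dn x \<le> up x \<and> up x \<ge> 1"
    and sums: "size X = size Y" "(\<Sum>x\<in>#X. up x) = (\<Sum>x\<in>#Y. up x)" "(\<Sum>x\<in>#X. dn x) = (\<Sum>x\<in>#Y. dn x)"
  shows "\<exists>X' Y'. eqv T X X' \<and> eqv T Y Y' \<and> image_mset sw X' = image_mset sw Y' \<and>
    (\<forall>x\<in>#X'. length x = T \<and> up x \<ge> 1) \<and> (\<forall>x\<in>#Y'. length x = T \<and> up x \<ge> 1)"
  using X Y sums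
proof (induction "size X" arbitrary: X Y)
  case 0
  then show ?case by (intro exI[of _ "{#}"]) (auto simp: eqv_refl)
next
  case (Suc n)
  obtain w X0 where X0: "X = add_mset w X0" using Suc.hyps(2) by (metis size_eq_Suc_imp_eq_union)
  have lw: "length w = T" "dn w \<le> up w" "\<forall>x\<in>#X0. length x = T \<and> dn x \<le> up x \<and> up x \<ge> 1" "up w \<ge> 1"
    using Suc.prems(1) X0 by simp_all
  have diff: "up x \<le> dn x + 1" if "length x = T" for x
    using that T by (intro up_le) auto
  \<comment> \<open>All differences \<open>up - dn\<close> are 0 or 1, so the sizes and the totals
    give \<open>X\<close> and \<open>Y\<close> the same number of closed words and the same number
    of words from 1 to 2.\<close>
  have "\<exists>y\<in>#Y. up y - dn y = up w - dn w"
  proof (rule ccontr)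
    assume no: "\<not> ?thesis"
    show False
    proof (cases "up w = dn w")
      case True
      then have "dn y + 1 \<le> up y" if "y \<in># Y" for y using no that by (metis Suc_eq_plus1 cancel_comm_monoid_add_class.diff_cancel diff_is_0_eq not_less_eq_eq)
      then have "(\<Sum>y\<in>#Y. dn y + 1) \<le> (\<Sum>y\<in>#Y. up y)" by (intro sum_mset_mono)
      moreover have "(\<Sum>x\<in>#X0. up x) \<le> (\<Sum>x\<in>#X0. dn x + 1)" using lw(3) diff by (intro sum_mset_mono) blast
      ultimately show False using Suc.prems(3-5) True X0 unfolding sum_mset_add_one by simp
    next
      case False
      then have w1: "up w = dn w + 1" using diff[OF lw(1)] lw(2) by linarith
      have "up y \<le> dn y" if "y \<in># Y" for y
      proof -
        have "up y - dn y \<noteq> 1" "up y \<le> dn y + 1" using no that w1 Suc.prems(2) diff by auto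
        then show ?thesis by linarith
      qed
      then have "(\<Sum>y\<in>#Y. up y) \<le> (\<Sum>y\<in>#Y. dn y)" by (intro sum_mset_mono)
      moreover have "(\<Sum>x\<in>#X0. dn x) \<le> (\<Sum>x\<in>#X0. up x)" using lw(3) by (intro sum_mset_mono) blast
      ultimately show False using Suc.prems(3-5) w1 X0 by simp
    qed
  qed
  then obtain y Y0 where y: "up y - dn y = up w - dn w" and Y0: "Y = add_mset y Y0" by (metis multi_member_split)
  have ly: "length y = T" "dn y \<le> up y" "\<forall>x\<in>#Y0. length x = T \<and> dn x \<le> up x \<and> up x \<ge> 1" "up y \<ge> 1"
    using Suc.prems(2) Y0 by simp_all
  have s0: "up w + (\<Sum>x\<in>#X0. up x) = up y + (\<Sum>x\<in>#Y0. up x)" "size X0 = size Y0" "n = size X0"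
    using Suc.prems Suc.hyps(2) X0 Y0 by simp_all
  have big: "size Z \<le> (\<Sum>x\<in>#Z. up x)" if "\<forall>x\<in>#Z. length x = T \<and> dn x \<le> up x \<and> up x \<ge> 1" for Z
  proof -
    have "(\<Sum>x\<in>#Z. 1) \<le> (\<Sum>x\<in>#Z. up x)" using that by (intro sum_mset_mono) auto
    then show ?thesis by (simp add: size_eq_sum_mset[symmetric])
  qed
  have tw: "up w + dn w < T" "up y + dn y < T" using length_eq_transitions[OF lw(1)] length_eq_transitions[OF ly(1)] T by linarith+
  show ?case
  proof (cases "up w \<le> up y")
    case True
    then obtain j where j: "up y = up w + j" using le_Suc_ex by blast
    then have jd: "dn y = dn w + j" using y lw(2) ly(2) by linarith
    have "up w + dn w + 2 * j < T" "size X0 + j \<le> (\<Sum>x\<in>#X0. up x)"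
      using tw s0 j jd big[OF ly(3)] by linarith+
    from raise_cycles[OF T lw(1-3) this] obtain w' X' where *: "eqv T X (add_mset w' X')" "length w' = T"
      "up w' = up w + j" "dn w' = dn w + j" "\<forall>x\<in>#X'. length x = T \<and> dn x \<le> up x \<and> up x \<ge> 1" unfolding X0 by blast
    have "size X' = size Y0" "(\<Sum>x\<in>#X'. up x) = (\<Sum>x\<in>#Y0. up x)" "(\<Sum>x\<in>#X'. dn x) = (\<Sum>x\<in>#Y0. dn x)" "n = size X'"
      using eqv_size[OF *(1)] eqv_tr[OF *(1), of True False] eqv_tr[OF *(1), of False True] Suc.prems(3-5) s0 *(3,4) j jd
      unfolding Y0 by simp_all
    from Suc.hyps(1)[OF this(4) *(5) ly(3) this(1-3)] obtain X'' Y'' where **: "eqv T X' X''" "eqv T Y0 Y''"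
      "image_mset sw X'' = image_mset sw Y''" "\<forall>x\<in>#X''. length x = T \<and> up x \<ge> 1" "\<forall>x\<in>#Y''. length x = T \<and> up x \<ge> 1"
      by blast
    have "eqv T X (add_mset w' X'')" "eqv T Y (add_mset y Y'')" unfolding Y0
      using eqv_trans[OF *(1) eqv_add_mset[OF **(1)]] eqv_add_mset[OF **(2)] by simp_all
    then show ?thesis using **(3-5) * lw ly j jd
      by (rule_tac exI[of _ "add_mset w' X''"], rule_tac exI[of _ "add_mset y Y''"]) simp
  next
    case False
    then obtain j where j: "up w = up y + j" using le_Suc_ex nat_le_linear by metis
    then have jd: "dn w = dn y + j" using y lw(2) ly(2) by linarith
    have "up y + dn y + 2 * j < T" "size Y0 + j \<le> (\<Sum>x\<in>#Y0. up x)"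
      using tw s0 j jd big[OF lw(3)] by linarith+
    from raise_cycles[OF T ly(1-3) this] obtain w' X' where *: "eqv T Y (add_mset w' X')" "length w' = T"
      "up w' = up y + j" "dn w' = dn y + j" "\<forall>x\<in>#X'. length x = T \<and> dn x \<le> up x \<and> up x \<ge> 1" unfolding Y0 by blast
    have "size X0 = size X'" "(\<Sum>x\<in>#X0. up x) = (\<Sum>x\<in>#X'. up x)" "(\<Sum>x\<in>#X0. dn x) = (\<Sum>x\<in>#X'. dn x)"
      using eqv_size[OF *(1)] eqv_tr[OF *(1), of True False] eqv_tr[OF *(1), of False True] Suc.prems(3-5) s0 *(3,4) j jd
      unfolding X0 by simp_all
    from Suc.hyps(1)[OF s0(3) lw(3) *(5) this(1-3)] obtain X'' Y'' where **: "eqv T X0 X''" "eqv T X' Y''"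
      "image_mset sw X'' = image_mset sw Y''" "\<forall>x\<in>#X''. length x = T \<and> up x \<ge> 1" "\<forall>x\<in>#Y''. length x = T \<and> up x \<ge> 1"
      by blast
    have "eqv T Y (add_mset w' Y'')" "eqv T X (add_mset w X'')" unfolding X0
      using eqv_trans[OF *(1) eqv_add_mset[OF **(2)]] eqv_add_mset[OF **(1)] by simp_all
    then show ?thesis using **(3-5) * lw ly j jd
      by (rule_tac exI[of _ "add_mset w X''"], rule_tac exI[of _ "add_mset w' Y''"]) simp
  qed
qed

lemma eqv_nonconstant:
  assumes T: "3 \<le> T" and X: "\<forall>x\<in>#X. length x = T \<and> dn x \<le> up x \<and> up x \<ge> 1"
    and Y: "\<forall>x\<in>#Y. length x = T \<and> dn x \<le> up x \<and> up x \<ge> 1"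
    and sums: "size X = size Y" "(\<Sum>x\<in>#X. up x) = (\<Sum>x\<in>#Y. up x)" "(\<Sum>x\<in>#X. dn x) = (\<Sum>x\<in>#Y. dn x)"
      "(\<Sum>x\<in>#X. l2 x) = (\<Sum>x\<in>#Y. l2 x)"
  shows "eqv T X Y"
proof -
  from equalize_switches[OF T X Y sums(1-3)] obtain X' Y' where *: "eqv T X X'" "eqv T Y Y'"
    "image_mset sw X' = image_mset sw Y'" "\<forall>x\<in>#X'. length x = T \<and> up x \<ge> 1" "\<forall>x\<in>#Y'. length x = T \<and> up x \<ge> 1" by blast
  have "eqv T X' Y'"
  proof (rule eqv_same_switches[OF T _ _ *(3)])
    show "\<forall>x\<in>#X'. length x = T \<and> up x + dn x \<ge> 1" "\<forall>x\<in>#Y'. length x = T \<and> up x + dn x \<ge> 1"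
      using *(4,5) by auto
    show "(\<Sum>x\<in>#X'. l2 x) = (\<Sum>x\<in>#Y'. l2 x)"
      using eqv_tr[OF *(1), of False False] eqv_tr[OF *(2), of False False] sums(4) by simp
  qed
  then show ?thesis using *(1,2) eqv_trans eqv_sym by blast
qed

text \<open>A word with two switches 12 can hand a round trip to a constant word and stays
  nonconstant itself. The number of constant words drops until there is no donor or no
  recipient.\<close>

lemma reduce_constants:
  assumes T: "3 \<le> T" and X: "\<forall>x\<in>#X. length x = T \<and> dn x \<le> up x"
  shows "\<exists>X'. eqv T X X' \<and> (\<forall>x\<in>#X'. length x = T \<and> dn x \<le> up x) \<and>
    ((\<forall>x\<in>#X'. up x \<ge> 1) \<or> (\<forall>x\<in>#X'. up x \<le> 1))"
  using X
proof (induction "size (filter_mset (\<lambda>x. up x = 0) X)" arbitrary: X rule: less_induct)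
  case less
  show ?case
  proof (cases "(\<forall>x\<in>#X. up x \<ge> 1) \<or> (\<forall>x\<in>#X. up x \<le> 1)")
    case True
    then show ?thesis using less.prems eqv_refl by blast
  next
    case False
    then obtain z w where zw: "z \<in># X" "up z = 0" "w \<in># X" "2 \<le> up w" by (auto simp: not_le numeral_2_eq_2 Suc_le_eq)
    then obtain R where R: "X = add_mset w (add_mset z R)" by (metis insert_noteq_member multi_member_split not_numeral_le_zero)
    have l: "length w = T" "length z = T" "dn w \<le> up w" "dn z \<le> up z" using less.prems R by simp_all
    have z: "dn z = 0" using l(4) zw(2) by simp
    have "w \<noteq> []" using l T by auto
    then have "3 < T" using length_eq_transitions[OF l(1)] zw(4) up_le[of w] T by linarith
    then have "up z + dn z + 2 < T" using zw(2) z by simp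
    from cycle_transfer[OF T l zw(4) this] obtain a b where
      ab: "eqv T {#w, z#} {#a, b#}" "length a = T" "length b = T" "up w = up a + 1" "dn w = dn a + 1"
        "up b = up z + 1" "dn b = dn z + 1" by blast
    let ?X = "add_mset a (add_mset b R)"
    have e: "eqv T X ?X" using eqv_add[OF ab(1), of R] R by simp
    have "\<exists>X'. eqv T ?X X' \<and> (\<forall>x\<in>#X'. length x = T \<and> dn x \<le> up x) \<and>
      ((\<forall>x\<in>#X'. up x \<ge> 1) \<or> (\<forall>x\<in>#X'. up x \<le> 1))"
    proof (rule less.hyps)
      show "size (filter_mset (\<lambda>x. up x = 0) ?X) < size (filter_mset (\<lambda>x. up x = 0) X)"
        using ab zw R by simp
      show "\<forall>x\<in>#?X. length x = T \<and> dn x \<le> up x" using ab l R less.prems by simp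
    qed
    then show ?thesis using eqv_trans[OF e] by blast
  qed
qed

section \<open>Replacing a constant path 1...1 by 2...2\<close>

lemma raise_pair:
  assumes T: "3 \<le> T" and len: "length a = T" "length b = T" and v: "up a + dn a = 1" "up b + dn b = 1"
    and R: "\<forall>x\<in>#R. length x = T \<and> up x + dn x \<ge> 1"
    and l: "T \<le> l2 a + l2 b + (\<Sum>x\<in>#R. l2 x) + 1"
  shows "\<exists>a' b' R'. eqv T (add_mset a (add_mset b R)) (add_mset a' (add_mset b' R')) \<and>
    length a' = T \<and> length b' = T \<and> sw a' = sw a \<and> sw b' = sw b \<and>
    (\<forall>x\<in>#R'. length x = T \<and> up x + dn x \<ge> 1) \<and> image_mset sw R' = image_mset sw R \<and> T \<le> l2 a' + l2 b' + 1"
proof -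
  have la: "l2 a + 2 \<le> T" "l2 b + 2 \<le> T" using length_eq_transitions[OF len(1)] length_eq_transitions[OF len(2)] v T by linarith+
  define k where "k = T - 1 - (l2 a + l2 b)"
  \<comment> \<open>\<open>k\<close> loops 22 are missing. A word with a single switch holds at most
    \<open>T - 2\<close> of them, so \<open>a\<close> is filled first. At most one loop is then left
    over, and only if \<open>b\<close> has none, so \<open>b\<close> can take it.\<close>
  define j where "j = min k (T - 2 - l2 a)"
  define i where "i = k - j"
  have k: "k \<le> (\<Sum>x\<in>#R. l2 x)" "T \<le> l2 a + l2 b + k + 1" using l unfolding k_def by linarith+
  have j: "j \<le> (\<Sum>x\<in>#R. l2 x)" "l2 a + j + up a + dn a < T" "j + i = k"
    using k la v unfolding j_def i_def by linarith+
  have i: "l2 b + i + up b + dn b < T"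
    using la v T unfolding i_def j_def k_def by linarith
  have "1 \<le> up a + dn a" "1 \<le> up b + dn b" using v by simp_all
  note v1 = this
  from raise_l2[OF T len(1) v1(1) R j(2,1)] obtain a' R1 where 1: "eqv T (add_mset a R) (add_mset a' R1)"
    "length a' = T" "sw a' = sw a" "l2 a' = l2 a + j" "\<forall>x\<in>#R1. length x = T \<and> up x + dn x \<ge> 1"
    "image_mset sw R1 = image_mset sw R" by blast
  have "i \<le> (\<Sum>x\<in>#R1. l2 x)" using eqv_tr[OF 1(1), of False False] 1(4) j(3) k(1) by simp
  from raise_l2[OF T len(2) v1(2) 1(5) i this] obtain b' R' where 2: "eqv T (add_mset b R1) (add_mset b' R')"
    "length b' = T" "sw b' = sw b" "l2 b' = l2 b + i" "\<forall>x\<in>#R'. length x = T \<and> up x + dn x \<ge> 1"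
    "image_mset sw R' = image_mset sw R1" by blast
  have "eqv T (add_mset a (add_mset b R)) (add_mset a' (add_mset b R1))"
    using eqv_add_mset[OF 1(1), of b] by (simp add: add_mset_commute)
  moreover have "eqv T (add_mset a' (add_mset b R1)) (add_mset a' (add_mset b' R'))"
    by (rule eqv_add_mset[OF 2(1)])
  ultimately have "eqv T (add_mset a (add_mset b R)) (add_mset a' (add_mset b' R'))" by (rule eqv_trans)
  moreover have "T \<le> l2 a' + l2 b' + 1" using 1(4) 2(4) j(3) k(2) by linarith
  moreover have "image_mset sw R' = image_mset sw R" using 1(6) 2(6) by simp
  ultimately show ?thesis using 1(2,3) 2(2,3,5) by blast
qed

lemma constant_word:
  assumes "length w = T" "3 \<le> T" "up w = 0" "dn w = 0"
  shows "w = replicate T True \<or> w = replicate T False"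
proof -
  have "w = replicate (length w) (hd w)" using assms by (intro no_switch) auto
  then show ?thesis using assms(1) by (cases "hd w") simp_all
qed

text \<open>Started in state 2, the closed word reads 21...12...2 and meets 1...1 at time 2.
  Crossing there opens it into a path from 2 to 1 and a path from 1 to 2, at the price of the
  constant word.\<close>

lemma split_cycle:
  assumes T: "3 \<le> T" and w: "length w = T" "up w = 1" "dn w = 1"
  shows "\<exists>a b. eqv T {#replicate T True, w#} {#a, b#} \<and> length a = T \<and> length b = T \<and>
    up a = 0 \<and> dn a = 1 \<and> up b = 1 \<and> dn b = 0"
proof -
  define m n where "m = l1 w" and "n = l2 w"
  have T': "T = m + n + 3" using length_eq_transitions[OF w(1)] w T unfolding m_def n_def by simp
  let ?v = "replicate m True @ replicate (Suc n) False"
  have tv: "tr p q (True # ?v) = of_bool (p = True \<and> q = True) * m + of_bool (True = p \<and> False = q) +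
      of_bool (p = False \<and> q = False) * n" for p q
    using tr_replicate_append[of "Suc m" "Suc n" p q True False] by simp
  have tc: "tr p q (True # replicate k True) = of_bool (p = True \<and> q = True) * k" for p q k
    using tr_replicate[of p q "Suc k" True] by simp
  have tF: "tr p q (False # True # r) = of_bool (\<not> p \<and> q) + tr p q (True # r)" for p q r by auto
  have tT: "tr p q (True # True # r) = of_bool (p \<and> q) + tr p q (True # r)" for p q r by auto
  have "eqv T {#w#} {#False # True # ?v#}"
    using w T by (intro eqv_same_type) (simp_all add: tF tv n_def[symmetric] T' del: tr.simps replicate_Suc)
  from eqv_pair[OF eqv_refl this]
  have 1: "eqv T {#replicate T True, w#} {#replicate T True, False # True # ?v#}" .
  have rT: "replicate T True = [True] @ True # replicate (m + n + 1) True"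
    unfolding T' by (simp add: numeral_3_eq_3)
  have "eqv T {#[False] @ True # ?v, [True] @ True # replicate (m + n + 1) True#}
      {#[False] @ True # replicate (m + n + 1) True, [True] @ True # ?v#}"
    by (intro eqv_cross) (simp_all add: T')
  then have 2: "eqv T {#replicate T True, False # True # ?v#}
      {#False # True # replicate (m + n + 1) True, True # True # ?v#}"
    unfolding rT by (simp add: add_mset_commute del: replicate_Suc)
  have "eqv T {#replicate T True, w#} {#False # True # replicate (m + n + 1) True, True # True # ?v#}"
    by (rule eqv_trans[OF 1 2])
  then show ?thesis
    by (rule_tac exI[of _ "False # True # replicate (m + n + 1) True"], rule_tac exI[of _ "True # True # ?v"])
      (simp add: tF tT tv tc T' del: tr.simps replicate_Suc)
qed

text \<open>In single-step form the bound on the loops says that \<open>b\<close> reaches state 2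
  before \<open>a\<close> leaves it. The words cross in state 2, which releases a constant word
  2...2.\<close>

lemma merge_cycle:
  assumes T: "3 \<le> T" and len: "length a = T" "length b = T"
    and d: "up a = 0" "dn a = 1" "up b = 1" "dn b = 0" and l: "T \<le> l2 a + l2 b + 1"
  shows "\<exists>w. eqv T {#a, b#} {#replicate T False, w#} \<and> length w = T \<and> up w = 1 \<and> dn w = 1"
proof -
  have T2: "2 \<le> T" using T by simp
  note ra = rep_dn[OF len(1) d(1,2) T2] and rb = rep_up[OF len(2) d(3,4) T2]
  let ?a = "Suc (l2 a)" and ?b = "T - Suc (l2 b)"
  let ?w = "replicate ?b True @ replicate (?a - ?b) False @ replicate (T - ?a) True"
  have ab: "0 < ?b" "?b < ?a" "?a < T" using ra(2) rb(2) l by linarith+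
  have "eqv T {#b, a#} {#?w, replicate T False#}"
    by (rule eqv_trans[OF eqv_pair[OF rb(1) ra(1)] cross_opposite[OF ab]])
  moreover have "tr p q ?w = of_bool (p = True \<and> q = True) * (?b - 1) + of_bool (True = p \<and> False = q) +
      of_bool (p = False \<and> q = False) * (?a - ?b - 1) + of_bool (False = p \<and> True = q) +
      of_bool (p = True \<and> q = True) * (T - ?a - 1)" for p q
    using ab by (intro tr_replicate_append3) simp_all
  then have "up ?w = 1" "dn ?w = 1" by simp_all
  moreover have "length ?w = T" using ab by simp
  ultimately show ?thesis by (metis add_mset_commute)
qed

text \<open>The bound on the loops becomes \<open>p + q < T\<close> for the switching times, so the
  sliding move with the extreme new times \<open>T - 1\<close> and \<open>p + q\<close> is
  available.\<close>

lemma slide_pair: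
  assumes T: "3 \<le> T" and len: "length a = T" "length b = T"
    and d: "up a = 1" "dn a = 0" "up b = 1" "dn b = 0" and l: "T \<le> l2 a + l2 b + 1"
  shows "\<exists>a' b'. eqv T {#replicate T True, a, b#} {#replicate T False, a', b'#} \<and> length a' = T \<and> length b' = T \<and>
    up a' = 1 \<and> dn a' = 0 \<and> up b' = 1 \<and> dn b' = 0"
proof -
  have T2: "2 \<le> T" using T by simp
  note ra = rep_up[OF len(1) d(1,2) T2] and rb = rep_up[OF len(2) d(3,4) T2]
  define p q where "p = T - Suc (l2 a)" and "q = T - Suc (l2 b)"
  have pq: "0 < p" "0 < q" "p < T" "q < T" "p + q < T" using ra(2) rb(2) l unfolding p_def q_def by linarith+
  define s where "s k = replicate k True @ replicate (T - k) False" for k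
  have "eqv T {#a, b#} {#s p, s q#}" using eqv_pair[OF ra(1) rb(1)] unfolding p_def q_def s_def .
  then have "eqv T {#replicate T True, a, b#} {#replicate T True, s p, s q#}" by (rule eqv_add_mset)
  moreover have "eqv T {#replicate T True, s p, s q#} {#replicate T False, s (T - 1), s (p + q)#}"
    unfolding s_def using pq T by (intro eqv_slide) simp_all
  ultimately have "eqv T {#replicate T True, a, b#} {#replicate T False, s (T - 1), s (p + q)#}"
    by (rule eqv_trans)
  moreover have "up (s k) = 1 \<and> dn (s k) = 0 \<and> length (s k) = T" if "0 < k" "k < T" for k
  proof -
    have "tr x y (s k) = of_bool (x = True \<and> y = True) * (k - 1) + of_bool (True = x \<and> False = y) +
        of_bool (x = False \<and> y = False) * (T - k - 1)" for x y
      unfolding s_def using that by (intro tr_replicate_append) simp_all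
    then show ?thesis using that by (simp add: s_def)
  qed
  then have "up (s (T - 1)) = 1 \<and> dn (s (T - 1)) = 0 \<and> length (s (T - 1)) = T"
    "up (s (p + q)) = 1 \<and> dn (s (p + q)) = 0 \<and> length (s (p + q)) = T" using pq T by simp_all
  ultimately show ?thesis by blast
qed

text \<open>The new word 2...2 needs \<open>T - 1\<close> loops 22 from the others. If some word has
  a round trip, it is opened against 1...1, loops are gathered on the two parts, and these are
  merged again; this passes through a path from 2 to 1. If all other words are single steps, the
  sliding move does the replacement.\<close>

lemma raise_constant:
  assumes T: "3 \<le> T" and X: "\<forall>x\<in>#X. length x = T \<and> up x = 1 \<and> dn x \<le> 1"
    and l: "T \<le> (\<Sum>x\<in>#X. l2 x) + 1"
  shows "\<exists>X'. eqv T (add_mset (replicate T True) X) (add_mset (replicate T False) X') \<and>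
    (\<forall>x\<in>#X'. length x = T \<and> up x = 1 \<and> dn x \<le> 1)"
proof (cases "\<exists>w\<in>#X. dn w = 1")
  case True
  then obtain w R where w: "dn w = 1" and X': "X = add_mset w R" by (metis multi_member_split)
  have lw: "length w = T" "up w = 1" "\<forall>x\<in>#R. length x = T \<and> up x = 1 \<and> dn x \<le> 1" using X X' by simp_all
  from split_cycle[OF T lw(1,2) w] obtain a b where ab: "eqv T {#replicate T True, w#} {#a, b#}"
    "length a = T" "length b = T" "up a = 0" "dn a = 1" "up b = 1" "dn b = 0" by blast
  have e1: "eqv T (add_mset (replicate T True) X) (add_mset a (add_mset b R))"
    using eqv_add[OF ab(1), of R] X' by simp
  have "l2 (replicate T True) = 0" by (simp add: tr_replicate)
  then have "T \<le> l2 a + l2 b + (\<Sum>x\<in>#R. l2 x) + 1"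
    using eqv_tr[OF e1, of False False] l by simp
  moreover have "up a + dn a = 1" "up b + dn b = 1" "\<forall>x\<in>#R. length x = T \<and> up x + dn x \<ge> 1"
    using ab lw(3) by simp_all
  ultimately obtain a' b' R' where 2: "eqv T (add_mset a (add_mset b R)) (add_mset a' (add_mset b' R'))"
    "length a' = T" "length b' = T" "sw a' = sw a" "sw b' = sw b"
    "\<forall>x\<in>#R'. length x = T \<and> up x + dn x \<ge> 1" "image_mset sw R' = image_mset sw R" "T \<le> l2 a' + l2 b' + 1"
    using raise_pair[OF T ab(2,3)] by blast
  have "up a' = 0" "dn a' = 1" "up b' = 1" "dn b' = 0" using 2(4,5) ab(4-7) by simp_all
  from merge_cycle[OF T 2(2,3) this 2(8)] obtain w' where w': "eqv T {#a', b'#} {#replicate T False, w'#}"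
    "length w' = T" "up w' = 1" "dn w' = 1" by blast
  have e3: "eqv T (add_mset a' (add_mset b' R')) (add_mset (replicate T False) (add_mset w' R'))"
    using eqv_add[OF w'(1), of R'] by simp
  have "length x = T \<and> up x = 1 \<and> dn x \<le> 1" if "x \<in># R'" for x
  proof -
    have "sw x \<in># image_mset sw R" using that unfolding 2(7)[symmetric] by simp
    then obtain y where "y \<in># R" "sw y = sw x" by auto
    then show ?thesis using lw(3) 2(6) that by auto
  qed
  then show ?thesis using eqv_trans[OF e1 eqv_trans[OF 2(1) e3]] w' by (intro exI[of _ "add_mset w' R'"]) simp
next
  case False
  have bound: "l2 x + 2 \<le> T" if "x \<in># X" for x using length_eq_transitions[of x T] X that T by fastforce
  have d0: "dn x = 0" if "x \<in># X" for x
  proof -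
    have "dn x \<le> 1" "dn x \<noteq> 1" using X False that by auto
    then show ?thesis by simp
  qed
  have "X \<noteq> {#}" using l T by auto
  then obtain a R where a: "X = add_mset a R" by (meson multiset_cases)
  \<comment> \<open>A word with one switch has at most \<open>T - 2\<close> loops 22, fewer than the
    total, so a second word exists.\<close>
  have "R \<noteq> {#}" using l bound[of a] a by auto
  then obtain b Q where b: "R = add_mset b Q" by (meson multiset_cases)
  have X': "X = add_mset a (add_mset b Q)" using a b by simp
  have la: "length a = T" "length b = T" "up a = 1" "up b = 1" "dn a = 0" "dn b = 0"
    "\<forall>x\<in>#Q. length x = T \<and> up x = 1 \<and> dn x \<le> 1" using X X' d0 by simp_all
  have "up a + dn a = 1" "up b + dn b = 1" "\<forall>x\<in>#Q. length x = T \<and> up x + dn x \<ge> 1"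
    using la by simp_all
  moreover have "T \<le> l2 a + l2 b + (\<Sum>x\<in>#Q. l2 x) + 1" using l X' by simp
  ultimately obtain a' b' R' where 2: "eqv T X (add_mset a' (add_mset b' R'))"
    "length a' = T" "length b' = T" "sw a' = sw a" "sw b' = sw b"
    "\<forall>x\<in>#R'. length x = T \<and> up x + dn x \<ge> 1" "image_mset sw R' = image_mset sw Q" "T \<le> l2 a' + l2 b' + 1"
    unfolding X' using raise_pair[OF T la(1,2)] by blast
  have "up a' = 1" "dn a' = 0" "up b' = 1" "dn b' = 0" using 2(4,5) la by simp_all
  from slide_pair[OF T 2(2,3) this 2(8)] obtain a2 b2 where s: "eqv T {#replicate T True, a', b'#} {#replicate T False, a2, b2#}"
    "length a2 = T" "length b2 = T" "up a2 = 1" "dn a2 = 0" "up b2 = 1" "dn b2 = 0" by blast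
  have e3: "eqv T (add_mset (replicate T True) (add_mset a' (add_mset b' R'))) (add_mset (replicate T False) (add_mset a2 (add_mset b2 R')))"
    using eqv_add[OF s(1), of R'] by simp
  have "length x = T \<and> up x = 1 \<and> dn x \<le> 1" if "x \<in># R'" for x
  proof -
    have "sw x \<in># image_mset sw Q" using that unfolding 2(7)[symmetric] by simp
    then obtain y where "y \<in># Q" "sw y = sw x" by auto
    then show ?thesis using la(7) 2(6) that by auto
  qed
  then show ?thesis using eqv_trans[OF eqv_add_mset[OF 2(1)] e3] s
    by (intro exI[of _ "add_mset a2 (add_mset b2 R')"]) simp
qed

lemma switches_determined:
  assumes "\<forall>x\<in>#X. up x = 1 \<and> dn x \<le> 1" "\<forall>x\<in>#Y. up x = 1 \<and> dn x \<le> 1"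
    "size X = size Y" "(\<Sum>x\<in>#X. dn x) = (\<Sum>x\<in>#Y. dn x)"
  shows "image_mset sw X = image_mset sw Y"
proof -
  have *: "image_mset sw Z = replicate_mset (\<Sum>x\<in>#Z. dn x) (1, 1) + replicate_mset (size Z - (\<Sum>x\<in>#Z. dn x)) (1, 0) \<and>
      (\<Sum>x\<in>#Z. dn x) \<le> size Z" if "\<forall>x\<in>#Z. up x = 1 \<and> dn x \<le> 1" for Z
    using that
  proof (induction Z)
    case (add x Z)
    then have "dn x = 0 \<or> dn x = 1" by auto
    with add show ?case by (auto simp: Suc_diff_le)
  qed simp
  show ?thesis using *[OF assms(1)] *[OF assms(2)] assms(3,4) by simp
qed

text \<open>Each word 2...2 that the first multiset lacks amounts to \<open>T - 1\<close> loops 22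
  that are spread over \<open>X\<close>, which is the supply that \<open>raise_constant\<close> asks
  for.\<close>

lemma eqv_few_cycles:
  fixes p q r s :: nat
  assumes T: "3 \<le> T" and X: "\<forall>x\<in>#X. length x = T \<and> up x = 1 \<and> dn x \<le> 1"
    and Y: "\<forall>x\<in>#Y. length x = T \<and> up x = 1 \<and> dn x \<le> 1"
    and sums: "size X = size Y" "(\<Sum>x\<in>#X. dn x) = (\<Sum>x\<in>#Y. dn x)"
      "(\<Sum>x\<in>#X. l2 x) + r * (T - 1) = (\<Sum>x\<in>#Y. l2 x) + s * (T - 1)" "p + r = q + s" "r \<le> s"
  shows "eqv T (X + replicate_mset p (replicate T True) + replicate_mset r (replicate T False))
    (Y + replicate_mset q (replicate T True) + replicate_mset s (replicate T False))"
  using X sums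
proof (induction "s - r" arbitrary: X p r)
  case 0
  then have rs: "r = s" "p = q" by simp_all
  have "image_mset sw X = image_mset sw Y" using 0 Y by (intro switches_determined) auto
  then have "eqv T X Y" using 0 Y rs by (intro eqv_same_switches[OF T]) auto
  then show ?case unfolding rs by (intro eqv_add)
next
  case (Suc n)
  then have "Suc r \<le> s" by simp
  then have "Suc r * (T - 1) \<le> s * (T - 1)" by (intro mult_right_mono) simp_all
  then have "T - 1 \<le> (\<Sum>x\<in>#X. l2 x)" using Suc.prems(4) unfolding mult_Suc by linarith
  then have "T \<le> (\<Sum>x\<in>#X. l2 x) + 1" by linarith
  from raise_constant[OF T Suc.prems(1) this] obtain X' where
    X': "eqv T (add_mset (replicate T True) X) (add_mset (replicate T False) X')"
    "\<forall>x\<in>#X'. length x = T \<and> up x = 1 \<and> dn x \<le> 1" by blast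
  obtain p' where p: "p = Suc p'" using Suc.prems(5) \<open>Suc r \<le> s\<close> by (cases p) auto
  let ?R = "replicate_mset p' (replicate T True) + replicate_mset r (replicate T False)"
  have 1: "eqv T (X + replicate_mset p (replicate T True) + replicate_mset r (replicate T False))
      (X' + replicate_mset p' (replicate T True) + replicate_mset (Suc r) (replicate T False))"
    using eqv_add[OF X'(1), of ?R] unfolding p by (simp add: ac_simps)
  have "eqv T (X' + replicate_mset p' (replicate T True) + replicate_mset (Suc r) (replicate T False))
    (Y + replicate_mset q (replicate T True) + replicate_mset s (replicate T False))"
  proof (rule Suc.hyps(1)[OF _ X'(2)])
    show "n = s - Suc r" "p' + Suc r = q + s" "Suc r \<le> s"
      using Suc.hyps(2) Suc.prems(5) p \<open>Suc r \<le> s\<close> by simp_all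
    show "size X' = size Y" using eqv_size[OF X'(1)] Suc.prems(2) by simp
    show "(\<Sum>x\<in>#X'. dn x) = (\<Sum>x\<in>#Y. dn x)"
      using eqv_tr[OF X'(1), of False True] Suc.prems(3) by (simp add: tr_replicate)
    show "(\<Sum>x\<in>#X'. l2 x) + Suc r * (T - 1) = (\<Sum>x\<in>#Y. l2 x) + s * (T - 1)"
      using eqv_tr[OF X'(1), of False False] Suc.prems(4) by (simp add: tr_replicate)
  qed
  then show ?case by (rule eqv_trans[OF 1])
qed

lemma two_valued_multiset:
  "\<forall>x\<in>#Z. x = a \<or> x = b \<Longrightarrow> \<exists>p r. Z = replicate_mset p a + replicate_mset r b"
proof (induction Z)
  case empty
  show ?case by (rule_tac exI[of _ 0], rule_tac exI[of _ 0]) simp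
next
  case (add x Z)
  then obtain p r where Z: "Z = replicate_mset p a + replicate_mset r b" by auto
  have "x = a \<or> x = b" using add.prems by simp
  then show ?case
  proof
    assume x: "x = a"
    have "add_mset x Z = replicate_mset (Suc p) a + replicate_mset r b" unfolding x Z by simp
    then show ?case by blast
  next
    assume x: "x = b"
    have "add_mset x Z = replicate_mset p a + replicate_mset (Suc r) b" unfolding x Z by simp
    then show ?case by blast
  qed
qed

lemma split_constants:
  assumes T: "3 \<le> T" and X: "\<forall>x\<in>#X. length x = T \<and> (up x = 0 \<longrightarrow> dn x = 0)"
  shows "\<exists>p r. X = filter_mset (\<lambda>x. up x \<noteq> 0) X + replicate_mset p (replicate T True) + replicate_mset r (replicate T False)"
proof -
  have "\<forall>x\<in>#filter_mset (\<lambda>x. up x = 0) X. x = replicate T True \<or> x = replicate T False"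
  proof
    fix x assume "x \<in># filter_mset (\<lambda>x. up x = 0) X"
    then have "length x = T" "up x = 0" "dn x = 0" using X by simp_all
    then show "x = replicate T True \<or> x = replicate T False" using constant_word T by blast
  qed
  from two_valued_multiset[OF this] obtain p r where
    *: "filter_mset (\<lambda>x. up x = 0) X = replicate_mset p (replicate T True) + replicate_mset r (replicate T False)"
    by (elim exE)
  have "X = filter_mset (\<lambda>x. up x \<noteq> 0) X + filter_mset (\<lambda>x. up x = 0) X"
    using multiset_partition[of X "\<lambda>x. up x \<noteq> 0"] by (simp only: not_not)
  then show ?thesis unfolding * add.assoc[symmetric] by (intro exI)
qed

lemma size_le_sum_up:
  assumes "\<forall>x\<in>#X. up x \<ge> 1"
  shows "size X \<le> (\<Sum>x\<in>#X. up x)"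
proof -
  have "(\<Sum>x\<in>#X. 1) \<le> (\<Sum>x\<in>#X. up x)" using assms by (intro sum_mset_mono) auto
  then show ?thesis by (simp add: size_eq_sum_mset[symmetric])
qed

lemma sum_up_le_size:
  assumes "\<forall>x\<in>#X. up x \<le> 1"
  shows "(\<Sum>x\<in>#X. up x) \<le> size X"
proof -
  have "(\<Sum>x\<in>#X. up x) \<le> (\<Sum>x\<in>#X. 1)" using assms by (intro sum_mset_mono) auto
  then show ?thesis by (simp add: size_eq_sum_mset[symmetric])
qed

lemma sum_replicate_mset: "(\<Sum>x\<in>#replicate_mset n a. f x) = n * f a" for f :: "'a \<Rightarrow> nat"
  by (induction n) auto

lemma eqv_no_down:
  assumes T: "3 \<le> T" and X: "\<forall>x\<in>#X. length x = T \<and> dn x \<le> up x"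
    and Y: "\<forall>x\<in>#Y. length x = T \<and> dn x \<le> up x"
    and sums: "size X = size Y" "(\<Sum>x\<in>#X. up x) = (\<Sum>x\<in>#Y. up x)" "(\<Sum>x\<in>#X. dn x) = (\<Sum>x\<in>#Y. dn x)"
      "(\<Sum>x\<in>#X. l2 x) = (\<Sum>x\<in>#Y. l2 x)"
  shows "eqv T X Y"
proof -
  from reduce_constants[OF T X] obtain X1 where X1: "eqv T X X1" "\<forall>x\<in>#X1. length x = T \<and> dn x \<le> up x"
    "(\<forall>x\<in>#X1. up x \<ge> 1) \<or> (\<forall>x\<in>#X1. up x \<le> 1)" by blast
  from reduce_constants[OF T Y] obtain Y1 where Y1: "eqv T Y Y1" "\<forall>x\<in>#Y1. length x = T \<and> dn x \<le> up x"
    "(\<forall>x\<in>#Y1. up x \<ge> 1) \<or> (\<forall>x\<in>#Y1. up x \<le> 1)" by blast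
  have sums1: "size X1 = size Y1" "(\<Sum>x\<in>#X1. up x) = (\<Sum>x\<in>#Y1. up x)" "(\<Sum>x\<in>#X1. dn x) = (\<Sum>x\<in>#Y1. dn x)"
      "(\<Sum>x\<in>#X1. l2 x) = (\<Sum>x\<in>#Y1. l2 x)"
    using sums eqv_size[OF X1(1)] eqv_size[OF Y1(1)] eqv_tr[OF X1(1)] eqv_tr[OF Y1(1)] by simp_all
  have "eqv T X1 Y1"
  \<comment> \<open>Invariants decide which outcome of \<open>reduce_constants\<close> occurs, and
    so it is the same for both sides: with at least as many switches 12 as words no constant word
    can remain, and with fewer there must be one.\<close>
  proof (cases "size X1 \<le> (\<Sum>x\<in>#X1. up x)")
    case True
    have ge: "\<forall>x\<in>#Z. up x \<ge> 1" if Z: "(\<forall>x\<in>#Z. up x \<ge> 1) \<or> (\<forall>x\<in>#Z. up x \<le> 1)" "size Z \<le> (\<Sum>x\<in>#Z. up x)" for Z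
    proof (rule ccontr)
      assume no: "\<not> ?thesis"
      then obtain x where x: "x \<in># Z" "up x = 0" by (auto simp: not_le)
      then obtain R where R: "Z = add_mset x R" by (metis multi_member_split)
      have "\<forall>x\<in>#Z. up x \<le> 1" using Z(1) no by blast
      then have "(\<Sum>x\<in>#R. up x) \<le> size R" using R by (intro sum_up_le_size) simp
      then show False using Z(2) R x by simp
    qed
    have "\<forall>x\<in>#X1. up x \<ge> 1" "\<forall>x\<in>#Y1. up x \<ge> 1"
      using ge[OF X1(3)] ge[OF Y1(3)] True sums1(1,2) by simp_all
    then show ?thesis using X1(2) Y1(2) sums1 by (intro eqv_nonconstant[OF T]) blast+
  next
    case False
    have "\<not> (\<forall>x\<in>#X1. up x \<ge> 1)" "\<not> (\<forall>x\<in>#Y1. up x \<ge> 1)"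
      using size_le_sum_up[of X1] size_le_sum_up[of Y1] False sums1 by auto
    then have le: "\<forall>x\<in>#X1. up x \<le> 1" "\<forall>x\<in>#Y1. up x \<le> 1" using X1(3) Y1(3) by blast+
    have const: "\<forall>x\<in>#X1. length x = T \<and> (up x = 0 \<longrightarrow> dn x = 0)" "\<forall>x\<in>#Y1. length x = T \<and> (up x = 0 \<longrightarrow> dn x = 0)"
      using X1(2) Y1(2) by auto
    define F where "F = filter_mset (\<lambda>x. up x \<noteq> 0)"
    from split_constants[OF T const(1)] obtain p r where
      Xs: "X1 = F X1 + replicate_mset p (replicate T True) + replicate_mset r (replicate T False)"
      unfolding F_def by (elim exE)
    from split_constants[OF T const(2)] obtain q s where
      Ys: "Y1 = F Y1 + replicate_mset q (replicate T True) + replicate_mset s (replicate T False)"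
      unfolding F_def by (elim exE)
    have F: "\<forall>x\<in>#F X1. length x = T \<and> up x = 1 \<and> dn x \<le> 1" "\<forall>x\<in>#F Y1. length x = T \<and> up x = 1 \<and> dn x \<le> 1"
    proof -
      have "\<forall>x\<in>#F Z. length x = T \<and> up x = 1 \<and> dn x \<le> 1"
        if Z: "\<forall>x\<in>#Z. length x = T \<and> dn x \<le> up x" "\<forall>x\<in>#Z. up x \<le> 1" for Z
      proof
        fix x assume "x \<in># F Z"
        then have "x \<in># Z" "up x \<noteq> 0" unfolding F_def by simp_all
        then have "length x = T" "dn x \<le> up x" "up x \<le> 1" using Z by blast+
        then show "length x = T \<and> up x = 1 \<and> dn x \<le> 1" using \<open>up x \<noteq> 0\<close> by linarith
      qed
      then show "\<forall>x\<in>#F X1. length x = T \<and> up x = 1 \<and> dn x \<le> 1" "\<forall>x\<in>#F Y1. length x = T \<and> up x = 1 \<and> dn x \<le> 1"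
        using X1(2) Y1(2) le by blast+
    qed
    have szF: "size Z = (\<Sum>x\<in>#Z. up x)" if "\<forall>x\<in>#Z. length x = T \<and> up x = 1 \<and> dn x \<le> 1" for Z
      using size_le_sum_up[of Z] sum_up_le_size[of Z] that by auto
    have sx: "size X1 = size (F X1) + p + r" "(\<Sum>x\<in>#X1. up x) = (\<Sum>x\<in>#F X1. up x)" "(\<Sum>x\<in>#X1. dn x) = (\<Sum>x\<in>#F X1. dn x)"
      "(\<Sum>x\<in>#X1. l2 x) = (\<Sum>x\<in>#F X1. l2 x) + r * (T - 1)"
      by (subst Xs, simp add: sum_replicate_mset tr_replicate)+
    have sy: "size Y1 = size (F Y1) + q + s" "(\<Sum>x\<in>#Y1. up x) = (\<Sum>x\<in>#F Y1. up x)" "(\<Sum>x\<in>#Y1. dn x) = (\<Sum>x\<in>#F Y1. dn x)"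
      "(\<Sum>x\<in>#Y1. l2 x) = (\<Sum>x\<in>#F Y1. l2 x) + s * (T - 1)"
      by (subst Ys, simp add: sum_replicate_mset tr_replicate)+
    have s0: "size (F X1) = size (F Y1)" "(\<Sum>x\<in>#F X1. dn x) = (\<Sum>x\<in>#F Y1. dn x)"
      "(\<Sum>x\<in>#F X1. l2 x) + r * (T - 1) = (\<Sum>x\<in>#F Y1. l2 x) + s * (T - 1)" "p + r = q + s"
      using szF[OF F(1)] szF[OF F(2)] sx sy sums1 by linarith+
    show ?thesis
    proof (cases "r \<le> s")
      case True
      then show ?thesis by (subst Xs, subst Ys) (intro eqv_few_cycles[OF T F s0])
    next
      case False
      then have "s \<le> r" by simp
      then show ?thesis
        by (subst Xs, subst Ys) (intro eqv_sym[OF eqv_few_cycles[OF T F(2,1) s0[symmetric]]])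
    qed
  qed
  then show ?thesis using X1(1) Y1(1) eqv_trans eqv_sym by blast
qed

section \<open>Words from 2 to 1\<close>

abbreviation neg :: "bool list multiset \<Rightarrow> nat" where
  "neg M \<equiv> size (filter_mset (\<lambda>w. up w < dn w) M)"

text \<open>For w from 1 to 2 and w' from 2 to 1: every word with the counts of w is complementary to every
  word with the counts of w', so that the two never share a state at any time.\<close>

abbreviation flipped :: "bool list \<Rightarrow> bool list \<Rightarrow> bool" where
  "flipped w w' \<equiv> up w' = dn w \<and> l2 w' = l1 w \<and> l1 w' = l2 w \<and> (dn w = 0 \<or> l1 w + l2 w = 0)"

text \<open>A pair that is not \<open>flipped\<close> could be turned into two closed words, which
  removes a path from 2 to 1. The bound on \<open>neg\<close> makes this applicable to every
  rearrangement of \<open>M\<close> that has no more such paths than \<open>M\<close>.\<close>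

lemma minimal_flipped:
  assumes min: "\<And>M'. eqv T M M' \<Longrightarrow> neg M \<le> neg M'"
    and M: "eqv T M (add_mset a (add_mset b Q))" "neg (add_mset a (add_mset b Q)) \<le> neg M"
    and len: "length a = T" "length b = T" and d: "up a = dn a + 1" "dn b = up b + 1"
  shows "flipped a b"
proof (rule ccontr)
  assume "\<not> flipped a b"
  from opposite_to_balanced[OF len d this] obtain x y where
    xy: "eqv T {#a, b#} {#x, y#}" "length x = T" "length y = T" "up x = dn x" "up y = dn y" by blast
  have "eqv T (add_mset a (add_mset b Q)) (add_mset x (add_mset y Q))"
    using eqv_add[OF xy(1), of Q] by simp
  from min[OF eqv_trans[OF M(1) this]] show False using M(2) d xy by simp
qed

text \<open>A third word may exchange loops or round trips with one member of a pair only if the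
  pair stays \<open>flipped\<close>. A pair without round trips tolerates no change of one member's
  loops, and a pair with round trips has no loops at all; these two cases give the two
  forms.\<close>

lemma minimal_forms:
  assumes T: "3 \<le> T" and min: "\<And>M'. eqv T M M' \<Longrightarrow> neg M \<le> neg M'"
    and M: "\<forall>x\<in>#M. length x = T" and D: "(\<Sum>x\<in>#M. dn x) \<le> (\<Sum>x\<in>#M. up x)" and pos: "neg M > 0"
  shows "(\<exists>a b R. M = add_mset a (add_mset b R) \<and> sw a = (1, 0) \<and> sw b = (0, 1) \<and> l2 a + l2 b + 2 = T \<and>
      (\<forall>x\<in>#R. up x = dn x \<and> (up x = 0 \<or> T = 3))) \<or>
    (\<exists>k. T = 2 * k + 2 \<and> (\<forall>x\<in>#M. up x + dn x \<ge> 1 \<and>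
      (if up x = dn x then l1 x + l2 x = 1 else l1 x + l2 x = 0)))"
proof -
  have tot: "Suc (l1 x + up x + dn x + l2 x) = T" if "length x = T" for x
    using length_eq_transitions[OF that] T by linarith
  have ne: "x \<noteq> []" if "length x = T" for x :: "bool list" using that T by auto
  have "\<exists>b\<in>#M. up b < dn b"
  proof (rule ccontr)
    assume no: "\<not> ?thesis"
    have "filter_mset (\<lambda>w. up w < dn w) M = filter_mset (\<lambda>w. False) M"
      using no by (intro filter_mset_cong) auto
    then have "neg M = 0" by (simp only: filter_mset_False size_empty)
    then show False using pos by linarith
  qed
  then obtain b where b: "b \<in># M" "up b < dn b" by blast
  have "\<exists>a\<in>#M. dn a < up a"
  proof (rule ccontr)
    assume no: "\<not> ?thesis"
    obtain Q where Q: "M = add_mset b Q" using b(1) by (metis multi_member_split)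
    have "(\<Sum>x\<in>#Q. up x) \<le> (\<Sum>x\<in>#Q. dn x)" using no Q by (intro sum_mset_mono) (auto simp: not_less)
    then show False using D b(2) Q by simp
  qed
  then obtain a where a: "a \<in># M" "dn a < up a" by blast
  have "a \<noteq> b" using a b by auto
  then obtain R where R: "M = add_mset a (add_mset b R)" using a(1) b(1) by (metis insert_noteq_member multi_member_split)
  have la: "length a = T" "up a = dn a + 1" and lb: "length b = T" "dn b = up b + 1"
    using M R a(2) b(2) up_le[OF ne, of a] dn_le[OF ne, of b] by simp_all
  have lR: "length x = T" if "x \<in># R" for x using M R that by simp
  note K = minimal_flipped[OF min]
  have Kab: "flipped x y" if "eqv T {#a, b#} {#x, y#}" "sw x = sw a" "sw y = sw b" "length x = T" "length y = T" for x y
  proof (rule K)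
    show "eqv T M (add_mset x (add_mset y R))" using eqv_add[OF that(1), of R] R by simp
    show "neg (add_mset x (add_mset y R)) \<le> neg M" using that R by simp
  qed (use that la lb in simp_all)
  have ab: "flipped a b" using Kab[OF eqv_refl] la lb by simp
  have Ka: "flipped x y" if R': "R = add_mset z Q" and e: "eqv T {#a, z#} {#x, z'#}" "sw x = sw a" "sw z' = sw z"
    "length x = T" and y: "y = b" for x y z z' Q
  proof (rule K)
    show "eqv T M (add_mset x (add_mset y (add_mset z' Q)))"
      using eqv_add[OF e(1), of "add_mset b Q"] R R' y by (simp add: add_mset_commute)
    show "neg (add_mset x (add_mset y (add_mset z' Q))) \<le> neg M" using e R R' y by simp
    show "length x = T" by (fact e)
    show "length y = T" "dn y = up y + 1" unfolding y by (fact lb)+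
    show "up x = dn x + 1" using e(2) la(2) by simp
  qed
  have Kb: "flipped a y" if R': "R = add_mset z Q" and e: "eqv T {#b, z#} {#y, z'#}" "sw y = sw b" "sw z' = sw z"
    "length y = T" for y z z' Q
  proof (rule K)
    show "eqv T M (add_mset a (add_mset y (add_mset z' Q)))"
      using eqv_add_mset[OF eqv_add[OF e(1), of Q], of a] R R' by simp
    show "neg (add_mset a (add_mset y (add_mset z' Q))) \<le> neg M" using e R R' by simp
    show "length a = T" "up a = dn a + 1" by (fact la)+
    show "length y = T" by (fact e)
    show "dn y = up y + 1" using e(2) lb(2) by simp
  qed
  have swap: "flipped x b" if x: "x \<in># R" and d: "up x = dn x + 1" for x
  proof -
    obtain Q where Q: "R = add_mset x Q" by (rule mset_add[OF x])
    show ?thesis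
    proof (rule K)
      show "eqv T M (add_mset x (add_mset b (add_mset a Q)))" using R Q by (simp add: add_mset_commute eqv_refl)
      show "neg (add_mset x (add_mset b (add_mset a Q))) \<le> neg M" using R Q by simp
    qed (use lR[OF x] d lb in simp_all)
  qed
  have swap': "flipped a x" if x: "x \<in># R" and d: "dn x = up x + 1" for x
  proof -
    obtain Q where Q: "R = add_mset x Q" by (rule mset_add[OF x])
    show ?thesis
    proof (rule K)
      show "eqv T M (add_mset a (add_mset x (add_mset b Q)))" using R Q by (simp add: add_mset_commute eqv_refl)
      show "neg (add_mset a (add_mset x (add_mset b Q))) \<le> neg M" using R Q by simp
    qed (use lR[OF x] d la in simp_all)
  qed
  have tri: "up x = dn x \<or> up x = dn x + 1 \<or> dn x = up x + 1" if "length x = T" for x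
    using up_le[OF ne[OF that]] dn_le[OF ne[OF that]] by linarith
  show ?thesis
  proof (cases "dn a = 0")
    case True
    then have swa: "up a = 1" "dn a = 0" "up b = 0" "dn b = 1" using la lb ab by simp_all
    have lab: "l2 a + l2 b + 2 = T" "l1 a + l2 a + 2 = T" "l1 b + l2 b + 2 = T"
      using tot[OF la(1)] tot[OF lb(1)] swa ab by simp_all
    \<comment> \<open>A loop exchange inside the pair changes \<open>l2\<close> of both members and
      keeps their directions. A third word that is not closed would have to be complementary to a
      member before and after this change.\<close>
    have bal: "up x = dn x" if x: "x \<in># R" for x
    proof (rule ccontr)
      assume "up x \<noteq> dn x"
      then have x': "up x = dn x + 1 \<or> dn x = up x + 1" using tri[OF lR[OF x]] by blast
      obtain Q where Q: "R = add_mset x Q" by (rule mset_add[OF x])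
      have "\<exists>a' b'. eqv T {#a, b#} {#a', b'#} \<and> length a' = T \<and> length b' = T \<and> sw a' = sw a \<and> sw b' = sw b \<and>
        l2 a' \<noteq> l2 a \<and> l2 b' \<noteq> l2 b"
      proof (cases "l1 a \<ge> 1")
        case True
        then have "l2 b \<ge> 1" using ab by simp
        moreover have "up a + dn a \<ge> 1" "up b + dn b \<ge> 1" using swa by simp_all
        ultimately obtain a' b' where "eqv T {#a, b#} {#a', b'#}" "length a' = T" "length b' = T" "up a' = up a" "dn a' = dn a"
          "l2 a' = l2 a + 1" "up b' = up b" "dn b' = dn b" "l2 b = l2 b' + 1"
          using loop_exchange[OF T la(1) lb(1) _ _ True] by blast
        then show ?thesis by (intro exI[of _ a'] exI[of _ b']) simp
      next
        case False
        then have "l2 a \<ge> 1" "l1 b \<ge> 1" using lab T ab by linarith+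
        moreover have "up a + dn a \<ge> 1" "up b + dn b \<ge> 1" using swa by simp_all
        ultimately obtain b' a' where "eqv T {#b, a#} {#b', a'#}" "length a' = T" "length b' = T" "up a' = up a" "dn a' = dn a"
          "l2 b' = l2 b + 1" "up b' = up b" "dn b' = dn b" "l2 a = l2 a' + 1"
          using loop_exchange[OF T lb(1) la(1)] by blast
        then show ?thesis by (intro exI[of _ a'] exI[of _ b']) (simp add: add_mset_commute)
      qed
      then obtain a' b' where e: "eqv T {#a, b#} {#a', b'#}" "length a' = T" "length b' = T" "sw a' = sw a" "sw b' = sw b"
        "l2 a' \<noteq> l2 a" "l2 b' \<noteq> l2 b" by blast
      have e': "eqv T M (add_mset a' (add_mset b' (add_mset x Q)))"
        using eqv_add[OF e(1), of R] R Q by (simp add: add_mset_commute)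
      have ng: "neg (add_mset a' (add_mset b' (add_mset x Q))) = neg M" using e(4,5) R Q by simp
      from x' show False
      proof
        assume up: "up x = dn x + 1"
        have "flipped x b'"
        proof (rule K)
          show "eqv T M (add_mset x (add_mset b' (add_mset a' Q)))" using e' by (simp add: add_mset_commute)
          show "neg (add_mset x (add_mset b' (add_mset a' Q))) \<le> neg M" using ng by (simp add: add_mset_commute)
        qed (use lR[OF x] e up lb in simp_all)
        then show False using swap[OF x up] e(7) by simp
      next
        assume dn: "dn x = up x + 1"
        have "flipped a' x"
        proof (rule K)
          show "eqv T M (add_mset a' (add_mset x (add_mset b' Q)))" using e' by (simp add: add_mset_commute)
          show "neg (add_mset a' (add_mset x (add_mset b' Q))) \<le> neg M" using ng by (simp add: add_mset_commute)
        qed (use lR[OF x] e dn la in simp_all)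
        then show False using swap'[OF x dn] e(6) by simp
      qed
    qed
    \<comment> \<open>For \<open>T \<ge> 4\<close>, a closed nonconstant word could trade a loop
      with just one member of the pair or, having no loop, hand \<open>a\<close> a round trip.
      Either way the counts of the pair cease to be complementary.\<close>
    have "up x = 0 \<or> T = 3" if x: "x \<in># R" for x
    proof (rule ccontr)
      assume no: "\<not> ?thesis"
      then have T4: "4 \<le> T" and x1: "up x \<ge> 1" "dn x = up x" using T bal[OF x] by simp_all
      obtain Q where Q: "R = add_mset x Q" by (rule mset_add[OF x])
      note lx = lR[OF x]
      have sx: "up x + dn x \<ge> 1" and sa: "up a + dn a \<ge> 1" and sb: "up b + dn b \<ge> 1" using x1 swa by simp_all
      consider "l2 x \<ge> 1" "l1 a \<ge> 1" | "l2 x \<ge> 1" "l1 b \<ge> 1" | "l1 x \<ge> 1" "l2 a \<ge> 1" | "l1 x \<ge> 1" "l2 b \<ge> 1"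
        | "l1 x = 0" "l2 x = 0"
      proof -
        have "l1 a \<ge> 1 \<or> l1 b \<ge> 1" "l2 a \<ge> 1 \<or> l2 b \<ge> 1" using lab T ab by linarith+
        then show thesis using that by (metis less_one not_le)
      qed
      then show False
      proof cases
        case 1
        from loop_exchange[OF T la(1) lx sa sx 1(2,1)] obtain a' x' where e: "eqv T {#a, x#} {#a', x'#}" "length a' = T"
          "up a' = up a" "dn a' = dn a" "l2 a' = l2 a + 1" "up x' = up x" "dn x' = dn x" by blast
        have "flipped a' b" using e by (intro Ka[OF Q e(1)]) simp_all
        then show False using ab e(5) by simp
      next
        case 2
        from loop_exchange[OF T lb(1) lx sb sx 2(2,1)] obtain b' x' where e: "eqv T {#b, x#} {#b', x'#}" "length b' = T"
          "up b' = up b" "dn b' = dn b" "l2 b' = l2 b + 1" "up x' = up x" "dn x' = dn x" by blast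
        have "flipped a b'" using e by (intro Kb[OF Q e(1)]) simp_all
        then show False using ab e(5) by simp
      next
        case 3
        from loop_exchange[OF T lx la(1) sx sa 3] obtain x' a' where e: "eqv T {#x, a#} {#x', a'#}" "length a' = T"
          "up a' = up a" "dn a' = dn a" "l2 a = l2 a' + 1" "up x' = up x" "dn x' = dn x" by blast
        have "flipped a' b" using e by (intro Ka[OF Q e(1)[unfolded add_mset_commute[of x] add_mset_commute[of x']]]) simp_all
        then show False using ab e(5) by simp
      next
        case 4
        from loop_exchange[OF T lx lb(1) sx sb 4] obtain x' b' where e: "eqv T {#x, b#} {#x', b'#}" "length b' = T"
          "up b' = up b" "dn b' = dn b" "l2 b = l2 b' + 1" "up x' = up x" "dn x' = dn x" by blast
        have "flipped a b'" using e by (intro Kb[OF Q e(1)[unfolded add_mset_commute[of x] add_mset_commute[of x']]]) simp_all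
        then show False using ab e(5) by simp
      next
        case 5
        have "2 \<le> up x" "up a + dn a + 2 < T" using tot[OF lx] 5 x1 T4 swa by linarith+
        from cycle_transfer[OF T lx la(1) _ _ this] obtain x' a' where e: "eqv T {#x, a#} {#x', a'#}" "length a' = T"
          "up x = up x' + 1" "dn x = dn x' + 1" "up a' = up a + 1" "dn a' = dn a + 1"
          using x1 swa by auto
        have "flipped a' b"
        proof (rule K)
          show "eqv T M (add_mset a' (add_mset b (add_mset x' Q)))"
            using eqv_add[OF e(1), of "add_mset b Q"] R Q by (simp add: add_mset_commute)
          show "neg (add_mset a' (add_mset b (add_mset x' Q))) \<le> neg M" using e R Q x1 la by simp
        qed (use e la lb in simp_all)
        then show False using swa e by simp
      qed
    qed
    then show ?thesis using R swa lab(1) bal by blast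
  next
    case False
    then have noloop: "l1 a = 0" "l2 a = 0" "dn a \<ge> 1" using ab by auto
    have noloop_b: "l1 b = 0" "l2 b = 0" using ab noloop by simp_all
    have Ta: "T = 2 * dn a + 2" using tot[OF la(1)] noloop la by simp
    have one: "up x + dn x \<ge> 1 \<and> (if up x = dn x then l1 x + l2 x = 1 else l1 x + l2 x = 0)" if x: "x \<in># R" for x
    proof -
      note lx = lR[OF x]
      consider "up x = dn x + 1" | "dn x = up x + 1" | "up x = dn x" using tri[OF lx] by blast
      then show ?thesis
      proof cases
        case 1
        then show ?thesis using swap[OF x 1] noloop_b by simp
      next
        case 2
        then show ?thesis using swap'[OF x 2] noloop by simp
      next
        case 3
        \<comment> \<open>Two loops in \<open>x\<close> would leave room for a round trip of
          \<open>a\<close>, after which \<open>up b = dn a\<close> fails. So there is at most one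
          loop, and since \<open>T\<close> is even a closed word has exactly one.\<close>
        have "\<not> up x + dn x + 2 < T"
        proof
          assume lt: "up x + dn x + 2 < T"
          obtain Q where Q: "R = add_mset x Q" by (rule mset_add[OF x])
          have "dn a \<le> up a" "dn x \<le> up x" "2 \<le> up a" using la noloop 3 by simp_all
          from cycle_transfer[OF T la(1) lx this lt] obtain a' x' where e: "eqv T {#a, x#} {#a', x'#}" "length a' = T"
            "up a = up a' + 1" "dn a = dn a' + 1" "up x' = up x + 1" "dn x' = dn x + 1" by blast
          have "flipped a' b"
          proof (rule K)
            show "eqv T M (add_mset a' (add_mset b (add_mset x' Q)))"
              using eqv_add[OF e(1), of "add_mset b Q"] R Q by (simp add: add_mset_commute)
            show "neg (add_mset a' (add_mset b (add_mset x' Q))) \<le> neg M" using e R Q 3 la by simp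
          qed (use e la lb in simp_all)
          then show False using ab e by simp
        qed
        then have "dn a \<le> dn x" "dn x \<le> dn a" using tot[OF lx] 3 Ta by linarith+
        then show ?thesis using tot[OF lx] 3 Ta noloop(3) by simp
      qed
    qed
    have "\<forall>x\<in>#M. up x + dn x \<ge> 1 \<and> (if up x = dn x then l1 x + l2 x = 1 else l1 x + l2 x = 0)"
      using one R noloop noloop_b la lb by simp
    then show ?thesis using Ta by blast
  qed
qed

section \<open>Comparing minimal tables through their totals\<close>

abbreviation bal :: "bool list multiset \<Rightarrow> nat" where
  "bal M \<equiv> size (filter_mset (\<lambda>w. up w = dn w) M)"

lemma trichotomy:
  assumes "length x = T" "3 \<le> T"
  shows "up x = dn x \<or> up x = dn x + 1 \<or> dn x = up x + 1"
proof -
  have "x \<noteq> []" using assms by auto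
  then show ?thesis using up_le[of x] dn_le[of x] by linarith
qed

text \<open>The quantity \<open>1 + dn x - up x\<close> is 1 for closed words, 0 from 1 to 2 and 2
  from 2 to 1. Hence \<open>bal + 2 * neg\<close> depends on the totals only.\<close>

lemma size_bal_neg:
  assumes T: "3 \<le> T" and M: "\<forall>x\<in>#M. length x = T"
  shows "size M + (\<Sum>x\<in>#M. dn x) = bal M + 2 * neg M + (\<Sum>x\<in>#M. up x)"
  using M
proof (induction M)
  case (add x M)
  then have IH: "size M + (\<Sum>x\<in>#M. dn x) = bal M + 2 * neg M + (\<Sum>x\<in>#M. up x)" and x: "length x = T" by simp_all
  from trichotomy[OF x T] show ?case
  proof (elim disjE)
    assume "up x = dn x" then show ?case using IH by simp
  next
    assume "up x = dn x + 1" then show ?case using IH by simp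
  next
    assume "dn x = up x + 1" then show ?case using IH by simp
  qed
qed simp

lemma sum_mset_pointwise:
  fixes f g :: "'a \<Rightarrow> nat"
  assumes "\<forall>x\<in>#M. g x \<le> f x" "(\<Sum>x\<in>#M. f x) \<le> (\<Sum>x\<in>#M. g x)" "x \<in># M"
  shows "f x = g x"
proof -
  obtain R where R: "M = add_mset x R" using assms(3) by (metis multi_member_split)
  have "(\<Sum>x\<in>#R. g x) \<le> (\<Sum>x\<in>#R. f x)" using assms(1) R by (intro sum_mset_mono) simp
  then show ?thesis using assms(1,2) R by simp
qed

lemma sum_of_bool: "(\<Sum>x\<in>#M. of_bool (P x)) = size (filter_mset P M)"
  by (induction M) auto

text \<open>With the loops fixed, the length determines the switches: \<open>k\<close> in each
  direction, and one more in the direction of travel if the word is not closed.\<close>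

lemma saturated_switches:
  assumes T: "T = 2 * k + 2" "3 \<le> T" and M: "\<forall>x\<in>#M. length x = T \<and> (l1 x + l2 x = of_bool (up x = dn x))"
  shows "image_mset sw M = replicate_mset (bal M) (k, k) + replicate_mset (neg M) (k, k + 1) +
    replicate_mset (size M - bal M - neg M) (k + 1, k) \<and> bal M + neg M \<le> size M"
  using M
proof (induction M)
  case (add x M)
  then have IH: "image_mset sw M = replicate_mset (bal M) (k, k) + replicate_mset (neg M) (k, k + 1) +
    replicate_mset (size M - bal M - neg M) (k + 1, k)" "bal M + neg M \<le> size M"
    and x: "length x = T" "l1 x + l2 x = of_bool (up x = dn x)" by simp_all
  have tot: "Suc (l1 x + up x + dn x + l2 x) = T" using length_eq_transitions[OF x(1)] T(2) by linarith
  from trichotomy[OF x(1) T(2)] show ?case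
  proof (elim disjE)
    assume d: "up x = dn x"
    then have "up x = k" "dn x = k" using tot x(2) T(1) by simp_all
    then show ?case using IH by simp
  next
    assume d: "up x = dn x + 1"
    then have "up x = k + 1" "dn x = k" using tot x(2) T(1) by simp_all
    then show ?case using IH by (simp add: Suc_diff_le)
  next
    assume d: "dn x = up x + 1"
    then have "up x = k" "dn x = k + 1" using tot x(2) T(1) by simp_all
    then show ?case using IH by simp
  qed
qed simp

lemma sum_tr_total:
  assumes "\<forall>x\<in>#M. length x = T" "1 \<le> T"
  shows "size M + (\<Sum>x\<in>#M. l1 x) + (\<Sum>x\<in>#M. up x) + (\<Sum>x\<in>#M. dn x) + (\<Sum>x\<in>#M. l2 x) = T * size M"
  using assms(1)
proof (induction M)
  case (add x M)
  then show ?case using length_eq_transitions[of x T] assms(2) by simp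
qed simp

text \<open>For even \<open>T\<close> every closed word has an odd number of loops, so a table has
  at least \<open>bal\<close> loops. As \<open>bal + 2 * neg\<close> is invariant,
  \<open>neg X \<le> neg Y\<close> gives \<open>bal X \<ge> bal Y\<close>, and \<open>bal Y\<close>
  is the common loop total. Equality follows throughout, so \<open>X\<close> is saturated as
  well.\<close>

lemma eqv_saturated:
  assumes T: "T = 2 * k + 2" "3 \<le> T" and X: "\<forall>x\<in>#X. length x = T" and Y: "\<forall>x\<in>#Y. length x = T"
    and sat: "\<forall>x\<in>#Y. l1 x + l2 x = of_bool (up x = dn x)"
    and sums: "size X = size Y" "(\<Sum>x\<in>#X. up x) = (\<Sum>x\<in>#Y. up x)" "(\<Sum>x\<in>#X. dn x) = (\<Sum>x\<in>#Y. dn x)"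
      "(\<Sum>x\<in>#X. l2 x) = (\<Sum>x\<in>#Y. l2 x)"
    and neg: "neg X \<le> neg Y"
  shows "eqv T X Y"
proof -
  have T1: "1 \<le> T" using T by simp
  have tot: "Suc (l1 x + up x + dn x + l2 x) = T" if "length x = T" for x
    using length_eq_transitions[OF that T1] .
  have "(\<Sum>x\<in>#X. l1 x) = (\<Sum>x\<in>#Y. l1 x)"
    using sum_tr_total[OF X T1] sum_tr_total[OF Y T1] sums by simp
  then have loops: "(\<Sum>x\<in>#X. l1 x + l2 x) = (\<Sum>x\<in>#Y. l1 x + l2 x)" using sums(4) by (simp add: sum_mset.distrib)
  have "image_mset (\<lambda>x. l1 x + l2 x) Y = image_mset (\<lambda>x. of_bool (up x = dn x)) Y"
    using sat by (intro image_mset_cong) simp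
  then have Yl: "(\<Sum>x\<in>#Y. l1 x + l2 x) = bal Y" using sum_of_bool[of "\<lambda>x. up x = dn x" Y] by simp
  have b: "bal X + 2 * neg X = bal Y + 2 * neg Y"
    using size_bal_neg[OF T(2) X] size_bal_neg[OF T(2) Y] sums by simp
  have ge: "\<forall>x\<in>#X. of_bool (up x = dn x) \<le> l1 x + l2 x"
  proof
    fix x assume "x \<in># X"
    then have t: "Suc (l1 x + up x + dn x + l2 x) = 2 * k + 2" using tot X T(1) by simp
    have "l1 x + l2 x \<noteq> 0" if "up x = dn x"
    proof
      assume "l1 x + l2 x = 0"
      then have "Suc (2 * up x) = 2 * (k + 1)" using t that by simp
      then show False by (metis even_Suc even_mult_iff even_numeral)
    qed
    then show "of_bool (up x = dn x) \<le> l1 x + l2 x" by (cases "up x = dn x") (simp_all add: Suc_le_eq)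
  qed
  have "(\<Sum>x\<in>#X. l1 x + l2 x) \<le> (\<Sum>x\<in>#X. of_bool (up x = dn x))"
    using loops Yl b neg sum_of_bool[of "\<lambda>x. up x = dn x" X] by simp
  then have satX: "\<forall>x\<in>#X. l1 x + l2 x = of_bool (up x = dn x)"
    using sum_mset_pointwise[OF ge] by blast
  have "image_mset (\<lambda>x. l1 x + l2 x) X = image_mset (\<lambda>x. of_bool (up x = dn x)) X"
    using satX by (intro image_mset_cong) simp
  then have "(\<Sum>x\<in>#X. l1 x + l2 x) = bal X" using sum_of_bool[of "\<lambda>x. up x = dn x" X] by simp
  then have eqs: "bal X = bal Y" "neg X = neg Y" using loops Yl b by simp_all
  have "image_mset sw X = image_mset sw Y"
    using saturated_switches[OF T, of X] saturated_switches[OF T, of Y] X Y sat satX eqs sums(1) by simp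
  moreover have nc: "\<forall>x\<in>#Z. length x = T \<and> up x + dn x \<ge> 1"
    if Z: "\<forall>x\<in>#Z. length x = T" "\<forall>x\<in>#Z. l1 x + l2 x = of_bool (up x = dn x)" for Z
  proof
    fix x assume x: "x \<in># Z"
    then have "Suc (l1 x + up x + dn x + l2 x) = T" "l1 x + l2 x \<le> 1" "length x = T" using tot Z by simp_all
    then show "length x = T \<and> up x + dn x \<ge> 1" using T(2) by linarith
  qed
  ultimately show ?thesis using eqv_same_switches[OF T(2) nc[OF X satX] nc[OF Y sat]] sums(4) by blast
qed

text \<open>Constant words have 0 or \<open>T - 1\<close> loops 22. The nonconstant closed words for
  T = 3 are 121 and 212, which have no loops.\<close>

lemma balanced_l2_dvd:
  assumes "length x = T" "3 \<le> T" "up x = dn x" "up x = 0 \<or> T = 3"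
  shows "(T - 1) dvd l2 x"
proof (cases "up x = 0")
  case True
  have "x \<noteq> []" using assms by auto
  with True have "l2 x = 0 \<or> l2 x = T - 1" using constant_loops[of x] assms(1,3) by simp blast
  then show ?thesis by auto
next
  case False
  then have "l2 x = 0" using length_eq_transitions[OF assms(1)] assms by linarith
  then show ?thesis by simp
qed

lemma dvd_sum_mset: "\<forall>x\<in>#M. k dvd f x \<Longrightarrow> k dvd (\<Sum>x\<in>#M. f x)" for k :: nat
  by (induction M) auto

text \<open>Loops 22 are counted modulo \<open>T - 1\<close>. On the side of \<open>Y\<close> the
  pair leaves \<open>T - 2\<close>. In \<open>X\<close> all words turn out to be closed; one
  nonconstant word holds at most \<open>T - 3\<close> loops 22, and the others contribute 0.\<close>

lemma opposite_pair_not_balanced: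
  assumes T: "3 \<le> T" and X: "\<forall>x\<in>#X. length x = T \<and> dn x \<le> up x"
    and Y: "Y = add_mset a (add_mset b R)" "sw a = (1, 0)" "sw b = (0, 1)" "l2 a + l2 b + 2 = T"
      "\<forall>x\<in>#R. length x = T \<and> up x = dn x \<and> (up x = 0 \<or> T = 3)"
    and sums: "(\<Sum>x\<in>#X. up x) = (\<Sum>x\<in>#Y. up x)" "(\<Sum>x\<in>#X. dn x) = (\<Sum>x\<in>#Y. dn x)"
      "(\<Sum>x\<in>#X. l2 x) = (\<Sum>x\<in>#Y. l2 x)"
  shows False
proof -
  have "image_mset up R = image_mset dn R" using Y(5) by (intro image_mset_cong) simp
  then have "(\<Sum>x\<in>#Y. up x) = (\<Sum>x\<in>#Y. dn x)" using Y by simp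
  then have "(\<Sum>x\<in>#X. up x) \<le> (\<Sum>x\<in>#X. dn x)" using sums by simp
  then have balX: "\<forall>x\<in>#X. up x = dn x" using sum_mset_pointwise[of X dn up] X by blast
  have pos: "(\<Sum>x\<in>#X. up x) \<ge> 1" using sums(1) Y by simp
  have "\<exists>x\<in>#X. up x \<ge> 1"
  proof (rule ccontr)
    assume "\<not> ?thesis"
    then have "\<forall>x\<in>#X. up x = 0" by (simp add: not_le)
    then have "(\<Sum>x\<in>#X. up x) = 0" by simp
    with pos show False by linarith
  qed
  then obtain x Q where x: "up x \<ge> 1" and Q: "X = add_mset x Q" by (metis multi_member_split)
  have lx: "length x = T" "up x = dn x" using X balX Q by simp_all
  have l2x: "l2 x + 3 \<le> T" using length_eq_transitions[OF lx(1)] lx(2) x T by linarith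
  have "(T - 1) dvd l2 z" if z: "z \<in># Q" for z
  proof (rule balanced_l2_dvd[OF _ T])
    show "length z = T" "up z = dn z" using X balX Q z by simp_all
    \<comment> \<open>For \<open>T > 3\<close> all words of \<open>R\<close> are constant, so there
      is only one switch 12 in total, and \<open>x\<close> uses it.\<close>
    show "up z = 0 \<or> T = 3"
    proof (rule ccontr)
      assume no: "\<not> ?thesis"
      then have "\<forall>x\<in>#R. up x = 0" using Y(5) by blast
      then have "(\<Sum>x\<in>#R. up x) = 0" by simp
      then have "(\<Sum>x\<in>#X. up x) = 1" using sums(1) Y by simp
      moreover obtain P where "Q = add_mset z P" using z by (metis multi_member_split)
      ultimately show False using no x Q by simp
    qed
  qed
  then have dQ: "(T - 1) dvd (\<Sum>z\<in>#Q. l2 z)" by (intro dvd_sum_mset) blast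
  have dR: "(T - 1) dvd (\<Sum>z\<in>#R. l2 z)" using Y(5) T by (intro dvd_sum_mset) (blast intro: balanced_l2_dvd)
  have eq: "l2 x + (\<Sum>z\<in>#Q. l2 z) = (T - 2) + (\<Sum>z\<in>#R. l2 z)" using sums(3) Y(1,4) Q by simp
  have "(l2 x) mod (T - 1) = (T - 2) mod (T - 1)"
  proof -
    obtain c where c: "(\<Sum>z\<in>#Q. l2 z) = (T - 1) * c" using dQ by (rule dvdE)
    obtain e where e: "(\<Sum>z\<in>#R. l2 z) = (T - 1) * e" using dR by (rule dvdE)
    have "(l2 x + (T - 1) * c) mod (T - 1) = ((T - 2) + (T - 1) * e) mod (T - 1)" using eq unfolding c e by (rule arg_cong)
    then show ?thesis by (simp only: mod_mult_self2)
  qed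
  then show False using l2x T by simp
qed

text \<open>The pair holds \<open>T - 2\<close> loops 22 on either side and nonconstant closed words
  hold none, so the totals determine the number of words 2...2, then the number of words 1...1. The
  nonconstant parts have equal switches.\<close>

lemma eqv_opposite_pairs:
  assumes T: "3 \<le> T"
    and X: "X = add_mset a (add_mset b R)" "length a = T" "length b = T" "sw a = (1, 0)" "sw b = (0, 1)" "l2 a + l2 b + 2 = T"
      "\<forall>x\<in>#R. length x = T \<and> up x = dn x \<and> (up x = 0 \<or> T = 3)"
    and Y: "Y = add_mset c (add_mset d Q)" "length c = T" "length d = T" "sw c = (1, 0)" "sw d = (0, 1)" "l2 c + l2 d + 2 = T"
      "\<forall>x\<in>#Q. length x = T \<and> up x = dn x \<and> (up x = 0 \<or> T = 3)"
    and sums: "size X = size Y" "(\<Sum>x\<in>#X. up x) = (\<Sum>x\<in>#Y. up x)" "(\<Sum>x\<in>#X. l2 x) = (\<Sum>x\<in>#Y. l2 x)"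
  shows "eqv T X Y"
proof -
  define F where "F = filter_mset (\<lambda>x. up x \<noteq> 0)"
  have F: "\<forall>x\<in>#F Z. length x = T \<and> up x = 1 \<and> dn x = 1 \<and> l2 x = 0"
    if Z: "\<forall>x\<in>#Z. length x = T \<and> up x = dn x \<and> (up x = 0 \<or> T = 3)" for Z
  proof
    fix x assume "x \<in># F Z"
    then have "x \<in># Z" "up x \<noteq> 0" unfolding F_def by simp_all
    then have x: "length x = T" "up x = dn x" "T = 3" "up x \<noteq> 0" using bspec[OF Z] by metis+
    then show "length x = T \<and> up x = 1 \<and> dn x = 1 \<and> l2 x = 0" using length_eq_transitions[OF x(1)] by linarith
  qed
  note FR = F[OF X(7)] and FQ = F[OF Y(7)]
  have Fs: "(\<Sum>x\<in>#W. up x) = size W \<and> (\<Sum>x\<in>#W. l2 x) = 0 \<and> image_mset sw W = replicate_mset (size W) (1, 1)"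
    if "\<forall>x\<in>#W. length x = T \<and> up x = 1 \<and> dn x = 1 \<and> l2 x = 0" for W
    using that by (induction W) auto
  have "\<forall>x\<in>#R. length x = T \<and> (up x = 0 \<longrightarrow> dn x = 0)" "\<forall>x\<in>#Q. length x = T \<and> (up x = 0 \<longrightarrow> dn x = 0)"
    using X(7) Y(7) by simp_all
  note const = this
  from split_constants[OF T const(1)] obtain p r where
    Rs: "R = F R + replicate_mset p (replicate T True) + replicate_mset r (replicate T False)"
    unfolding F_def by (elim exE)
  from split_constants[OF T const(2)] obtain q s where
    Qs: "Q = F Q + replicate_mset q (replicate T True) + replicate_mset s (replicate T False)"
    unfolding F_def by (elim exE)
  have sR: "size R = size (F R) + p + r" "(\<Sum>x\<in>#R. up x) = size (F R)" "(\<Sum>x\<in>#R. l2 x) = r * (T - 1)"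
    using Fs[OF FR] by (subst Rs, simp add: sum_replicate_mset tr_replicate)+
  have sQ: "size Q = size (F Q) + q + s" "(\<Sum>x\<in>#Q. up x) = size (F Q)" "(\<Sum>x\<in>#Q. l2 x) = s * (T - 1)"
    using Fs[OF FQ] by (subst Qs, simp add: sum_replicate_mset tr_replicate)+
  have e1: "size (F R) = size (F Q)" using sums(2) sR(2) sQ(2) X(1,4,5) Y(1,4,5) by simp
  have "l2 a + l2 b + r * (T - 1) = l2 c + l2 d + s * (T - 1)" using sums(3) sR(3) sQ(3) X(1) Y(1) by simp
  then have "r * (T - 1) = s * (T - 1)" using X(6) Y(6) by linarith
  then have e2: "r = s" using T by simp
  then have e3: "p = q" using sums(1) sR(1) sQ(1) X(1) Y(1) e1 by simp
  have "eqv T (add_mset a (add_mset b (F R))) (add_mset c (add_mset d (F Q)))"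
  proof (rule eqv_same_switches[OF T])
    show "\<forall>x\<in>#add_mset a (add_mset b (F R)). length x = T \<and> up x + dn x \<ge> 1" using X FR by simp
    show "\<forall>x\<in>#add_mset c (add_mset d (F Q)). length x = T \<and> up x + dn x \<ge> 1" using Y FQ by simp
    show "image_mset sw (add_mset a (add_mset b (F R))) = image_mset sw (add_mset c (add_mset d (F Q)))"
      using Fs[OF FR] Fs[OF FQ] X(4,5) Y(4,5) e1 by simp
    show "(\<Sum>x\<in>#add_mset a (add_mset b (F R)). l2 x) = (\<Sum>x\<in>#add_mset c (add_mset d (F Q)). l2 x)"
    proof -
      have "(\<Sum>x\<in>#F R. l2 x) = 0" "(\<Sum>x\<in>#F Q. l2 x) = 0" using Fs[OF FR] Fs[OF FQ] by blast+
      then show ?thesis using X(6) Y(6) unfolding image_mset_add_mset sum_mset.add_mset by linarith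
    qed
  qed
  from eqv_add[OF this, of "replicate_mset p (replicate T True) + replicate_mset r (replicate T False)"]
  show ?thesis unfolding X(1) Y(1) by (subst Rs, subst Qs) (simp add: e2 e3 add.assoc)
qed

lemma eqv_minimal:
  assumes T: "3 \<le> T" and minX: "\<And>M. eqv T X M \<Longrightarrow> neg X \<le> neg M" and minY: "\<And>M. eqv T Y M \<Longrightarrow> neg Y \<le> neg M"
    and X: "\<forall>x\<in>#X. length x = T" and Y: "\<forall>x\<in>#Y. length x = T"
    and sums: "size X = size Y" "(\<Sum>x\<in>#X. up x) = (\<Sum>x\<in>#Y. up x)" "(\<Sum>x\<in>#X. dn x) = (\<Sum>x\<in>#Y. dn x)"
      "(\<Sum>x\<in>#X. l2 x) = (\<Sum>x\<in>#Y. l2 x)"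
    and D: "(\<Sum>x\<in>#X. dn x) \<le> (\<Sum>x\<in>#X. up x)" and neg: "neg X \<le> neg Y"
  shows "eqv T X Y"
proof -
  have neg0: "\<forall>x\<in>#M. length x = T \<and> dn x \<le> up x" if "neg M = 0" "\<forall>x\<in>#M. length x = T" for M
  proof
    fix x assume x: "x \<in># M"
    have "filter_mset (\<lambda>w. up w < dn w) M = {#}" using that(1) by (simp only: size_eq_0_iff_empty)
    then have "x \<notin># filter_mset (\<lambda>w. up w < dn w) M" by (simp only: set_mset_empty empty_iff not_False_eq_True)
    then have "\<not> up x < dn x" using x by (simp only: set_mset_filter mem_Collect_eq) blast
    then show "length x = T \<and> dn x \<le> up x" using that(2) x by simp
  qed
  have DY: "(\<Sum>x\<in>#Y. dn x) \<le> (\<Sum>x\<in>#Y. up x)" using D sums by simp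
  define pairs where "pairs M \<longleftrightarrow> (\<exists>a b R. M = add_mset a (add_mset b R) \<and> sw a = (1, 0) \<and> sw b = (0, 1) \<and> l2 a + l2 b + 2 = T \<and>
      (\<forall>x\<in>#R. up x = dn x \<and> (up x = 0 \<or> T = 3)))" for M
  define sat where "sat M \<longleftrightarrow> (\<exists>k. T = 2 * k + 2 \<and> (\<forall>x\<in>#M. up x + dn x \<ge> 1 \<and>
      (if up x = dn x then l1 x + l2 x = 1 else l1 x + l2 x = 0)))" for M
  have satD: "\<exists>k. T = 2 * k + 2 \<and> (\<forall>x\<in>#M. l1 x + l2 x = of_bool (up x = dn x))" if "sat M" for M
  proof -
    from that obtain k where k: "T = 2 * k + 2"
      "\<forall>x\<in>#M. up x + dn x \<ge> 1 \<and> (if up x = dn x then l1 x + l2 x = 1 else l1 x + l2 x = 0)"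
      unfolding sat_def by blast
    have "l1 x + l2 x = of_bool (up x = dn x)" if "x \<in># M" for x
      using bspec[OF k(2) that] by (cases "up x = dn x") simp_all
    then show ?thesis using k(1) by blast
  qed
  show ?thesis
  proof (cases "neg Y = 0")
    case True
    then have "neg X = 0" using neg by linarith
    from eqv_no_down[OF T neg0[OF this X] neg0[OF True Y] sums] show ?thesis .
  next
    case False
    then have posY: "neg Y > 0" by linarith
    have formsY: "pairs Y \<or> sat Y" unfolding pairs_def sat_def by (rule minimal_forms[OF T minY Y DY posY])
    show ?thesis
    \<comment> \<open>The saturated case is settled first because it asks for no particular shape of
      \<open>X\<close>. Afterwards \<open>neg Y = 1\<close>, so that either \<open>neg X = 0\<close>
      or \<open>neg Y \<le> neg X\<close>, and in the latter case the argument for a saturated table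
      can be used with \<open>X\<close> and \<open>Y\<close> interchanged.\<close>
    proof (cases "sat Y")
      case True
      from satD[OF this] obtain k where k: "T = 2 * k + 2" "\<forall>x\<in>#Y. l1 x + l2 x = of_bool (up x = dn x)" by blast
      show ?thesis by (rule eqv_saturated[OF k(1) T X Y k(2) sums neg])
    next
      case False
      then have "pairs Y" using formsY by blast
      then obtain c d Q where Y': "Y = add_mset c (add_mset d Q)" "sw c = (1, 0)" "sw d = (0, 1)" "l2 c + l2 d + 2 = T"
        "\<forall>x\<in>#Q. up x = dn x \<and> (up x = 0 \<or> T = 3)" unfolding pairs_def by blast
      have "\<forall>x\<in>#Q. length x = T" using Y Y'(1) by simp
      then have lQ: "\<forall>x\<in>#Q. length x = T \<and> up x = dn x \<and> (up x = 0 \<or> T = 3)" using Y'(5) by blast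
      have lcd: "length c = T" "length d = T" using Y Y'(1) by simp_all
      have "filter_mset (\<lambda>w. up w < dn w) Q = filter_mset (\<lambda>w. False) Q"
        using Y'(5) by (intro filter_mset_cong) auto
      then have negY: "neg Y = 1" using Y'(1,2,3) by simp
      show ?thesis
      proof (cases "neg X = 0")
        case True
        from opposite_pair_not_balanced[OF T neg0[OF True X] Y'(1-4) lQ sums(2-4)] show ?thesis by blast
      next
        case False
        then have posX: "neg X > 0" and negX: "neg Y \<le> neg X" using negY by linarith+
        have formsX: "pairs X \<or> sat X" unfolding pairs_def sat_def by (rule minimal_forms[OF T minX X D posX])
        show ?thesis
        proof (cases "sat X")
          case True
          from satD[OF this] obtain k where k: "T = 2 * k + 2" "\<forall>x\<in>#X. l1 x + l2 x = of_bool (up x = dn x)" by blast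
          show ?thesis by (rule eqv_sym[OF eqv_saturated[OF k(1) T Y X k(2) sums[symmetric] negX]])
        next
          case False
          then have "pairs X" using formsX by blast
          then obtain a b R where X': "X = add_mset a (add_mset b R)" "sw a = (1, 0)" "sw b = (0, 1)" "l2 a + l2 b + 2 = T"
            "\<forall>x\<in>#R. up x = dn x \<and> (up x = 0 \<or> T = 3)" unfolding pairs_def by blast
          have "\<forall>x\<in>#R. length x = T" using X X'(1) by simp
          then have lR: "\<forall>x\<in>#R. length x = T \<and> up x = dn x \<and> (up x = 0 \<or> T = 3)" using X'(5) by blast
          have lab: "length a = T" "length b = T" using X X'(1) by simp_all
          show ?thesis
            by (rule eqv_opposite_pairs[OF T X'(1) lab X'(2-4) lR Y'(1) lcd Y'(2-4) lQ sums(1,2,4)])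
        qed
      qed
    qed
  qed
qed

lemma ex_minimal_neg: "\<exists>N. eqv T M N \<and> (\<forall>P. eqv T N P \<longrightarrow> neg N \<le> neg P)"
proof -
  obtain N where N: "eqv T M N" "\<And>P. eqv T M P \<Longrightarrow> neg N \<le> neg P"
    using ex_has_least_nat[of "\<lambda>N. eqv T M N" M neg] eqv_refl by metis
  then show ?thesis using eqv_trans by blast
qed

lemma eqv_fiber_up:
  fixes X Y :: "bool list multiset"
  assumes T: "3 \<le> T" and X: "\<forall>x\<in>#X. length x = T" and Y: "\<forall>x\<in>#Y. length x = T"
    and sums: "size X = size Y" "\<And>a b. (\<Sum>x\<in>#X. tr a b x) = (\<Sum>x\<in>#Y. tr a b x)"
    and D: "(\<Sum>x\<in>#X. dn x) \<le> (\<Sum>x\<in>#X. up x)"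
  shows "eqv T X Y"
proof -
  obtain X' where X': "eqv T X X'" "\<And>P. eqv T X' P \<Longrightarrow> neg X' \<le> neg P" using ex_minimal_neg by blast
  obtain Y' where Y': "eqv T Y Y'" "\<And>P. eqv T Y' P \<Longrightarrow> neg Y' \<le> neg P" using ex_minimal_neg by blast
  have len: "\<forall>x\<in>#X'. length x = T" "\<forall>x\<in>#Y'. length x = T"
    using eqv_length[OF X'(1)] eqv_length[OF Y'(1)] X Y by blast+
  have s: "size X' = size Y'" using eqv_size[OF X'(1)] eqv_size[OF Y'(1)] sums(1) by simp
  have t: "(\<Sum>x\<in>#X'. tr a b x) = (\<Sum>x\<in>#Y'. tr a b x)" for a b
    using eqv_tr[OF X'(1), of a b] eqv_tr[OF Y'(1), of a b] sums(2)[of a b] by simp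
  have D': "(\<Sum>x\<in>#X'. dn x) \<le> (\<Sum>x\<in>#X'. up x)" "(\<Sum>x\<in>#Y'. dn x) \<le> (\<Sum>x\<in>#Y'. up x)"
    using D eqv_tr[OF X'(1)] t by (metis order_refl)+
  have "eqv T X' Y'"
  proof (cases "neg X' \<le> neg Y'")
    case True
    show ?thesis by (rule eqv_minimal[OF T X'(2) Y'(2) len s t t t D'(1) True])
  next
    case False
    then have ge: "neg Y' \<le> neg X'" by linarith
    show ?thesis
      by (rule eqv_sym[OF eqv_minimal[OF T Y'(2) X'(2) len(2,1) s[symmetric] t[symmetric] t[symmetric] t[symmetric] D'(2) ge]])
  qed
  then show ?thesis using X'(1) Y'(1) eqv_trans eqv_sym by blast
qed

lemma eqv_fiber:
  fixes X Y :: "bool list multiset"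
  assumes T: "3 \<le> T" and X: "\<forall>x\<in>#X. length x = T" and Y: "\<forall>x\<in>#Y. length x = T"
    and sums: "size X = size Y" "\<And>a b. (\<Sum>x\<in>#X. tr a b x) = (\<Sum>x\<in>#Y. tr a b x)"
  shows "eqv T X Y"
proof (cases "(\<Sum>x\<in>#X. dn x) \<le> (\<Sum>x\<in>#X. up x)")
  case True
  show ?thesis by (rule eqv_fiber_up[OF T X Y sums True])
next
  case False
  let ?f = "image_mset (map Not)"
  have tr: "(\<Sum>x\<in>#?f M. tr a b x) = (\<Sum>x\<in>#M. tr (\<not> a) (\<not> b) x)" for M a b
    by (simp add: image_mset.compositionality comp_def tr_flip)
  have "eqv T (?f X) (?f Y)"
  proof (rule eqv_fiber_up[OF T])
    show "\<forall>x\<in>#?f X. length x = T" "\<forall>x\<in>#?f Y. length x = T" using X Y by simp_all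
    show "size (?f X) = size (?f Y)" using sums(1) by simp
    show "(\<Sum>x\<in>#?f X. tr a b x) = (\<Sum>x\<in>#?f Y. tr a b x)" for a b unfolding tr by (rule sums(2))
    show "(\<Sum>x\<in>#?f X. dn x) \<le> (\<Sum>x\<in>#?f X. up x)" unfolding tr using False by simp
  qed
  from eqv_flip[OF this] show ?thesis by (simp add: image_mset.compositionality comp_def)
qed

section \<open>From words to tables\<close>

lemma tr_eq_sum: "tr a b w = (\<Sum>k<length w - 1. of_bool (w ! k = a \<and> w ! Suc k = b))"
proof (induction a b w rule: tr.induct)
  case (1 a b x y w)
  let ?g = "\<lambda>k. of_bool ((x # y # w) ! k = a \<and> (x # y # w) ! Suc k = b) :: nat"
  have "(\<Sum>k<length (x # y # w) - 1. ?g k) = (\<Sum>k<Suc (length (y # w) - 1). ?g k)" by simp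
  also have "\<dots> = ?g 0 + (\<Sum>k<length (y # w) - 1. ?g (Suc k))" by (rule sum.lessThan_Suc_shift)
  also have "\<dots> = tr a b (x # y # w)" unfolding tr.simps 1 by (simp only: nth_Cons_0 nth_Cons_Suc)
  finally show ?case by (rule sym)
qed auto

lemma transitions_eq_tr: "transitions i j w = tr i j w"
proof -
  have "transitions i j w = card (Suc ` {k \<in> {..<length w - 1}. w ! k = i \<and> w ! Suc k = j})"
    unfolding transitions_def st_def
  proof (intro arg_cong[of _ _ card] set_eqI iffI)
    fix t assume t: "t \<in> {t \<in> {1..<length w}. w ! (t - 1) = i \<and> w ! (t + 1 - 1) = j}"
    then have "t = Suc (t - 1)" "t - 1 \<in> {k \<in> {..<length w - 1}. w ! k = i \<and> w ! Suc k = j}" by auto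
    then show "t \<in> Suc ` {k \<in> {..<length w - 1}. w ! k = i \<and> w ! Suc k = j}" by (rule image_eqI)
  qed auto
  also have "\<dots> = card {k \<in> {..<length w - 1}. w ! k = i \<and> w ! Suc k = j}"
    by (rule card_image) simp
  also have "\<dots> = tr i j w"
    unfolding tr_eq_sum by (subst sum_of_bool_eq) (auto intro!: arg_cong[of _ _ card])
  finally show ?thesis .
qed

lemma seg_middle:
  "a = Suc (length u) \<Longrightarrow> b = length u + length m \<Longrightarrow> seg (u @ m @ v) a b = m"
  by (simp add: seg_def)

lemma seg_join: "1 \<le> a \<Longrightarrow> a \<le> Suc b \<Longrightarrow> b \<le> c \<Longrightarrow> seg w a b @ seg w (Suc b) c = seg w a c"
proof -
  assume *: "1 \<le> a" "a \<le> Suc b" "b \<le> c"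
  have "take (c + 1 - a) (drop (a - 1) w) =
      take (Suc b - a) (drop (a - 1) w) @ take (c - b) (drop (Suc b - a) (drop (a - 1) w))"
    using * take_add[of "Suc b - a" "c - b" "drop (a - 1) w"] by simp
  then show ?thesis using * by (simp add: seg_def)
qed

lemma seg_all: "T = length w \<Longrightarrow> seg w 1 T = w"
  by (simp add: seg_def)

lemma seg_one: "1 \<le> a \<Longrightarrow> a \<le> length w \<Longrightarrow> seg w a a = [st w a]"
  by (simp add: seg_def st_def take_Suc_conv_app_nth Cons_nth_drop_Suc[symmetric])

lemma seg_Cons: "1 \<le> a \<Longrightarrow> a \<le> c \<Longrightarrow> a \<le> length w \<Longrightarrow> seg w a c = st w a # seg w (Suc a) c"
  using seg_join[of a a c w] seg_one[of a w] by simp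

lemma seg_snoc: "1 \<le> a \<Longrightarrow> a \<le> Suc c \<Longrightarrow> Suc c \<le> length w \<Longrightarrow> seg w a (Suc c) = seg w a c @ [st w (Suc c)]"
  using seg_join[of a c "Suc c" w] seg_one[of "Suc c" w] by simp

lemma length_seg: "1 \<le> a \<Longrightarrow> b \<le> length w \<Longrightarrow> length (seg w a b) = Suc b - a"
  by (simp add: seg_def)

lemma set_seg: "set (seg w a b) \<subseteq> set w"
  unfolding seg_def by (meson order_trans set_drop_subset set_take_subset)

section \<open>Tables of path multisets, and the listed arrays as moves\<close>

lemma table_of_add: "table_of (add_mset w M) = (\<lambda>\<eta>. unit_table w \<eta> + table_of M \<eta>)"
  by (simp add: table_of_def)

lemma table_of_union: "table_of (M + N) = (\<lambda>\<eta>. table_of M \<eta> + table_of N \<eta>)"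
  by (simp add: table_of_def)

lemma table_of_count: "table_of M w = int (count M w)"
  by (induction M) (auto simp: table_of_def unit_table_def)

lemma A_mult_diff: "A_mult T (\<lambda>\<eta>. x \<eta> - y \<eta>) i j = A_mult T x i j - A_mult T y i j"
  by (simp add: A_mult_def right_diff_distrib sum_subtractf)

lemma A_mult_table_of:
  "set_mset M \<subseteq> paths T \<Longrightarrow> A_mult T (table_of M) i j = int (\<Sum>w\<in>#M. tr i j w)"
proof (induction M)
  case empty
  show ?case by (simp add: A_mult_def table_of_def)
next
  case (add w M)
  have "A_mult T (table_of (add_mset w M)) i j =
      (\<Sum>\<eta>\<in>paths T. int (tr i j \<eta>) * unit_table w \<eta>) + A_mult T (table_of M) i j"
    by (simp add: A_mult_def table_of_add distrib_left sum.distrib transitions_eq_tr)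
  also have "(\<Sum>\<eta>\<in>paths T. int (tr i j \<eta>) * unit_table w \<eta>) = int (tr i j w)"
    using add.prems finite_paths[of T] by (simp add: unit_table_def if_distrib sum.delta cong: if_cong)
  finally show ?case using add by simp
qed

lemma swapping_moves:
  assumes "set_mset M \<subseteq> paths T" "set_mset N \<subseteq> paths T"
    "\<And>i j. (\<Sum>w\<in>#M. tr i j w) = (\<Sum>w\<in>#N. tr i j w)"
  shows "swapping M N \<subseteq> moves T"
proof -
  have "(\<lambda>\<eta>. table_of A \<eta> - table_of B \<eta>) \<in> moves T"
    if "set_mset A \<subseteq> paths T" "set_mset B \<subseteq> paths T" "\<And>i j. (\<Sum>w\<in>#A. tr i j w) = (\<Sum>w\<in>#B. tr i j w)" for A B
  proof -
    have "table_of A \<eta> - table_of B \<eta> = 0" if "\<eta> \<notin> paths T" for \<eta>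
      using that \<open>set_mset A \<subseteq> paths T\<close> \<open>set_mset B \<subseteq> paths T\<close>
      unfolding table_of_count by (metis diff_self in_mono not_in_iff)
    then show ?thesis unfolding moves_def integer_arrays_def
      using that by (simp add: A_mult_diff A_mult_table_of)
  qed
  from this[OF assms] this[OF assms(2,1) assms(3)[symmetric]] show ?thesis unfolding swapping_def by blast
qed

lemma swapping_commute: "swapping M N = swapping N M"
  unfolding swapping_def by blast

text \<open>Here \<open>eqv\<close> is used on words over the labels 1 and 2 themselves: a listed
  swapping that is an instance of a generator inherits the invariance of the counts from
  \<open>eqv_tr\<close>.\<close>

lemma eqv_swapping_moves:
  assumes "eqv T M N" "set_mset M \<subseteq> paths T" "\<forall>w\<in>#N. set w \<subseteq> {1, 2}"
  shows "swapping M N \<subseteq> moves T"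
proof (rule swapping_moves[OF assms(2) _ eqv_tr[OF assms(1)]])
  have "\<forall>w\<in>#M. length w = T" using assms(2) unfolding paths_def by blast
  then have "\<forall>w\<in>#N. length w = T" using eqv_length[OF assms(1)] by blast
  then show "set_mset N \<subseteq> paths T" using assms(3) unfolding paths_def by blast
qed

lemma flip_states_path: "w \<in> paths T \<Longrightarrow> flip_states w \<in> paths T"
  by (auto simp: paths_def flip_states_def)

lemma rev_path: "w \<in> paths T \<Longrightarrow> rev w \<in> paths T"
  by (simp add: paths_def)

lemma seg_path: "w \<in> paths T \<Longrightarrow> set (seg w a b) \<subseteq> {1, 2}"
  using set_seg[of w a b] by (auto simp: paths_def)

lemma type1_moves_subset: "type1_moves T \<subseteq> moves T"
proof -
  have "swapping {#w#} {#seg w 1 (t0 - 1) @ seg w t1 (t2 - 1) @ seg w t0 t1 @ seg w (t2 + 1) T#} \<subseteq> moves T"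
    if w: "w \<in> paths T" and t: "1 \<le> t0" "t0 < t1" "t1 < t2" "t2 \<le> T" and i: "st w t0 = i" "st w t1 = i" "st w t2 = i"
    for w t0 t1 t2 i
  proof -
    have len: "length w = T" using w by (simp add: paths_def)
    let ?u = "seg w 1 (t0 - 1)" and ?x = "seg w (Suc t0) (t1 - 1)" and ?y = "seg w (Suc t1) (t2 - 1)" and ?v = "seg w (Suc t2) T"
    have x: "seg w t0 (t1 - 1) = i # ?x" and y: "seg w t1 (t2 - 1) = i # ?y" and v: "seg w t2 T = i # ?v"
      using seg_Cons[of t0 "t1 - 1" w] seg_Cons[of t1 "t2 - 1" w] seg_Cons[of t2 T w] t i len by simp_all
    have x': "seg w t0 t1 = (i # ?x) @ [i]" using seg_snoc[of t0 "t1 - 1" w] t i len x by simp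
    have w': "w = ?u @ (i # ?x) @ (i # ?y) @ (i # ?v)"
      using seg_join[of 1 "t0 - 1" T w] seg_join[of t0 "t1 - 1" T w] seg_join[of t1 "t2 - 1" T w] t len seg_all[of T w]
      unfolding x[symmetric] y[symmetric] v[symmetric] by simp
    have new: "?u @ seg w t1 (t2 - 1) @ seg w t0 t1 @ seg w (t2 + 1) T = ?u @ (i # ?y) @ (i # ?x) @ (i # ?v)"
      unfolding x' y by simp
    have "eqv T {#w#} {#?u @ seg w t1 (t2 - 1) @ seg w t0 t1 @ seg w (t2 + 1) T#}"
      unfolding new by (subst (1) w') (rule eqv_loops, use len w' in simp)
    then show ?thesis
      using w seg_path[OF w] by (intro eqv_swapping_moves) simp_all
  qed
  then show ?thesis unfolding type1_moves_def by blast
qed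

lemma seg_at:
  assumes "length w = T" "1 \<le> t" "t \<le> T"
  shows "w = seg w 1 (t - 1) @ st w t # seg w (Suc t) T"
  using seg_join[of 1 "t - 1" T w] seg_Cons[of t T w] seg_all[of T w] assms by simp

lemma crossing_swappings_subset: "crossing_swappings T \<subseteq> moves T"
proof -
  have "swapping {#w, w'#} {#seg w 1 (t - 1) @ [i] @ seg w' (t + 1) T, seg w' 1 (t - 1) @ [i] @ seg w (t + 1) T#} \<subseteq> moves T"
    if w: "w \<in> paths T" "w' \<in> paths T" and t: "1 \<le> t" "t \<le> T" and i: "st w t = i" "st w' t = i" for w w' t i
  proof -
    have len: "length w = T" "length w' = T" using w by (simp_all add: paths_def)
    let ?u = "seg w 1 (t - 1)" and ?v = "seg w (Suc t) T" and ?u' = "seg w' 1 (t - 1)" and ?v' = "seg w' (Suc t) T"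
    have eq: "w = ?u @ i # ?v" "w' = ?u' @ i # ?v'"
      using seg_at[OF len(1) t] seg_at[OF len(2) t] unfolding i by simp_all
    have l: "length ?u' = length ?u" "length ?v' = length ?v" using len t by (simp_all add: length_seg)
    have "length (?u @ i # ?v) = T" using eq(1) len(1) by simp
    from eqv_cross[OF this l] have "eqv T {#w, w'#} {#?u @ [i] @ ?v', ?u' @ [i] @ ?v#}"
      unfolding eq[symmetric] by simp
    moreover have "i \<in> set w" by (subst eq(1)) simp
    then have "i \<in> {1, 2}" using w(1) unfolding paths_def by blast
    ultimately show ?thesis
      using w seg_path[OF w(1)] seg_path[OF w(2)] by (intro eqv_swapping_moves) simp_all
  qed
  then show ?thesis unfolding crossing_swappings_def by blast
qed

text \<open>The generators contain the 2 by 2 swap at adjacent times only, so for arbitrary times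
  the counts are compared directly. Both words enter only at the junctions after times
  \<open>a\<close> and \<open>b\<close>.\<close>

lemma tr_exchange:
  assumes "length w = T" "length w' = T" "1 \<le> a" "a < b" "b < T"
  shows "tr i j (exchange a b w w') = tr i j (seg w 1 a) + of_bool (st w a = i \<and> st w' (Suc a) = j) +
    tr i j (seg w' (Suc a) b) + of_bool (st w' b = i \<and> st w (Suc b) = j) + tr i j (seg w (Suc b) T)"
proof -
  have A: "seg w 1 a \<noteq> []" "last (seg w 1 a) = st w a"
    using seg_snoc[of 1 "a - 1" w] assms by simp_all
  have B: "seg w' (Suc a) b \<noteq> []" "hd (seg w' (Suc a) b) = st w' (Suc a)"
    using seg_Cons[of "Suc a" b w'] assms by simp_all
  have B': "last (seg w' (Suc a) b) = st w' b" using seg_snoc[of "Suc a" "b - 1" w'] assms by simp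
  have C: "seg w (Suc b) T \<noteq> []" "hd (seg w (Suc b) T) = st w (Suc b)"
    using seg_Cons[of "Suc b" T w] assms by simp_all
  have "exchange a b w w' = seg w 1 a @ seg w' (Suc a) b @ seg w (Suc b) T"
    unfolding exchange_def using assms by simp
  then show ?thesis using A B B' C by (simp add: tr_append)
qed

lemma exchange_self: "length w = T \<Longrightarrow> a \<le> b \<Longrightarrow> b \<le> T \<Longrightarrow> exchange a b w w = w"
  using seg_join[of "Suc a" b T w] seg_join[of 1 a T w] seg_all[of T w] unfolding exchange_def by simp

lemma exchange_path: "w \<in> paths T \<Longrightarrow> w' \<in> paths T \<Longrightarrow> a \<le> b \<Longrightarrow> b \<le> T \<Longrightarrow> exchange a b w w' \<in> paths T"
  using seg_path[of w T] seg_path[of w' T] unfolding exchange_def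
  by (auto simp: paths_def length_seg)

lemma two_by_two_swaps_subset: "two_by_two_swaps T \<subseteq> moves T"
proof -
  have "swapping {#w, w'#} {#exchange (min t0 t1) (max t0 t1) w w', exchange (min t0 t1) (max t0 t1) w' w#} \<subseteq> moves T"
    if w: "w \<in> paths T" "w' \<in> paths T" and t: "t0 \<in> {1..T - 1}" "t1 \<in> {1..T - 1}" "t0 \<noteq> t1"
      and s: "(st w t0, st w (t0 + 1)) = (1, 1)" "(st w' t0, st w' (t0 + 1)) = (2, 2)"
      and s': "(st w t1, st w (t1 + 1)) = (1, 2) \<and> (st w' t1, st w' (t1 + 1)) = (2, 1) \<or>
           (st w t1, st w (t1 + 1)) = (2, 1) \<and> (st w' t1, st w' (t1 + 1)) = (1, 2)" for w w' t0 t1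
  proof -
    define a b where "a = min t0 t1" and "b = max t0 t1"
    have ab: "1 \<le> a" "a < b" "b < T" "a \<le> b" "b \<le> T" using t unfolding a_def b_def by auto
    have len: "length w = T" "length w' = T" using w by (simp_all add: paths_def)
    note e = tr_exchange[OF len ab(1-3)] tr_exchange[OF len(2,1) ab(1-3)]
      tr_exchange[OF len(1,1) ab(1-3), unfolded exchange_self[OF len(1) ab(4,5)]]
      tr_exchange[OF len(2,2) ab(1-3), unfolded exchange_self[OF len(2) ab(4,5)]]
    have "a = t0 \<and> b = t1 \<or> a = t1 \<and> b = t0" unfolding a_def b_def by (simp add: min_def max_def)
    \<comment> \<open>At one junction 11 and 22 turn into 12 and 21, at the other 12 and 21 turn
      into 11 and 22, so the four transitions are merely permuted.\<close>
    then have vals: "of_bool (st w a = i \<and> st w' (Suc a) = j) + of_bool (st w' a = i \<and> st w (Suc a) = j) +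
        (of_bool (st w' b = i \<and> st w (Suc b) = j) + of_bool (st w b = i \<and> st w' (Suc b) = j)) =
        of_bool (st w a = i \<and> st w (Suc a) = j) + of_bool (st w' a = i \<and> st w' (Suc a) = j) +
        (of_bool (st w b = i \<and> st w (Suc b) = j) + (of_bool (st w' b = i \<and> st w' (Suc b) = j) :: nat))" for i j
      using s s' by (elim disjE conjE) simp_all
    have "swapping {#w, w'#} {#exchange a b w w', exchange a b w' w#} \<subseteq> moves T"
    proof (rule swapping_moves)
      show "set_mset {#w, w'#} \<subseteq> paths T" "set_mset {#exchange a b w w', exchange a b w' w#} \<subseteq> paths T"
        using w exchange_path[of _ T _ a b] ab by simp_all
      show "(\<Sum>w\<in>#{#w, w'#}. tr i j w) = (\<Sum>w\<in>#{#exchange a b w w', exchange a b w' w#}. tr i j w)" for i j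
        using e[of i j] vals[of i j] by simp
    qed
    then show ?thesis unfolding a_def b_def .
  qed
  then show ?thesis unfolding two_by_two_swaps_def by blast
qed

lemma overwrite3_path: "w \<in> paths T \<Longrightarrow> set s \<subseteq> {1, 2} \<Longrightarrow> length s = 3 \<Longrightarrow> 1 \<le> t \<Longrightarrow> t + 2 \<le> T \<Longrightarrow> overwrite3 t s w \<in> paths T"
  using seg_path[of w T] unfolding overwrite3_def by (auto simp: paths_def length_seg)

lemma type4_moves_subset: "type4_moves T \<subseteq> moves T"
proof (cases "4 \<le> T")
  case True
  have "swapping A B \<subseteq> moves T \<and> swapping (image_mset flip_states A) (image_mset flip_states B) \<subseteq> moves T"
    if AB: "(A, B) \<in> type4_pairs T" for A B
  proof -
    from AB obtain w w' t0 t1 where AB': "A = {#overwrite3 t0 [1, 1, 2] w, overwrite3 t1 [1, 2, 2] w'#}"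
      "B = {#overwrite3 t0 [1, 2, 2] w, overwrite3 t1 [1, 1, 2] w'#}"
      and w: "w \<in> paths T" "w' \<in> paths T" and t: "t0 \<in> {1..T - 2}" "t1 \<in> {1..T - 2}"
      unfolding type4_pairs_def by blast
    have t': "1 \<le> t0" "t0 + 2 \<le> T" "1 \<le> t1" "t1 + 2 \<le> T" using t True by auto
    have p: "set_mset A \<subseteq> paths T" "set_mset B \<subseteq> paths T"
      using overwrite3_path[OF w(1) _ _ t'(1,2)] overwrite3_path[OF w(2) _ _ t'(3,4)] unfolding AB' by simp_all
    have tr3: "tr i j (overwrite3 t [1, 2, 2] x) + of_bool (1 = i \<and> 1 = j) = tr i j (overwrite3 t [1, 1, 2] x) + of_bool (2 = i \<and> 2 = j)"
      for i j t x unfolding overwrite3_def by (rule tr_first_second) simp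
    have s: "(\<Sum>w\<in>#A. tr i j w) = (\<Sum>w\<in>#B. tr i j w)" for i j
      using tr3[of i j t0 w] tr3[of i j t1 w'] unfolding AB' by simp
    have fp: "set_mset (image_mset flip_states A) \<subseteq> paths T" "set_mset (image_mset flip_states B) \<subseteq> paths T"
      using p flip_states_path by (auto simp: subset_iff)
    have tf: "tr i j (map f x @ [f 1, f 2, f 2] @ map f y) + of_bool (f 1 = i \<and> f 1 = j) =
        tr i j (map f x @ [f 1, f 1, f 2] @ map f y) + of_bool (f 2 = i \<and> f 2 = j)" if "f 1 \<noteq> f 2"
      for f :: "nat \<Rightarrow> nat" and i j x y using that by (rule tr_first_second)
    have tr3f: "tr i j (flip_states (overwrite3 t [1, 2, 2] x)) + of_bool (2 = i \<and> 2 = j) =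
        tr i j (flip_states (overwrite3 t [1, 1, 2] x)) + of_bool (1 = i \<and> 1 = j)" for i j t x
      using tf[of "\<lambda>i. if i = 1 then 2 else 1"] unfolding overwrite3_def flip_states_def by simp
    have sf: "(\<Sum>w\<in>#image_mset flip_states A. tr i j w) = (\<Sum>w\<in>#image_mset flip_states B. tr i j w)" for i j
      using tr3f[of i j t0 w] tr3f[of i j t1 w'] unfolding AB' by simp
    from swapping_moves[OF p s] swapping_moves[OF fp sf] show ?thesis by blast
  qed
  then show ?thesis unfolding type4_moves_def using True by auto
qed (simp add: type4_moves_def)

lemma type2_moves_subset: "type2_moves T \<subseteq> moves T"
proof -
  have "swapping {#w#} {#seg w t (T - 1) @ seg w 1 t#} \<subseteq> moves T"
    if w: "w \<in> paths T" and i: "st w 1 = i" "st w T = i" and t: "1 < t" "t < T" and j: "st w t = j" "j \<noteq> i" for w t i j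
  proof -
    have len: "length w = T" using w by (simp add: paths_def)
    let ?x = "seg w 2 (t - 1)" and ?y = "seg w (Suc t) (T - 1)"
    have x: "seg w 1 (t - 1) = i # ?x" and y: "seg w t (T - 1) = j # ?y" and z: "seg w T T = [i]"
      using seg_Cons[of 1 "t - 1" w] seg_Cons[of t "T - 1" w] seg_one[of T w] t i j len by (simp_all add: numeral_2_eq_2)
    have x': "seg w 1 t = (i # ?x) @ [j]" using seg_snoc[of 1 "t - 1" w] t j len x by simp
    have w': "w = (i # ?x) @ (j # ?y) @ [i]"
      using seg_join[of 1 "t - 1" T w] seg_join[of t "T - 1" T w] t len seg_all[of T w]
      unfolding x[symmetric] y[symmetric] z[symmetric] by simp
    have new: "seg w t (T - 1) @ seg w 1 t = (j # ?y) @ (i # ?x) @ [j]" unfolding x' y by simp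
    have "length ((i # ?x) @ (j # ?y) @ [i]) = T" using len w' by simp
    from eqv_rotate[OF this j(2)[symmetric]] have "eqv T {#w#} {#seg w t (T - 1) @ seg w 1 t#}"
      unfolding new w'[symmetric] .
    then show ?thesis using w seg_path[OF w] by (intro eqv_swapping_moves) simp_all
  qed
  then show ?thesis unfolding type2_moves_def by blast
qed

lemma single_step_path: "a \<le> T \<Longrightarrow> single_step T a \<in> paths T"
  by (auto simp: single_step_def paths_def)

lemma sliding_moves_subset: "sliding_moves T \<subseteq> moves T"
proof -
  have "swapping A B \<subseteq> moves T \<and> swapping (image_mset rev A) (image_mset rev B) \<subseteq> moves T"
    if AB: "(A, B) \<in> sliding_pairs T" for A B
  proof -
    from AB obtain a b u a' b' where AB': "A = {#replicate T 1, single_step T a, single_step T b#}"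
      "B = {#replicate T 2, single_step T a', single_step T b'#}"
      and ab: "1 \<le> a" "a \<le> b" "b \<le> T - 1" "a + b \<le> T - 1" "b \<le> u" "u \<le> T - 1 - a" "a' = a + u" "b' = b + T - 1 - u"
      unfolding sliding_pairs_def by blast
    have e: "eqv T A B" unfolding AB' single_step_def using ab by (intro eqv_slide) simp_all
    have p: "set_mset A \<subseteq> paths T" "set_mset B \<subseteq> paths T"
      using single_step_path[of _ T] ab unfolding AB' by (auto simp: paths_def)
    have rp: "set_mset (image_mset rev A) \<subseteq> paths T" "set_mset (image_mset rev B) \<subseteq> paths T"
      using p rev_path by (auto simp: subset_iff)
    have "(\<Sum>w\<in>#image_mset rev M. tr i j w) = (\<Sum>w\<in>#M. tr j i w)" for M :: "path multiset" and i j
      by (simp add: image_mset.compositionality comp_def tr_rev)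
    then have "(\<Sum>w\<in>#image_mset rev A. tr i j w) = (\<Sum>w\<in>#image_mset rev B. tr i j w)" for i j
      using eqv_tr[OF e] by simp
    from swapping_moves[OF rp this] swapping_moves[OF p eqv_tr[OF e]] show ?thesis by blast
  qed
  then show ?thesis unfolding sliding_moves_def by auto
qed

lemma thmc_moves_subset: "thmc_moves T \<subseteq> moves T"
  unfolding thmc_moves_def
  using type1_moves_subset crossing_swappings_subset two_by_two_swaps_subset type4_moves_subset
    type2_moves_subset sliding_moves_subset by blast

section \<open>Realizing the generators by listed moves\<close>

definition enc :: "bool list \<Rightarrow> path" where
  "enc = map (\<lambda>b. if b then 1 else 2)"

lemma enc_simps [simp]:
  "enc [] = []" "enc (b # w) = (if b then 1 else 2) # enc w" "enc (u @ w) = enc u @ enc w"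
  "length (enc w) = length w" "enc (replicate n b) = replicate n (if b then 1 else 2)" "enc (rev w) = rev (enc w)"
  by (simp_all add: enc_def rev_map)

lemma enc_path: "length w = T \<Longrightarrow> enc w \<in> paths T"
  by (auto simp: enc_def paths_def)

lemma enc_letters [simp]: "set (enc w) \<subseteq> {Suc 0, 2}"
  by (auto simp: enc_def)

lemma flip_enc: "flip_states (enc w) = enc (map Not w)"
  by (simp add: enc_def flip_states_def)

lemma path_enc: "w \<in> paths T \<Longrightarrow> enc (map (\<lambda>s. s = 1) w) = w"
proof -
  assume "w \<in> paths T"
  then have "set w \<subseteq> {1, 2}" by (simp add: paths_def)
  then show ?thesis unfolding enc_def by (induction w) auto
qed

lemma tr_enc: "tr (if a then 1 else 2) (if b then 1 else 2) (enc w) = tr a b w"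
  unfolding enc_def by (rule tr_map_inj) (auto simp: inj_def)

lemma st_middle: "t = Suc (length u) \<Longrightarrow> st (u @ x # v) t = x"
  by (simp add: st_def)

text \<open>The exchange takes place inside a context \<open>K\<close>, so that both ends are
  genuine multisets of paths; nonnegativity along a chain is thereby built in.\<close>

definition step :: "nat \<Rightarrow> path multiset \<Rightarrow> path multiset \<Rightarrow> bool" where
  "step T M N \<longleftrightarrow> (\<exists>A B K. M = A + K \<and> N = B + K \<and> swapping A B \<subseteq> thmc_moves T)"

lemma step_sym: "step T M N \<Longrightarrow> step T N M"
  unfolding step_def using swapping_commute by metis

lemma step_add: "step T M N \<Longrightarrow> step T (M + L) (N + L)"
  unfolding step_def by (metis add.assoc)

lemma steps_sym: "(step T)\<^sup>*\<^sup>* M N \<Longrightarrow> (step T)\<^sup>*\<^sup>* N M"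
  by (induction rule: rtranclp_induct) (auto intro: step_sym converse_rtranclp_into_rtranclp)

lemma steps_add: "(step T)\<^sup>*\<^sup>* M N \<Longrightarrow> (step T)\<^sup>*\<^sup>* (M + L) (N + L)"
  by (induction rule: rtranclp_induct) (auto intro: step_add rtranclp.rtrancl_into_rtrancl)

lemma steps_swapping: "swapping A B \<subseteq> thmc_moves T \<Longrightarrow> (step T)\<^sup>*\<^sup>* A B"
  unfolding step_def by (intro r_into_rtranclp exI[of _ A] exI[of _ B] exI[of _ "{#}"]) auto

lemma loops_step:
  assumes "length (u @ (i # x) @ (i # y) @ (i # v)) = T" "set (u @ x @ y @ v) \<subseteq> {1, 2}" "i \<in> {1, 2}"
  shows "(step T)\<^sup>*\<^sup>* {#u @ (i # x) @ (i # y) @ (i # v)#} {#u @ (i # y) @ (i # x) @ (i # v)#}"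
\<comment> \<open>Type I moves require a state other than \<open>i\<close> between the outer times.
  If there is none, both cycles consist of \<open>i\<close> alone and the two words
  coincide.\<close>
proof (cases "\<forall>c\<in>set (x @ y). c = i")
  case True
  then have r: "i # x = replicate (Suc (length x)) i" "i # y = replicate (Suc (length y)) i"
    by (auto intro!: replicate_eqI)
  have "(i # x) @ (i # y) = (i # y) @ (i # x)"
    unfolding r replicate_add[symmetric] by (simp only: add.commute)
  then have "u @ (i # x) @ (i # y) @ (i # v) = u @ (i # y) @ (i # x) @ (i # v)"
    by (metis append_assoc)
  then show ?thesis by (simp only: rtranclp.rtrancl_refl)
next
  case False
  then obtain c where c: "c \<in> set (x @ i # y)" "c \<noteq> i" by auto
  then obtain p q where pq: "x @ i # y = p @ c # q" by (meson split_list)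
  define w where "w = u @ (i # x) @ (i # y) @ (i # v)"
  define t0 t1 t2 where "t0 = Suc (length u)" and "t1 = t0 + Suc (length x)" and "t2 = t1 + Suc (length y)"
  have len: "length w = T" and path: "w \<in> paths T" using assms unfolding w_def paths_def by auto
  \<comment> \<open>Four bracketings of the same word, one for each segment that is read off
    below.\<close>
  have w: "w = (u @ i # x) @ (i # y) @ (i # v)" "w = u @ ((i # x) @ [i]) @ (y @ i # v)"
    "w = [] @ u @ (i # x @ i # y @ i # v)" "w = (u @ i # x @ i # y @ [i]) @ v @ []"
    unfolding w_def by simp_all
  have w': "w = (u @ i # p) @ c # (q @ i # v)" using arg_cong[OF pq, of "\<lambda>m. u @ i # m @ i # v"] unfolding w_def by simp
  have T: "T = length u + length x + length y + length v + 3" using len unfolding w_def by simp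
  have s1: "seg w 1 (t0 - 1) = u" by (subst w(3), rule seg_middle) (simp_all add: t0_def)
  have s2: "seg w t1 (t2 - 1) = i # y" by (subst w(1), rule seg_middle) (simp_all add: t0_def t1_def t2_def)
  have s3: "seg w t0 t1 = (i # x) @ [i]" by (subst w(2), rule seg_middle) (simp_all add: t0_def t1_def)
  have s4: "seg w (t2 + 1) T = v" by (subst w(4), rule seg_middle) (simp_all add: t0_def t1_def t2_def T)
  have st: "st w t0 = i" "st w t1 = i" "st w t2 = i" "st w (Suc (length (u @ i # p))) = c"
    using st_middle[of t0 u i "x @ i # y @ i # v"] st_middle[of t1 "u @ i # x" i "y @ i # v"]
      st_middle[of t2 "u @ i # x @ i # y" i v] st_middle[OF HOL.refl, of "u @ i # p" c "q @ i # v"]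
    unfolding w'[symmetric] unfolding w_def t0_def t1_def t2_def by simp_all
  have "length p < length x + Suc (length y)" using arg_cong[OF pq, of length] by simp
  then have "t0 < Suc (length (u @ i # p)) \<and> Suc (length (u @ i # p)) < t2" unfolding t0_def t1_def t2_def by simp
  then have ex: "\<exists>t. t0 < t \<and> t < t2 \<and> st w t \<noteq> i" using st(4) c(2) by blast
  have t: "1 \<le> t0" "t0 < t1" "t1 < t2" "t2 \<le> T" using len unfolding w_def t0_def t1_def t2_def by simp_all
  have "swapping {#w#} {#seg w 1 (t0 - 1) @ seg w t1 (t2 - 1) @ seg w t0 t1 @ seg w (t2 + 1) T#} \<subseteq> type1_moves T"
    unfolding type1_moves_def using path t st(1-3) ex by blast
  then have "swapping {#w#} {#u @ (i # y) @ (i # x) @ (i # v)#} \<subseteq> thmc_moves T"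
    unfolding s1 s2 s3 s4 thmc_moves_def by auto
  then show ?thesis unfolding w_def by (rule steps_swapping)
qed

lemma rotate_step:
  assumes "length ((i # x) @ (j # y) @ [i]) = T" "set (x @ y) \<subseteq> {1, 2}" "i \<in> {1, 2}" "j \<in> {1, 2}" "i \<noteq> j"
  shows "(step T)\<^sup>*\<^sup>* {#(i # x) @ (j # y) @ [i]#} {#(j # y) @ (i # x) @ [j]#}"
proof -
  define w where "w = (i # x) @ (j # y) @ [i]"
  define t where "t = Suc (Suc (length x))"
  have len: "length w = T" and path: "w \<in> paths T" using assms unfolding w_def paths_def by auto
  have T: "T = length x + length y + 3" using len unfolding w_def by simp
  have s: "seg w t (T - 1) = j # y" "seg w 1 t = (i # x) @ [j]"
    using seg_middle[of t "i # x" "T - 1" "j # y" "[i]"] seg_middle[of 1 "[]" t "(i # x) @ [j]" "y @ [i]"]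
    unfolding w_def t_def by (simp_all add: T)
  have st: "st w 1 = i" "st w T = i" "st w t = j"
    using st_middle[of 1 "[]" i "x @ j # y @ [i]"] st_middle[of T "i # x @ j # y" i "[]"] st_middle[of t "i # x" j "y @ [i]"]
    unfolding w_def t_def by (simp_all add: T)
  have t: "1 < t" "t < T" using len unfolding w_def t_def by simp_all
  have "swapping {#w#} {#seg w t (T - 1) @ seg w 1 t#} \<subseteq> type2_moves T"
    unfolding type2_moves_def
    by (rule Union_upper, rule CollectI, rule exI[of _ w], rule exI[of _ t], rule exI[of _ i], rule exI[of _ j])
      (use path st t assms(5) in simp)
  then have "swapping {#w#} {#(j # y) @ (i # x) @ [j]#} \<subseteq> thmc_moves T"
    unfolding s thmc_moves_def by auto
  then show ?thesis unfolding w_def by (rule steps_swapping)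
qed

lemma cross_step:
  assumes "length (u @ i # v) = T" "length u' = length u" "length v' = length v"
    "set (u @ v @ u' @ v') \<subseteq> {1, 2}" "i \<in> {1, 2}"
  shows "(step T)\<^sup>*\<^sup>* {#u @ i # v, u' @ i # v'#} {#u @ i # v', u' @ i # v#}"
proof -
  define w w' t where "w = u @ i # v" and "w' = u' @ i # v'" and "t = Suc (length u)"
  have len: "length w = T" "length w' = T" using assms unfolding w_def w'_def by simp_all
  have path: "w \<in> paths T" "w' \<in> paths T" using assms unfolding w_def w'_def paths_def by auto
  have T: "T = length u + length v + 1" using len unfolding w_def by simp
  have s: "seg w 1 (t - 1) = u" "seg w (t + 1) T = v" "seg w' 1 (t - 1) = u'" "seg w' (t + 1) T = v'"
    using seg_middle[of 1 "[]" "t - 1" u "i # v"] seg_middle[of "t + 1" "u @ [i]" T v "[]"]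
      seg_middle[of 1 "[]" "t - 1" u' "i # v'"] seg_middle[of "t + 1" "u' @ [i]" T v' "[]"] assms(2,3)
    unfolding w_def w'_def t_def by (simp_all add: T)
  have st: "st w t = i" "st w' t = i"
    using st_middle[of t u i v] st_middle[of t u' i v'] assms(2) unfolding w_def w'_def t_def by simp_all
  have t: "1 \<le> t" "t \<le> T" using len unfolding w_def t_def by simp_all
  have "swapping {#w, w'#} {#seg w 1 (t - 1) @ [i] @ seg w' (t + 1) T, seg w' 1 (t - 1) @ [i] @ seg w (t + 1) T#} \<subseteq> crossing_swappings T"
    unfolding crossing_swappings_def using path st t by blast
  then have "swapping {#w, w'#} {#u @ i # v', u' @ i # v#} \<subseteq> thmc_moves T"
    unfolding s thmc_moves_def by auto
  then show ?thesis unfolding w_def w'_def by (rule steps_swapping)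
qed

lemma seg_triple:
  "t = Suc (length x) \<Longrightarrow> seg (x @ [a, b, c] @ z) 1 t = x @ [a]"
  "t = Suc (length x) \<Longrightarrow> seg (x @ [a, b, c] @ z) (Suc t) (Suc t) = [b]"
  "t = Suc (length x) \<Longrightarrow> T = length x + length z + 3 \<Longrightarrow> seg (x @ [a, b, c] @ z) (Suc (Suc t)) T = c # z"
  "t = Suc (length x) \<Longrightarrow> st (x @ [a, b, c] @ z) t = a"
  "t = Suc (length x) \<Longrightarrow> st (x @ [a, b, c] @ z) (t + 1) = b"
  "t = Suc (length x) \<Longrightarrow> st (x @ [a, b, c] @ z) (Suc t + 1) = c"
  by (simp_all add: seg_def st_def nth_append)

text \<open>The 2 by 2 swap with \<open>t0 = t\<close> and \<open>t1 = t + 1\<close> exchanges the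
  two words at the single time \<open>t + 1\<close>.\<close>

lemma square_step_up:
  assumes "length (u @ [1, 1, 2] @ v) = T" "length u' = length u" "length v' = length v"
    "set (u @ v @ u' @ v') \<subseteq> {1, 2}"
  shows "(step T)\<^sup>*\<^sup>* {#u @ [1, 1, 2] @ v, u' @ [2, 2, 1] @ v'#} {#u @ [1, 2, 2] @ v, u' @ [2, 1, 1] @ v'#}"
proof -
  define w w' t where "w = u @ [1, 1, 2] @ v" and "w' = u' @ [2, 2, 1] @ v'" and "t = Suc (length u)"
  have len: "length w = T" "length w' = T" using assms unfolding w_def w'_def by simp_all
  have path: "w \<in> paths T" "w' \<in> paths T" using assms unfolding w_def w'_def paths_def by simp_all
  have T: "T = length u + length v + 3" using len unfolding w_def by simp
  have t': "t = Suc (length u)" "t = Suc (length u')" and T': "T = length u' + length v' + 3"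
    unfolding t_def T assms(2,3) by (rule HOL.refl)+
  note s = seg_triple[where x = u and a = "1 :: nat" and b = 1 and c = 2 and z = v, OF t'(1), folded w_def]
    seg_triple(3)[where x = u and a = "1 :: nat" and b = 1 and c = 2 and z = v, OF t'(1) T, folded w_def]
    seg_triple[where x = u' and a = "2 :: nat" and b = 2 and c = 1 and z = v', OF t'(2), folded w'_def]
    seg_triple(3)[where x = u' and a = "2 :: nat" and b = 2 and c = 1 and z = v', OF t'(2) T', folded w'_def]
  have t: "t \<in> {1..T - 1}" "Suc t \<in> {1..T - 1}" "t \<noteq> Suc t" unfolding t_def by (simp_all add: T)
  have e: "exchange (min t (Suc t)) (max t (Suc t)) w w' = u @ [1, 2, 2] @ v"
    "exchange (min t (Suc t)) (max t (Suc t)) w' w = u' @ [2, 1, 1] @ v'"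
    unfolding exchange_def len by (simp_all add: s[simplified])
  have "(st w t, st w (t + 1)) = (1, 1)" "(st w' t, st w' (t + 1)) = (2, 2)"
    "(st w (Suc t), st w (Suc t + 1)) = (1, 2) \<and> (st w' (Suc t), st w' (Suc t + 1)) = (2, 1) \<or>
     (st w (Suc t), st w (Suc t + 1)) = (2, 1) \<and> (st w' (Suc t), st w' (Suc t + 1)) = (1, 2)"
    by (simp_all add: s[simplified])
  then have "swapping {#w, w'#} {#exchange (min t (Suc t)) (max t (Suc t)) w w', exchange (min t (Suc t)) (max t (Suc t)) w' w#}
      \<subseteq> two_by_two_swaps T"
    unfolding two_by_two_swaps_def using path t
    by (intro Union_upper CollectI exI[of _ w] exI[of _ w'] exI[of _ t] exI[of _ "Suc t"] conjI HOL.refl) assumption+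
  then have "swapping {#w, w'#} {#u @ [1, 2, 2] @ v, u' @ [2, 1, 1] @ v'#} \<subseteq> thmc_moves T"
    unfolding e thmc_moves_def by blast
  then show ?thesis unfolding w_def w'_def by (rule steps_swapping)
qed

lemma type4_swapping:
  assumes "length (u @ [1, 1, 2] @ v) = T" "length (u' @ [1, 2, 2] @ v') = T" "4 \<le> T" "set (u @ v @ u' @ v') \<subseteq> {1, 2}"
  shows "({#u @ [1, 1, 2] @ v, u' @ [1, 2, 2] @ v'#}, {#u @ [1, 2, 2] @ v, u' @ [1, 1, 2] @ v'#}) \<in> type4_pairs T"
proof -
  define w w' t t' where "w = u @ [1, 1, 2] @ v" and "w' = u' @ [1, 2, 2] @ v'" and "t = Suc (length u)" and "t' = Suc (length u')"
  have len: "length w = T" "length w' = T" using assms unfolding w_def w'_def by simp_all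
  have path: "w \<in> paths T" "w' \<in> paths T" using assms unfolding w_def w'_def paths_def by auto
  have s: "seg w 1 (t - 1) = u" "seg w (t + 3) (length w) = v" "seg w' 1 (t' - 1) = u'" "seg w' (t' + 3) (length w') = v'"
    using seg_middle[of 1 "[]" "t - 1" u "[1, 1, 2] @ v"] seg_middle[of "t + 3" "u @ [1, 1, 2]" "length w" v "[]"]
      seg_middle[of 1 "[]" "t' - 1" u' "[1, 2, 2] @ v'"] seg_middle[of "t' + 3" "u' @ [1, 2, 2]" "length w'" v' "[]"]
    unfolding w_def w'_def t_def t'_def by simp_all
  have o: "overwrite3 t z w = u @ z @ v" "overwrite3 t' z w' = u' @ z @ v'" for z
    unfolding overwrite3_def s by simp_all
  have t: "t \<in> {1..T - 2}" "t' \<in> {1..T - 2}" using assms(1,2) unfolding t_def t'_def by auto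
  show ?thesis unfolding type4_pairs_def
    by (rule CollectI, rule exI[of _ w], rule exI[of _ w'], rule exI[of _ t], rule exI[of _ t'])
      (use path t in \<open>simp add: o\<close>)
qed

lemma exchange_step:
  assumes "length (u @ [i, i, j] @ v) = T" "length (u' @ [i, j, j] @ v') = T" "4 \<le> T" "i \<noteq> j"
  shows "(step T)\<^sup>*\<^sup>* (image_mset enc {#u @ [i, i, j] @ v, u' @ [i, j, j] @ v'#})
    (image_mset enc {#u @ [i, j, j] @ v, u' @ [i, i, j] @ v'#})"
proof (rule steps_swapping)
  have enc12: "set (enc x) \<subseteq> {1, 2}" for x by (auto simp: enc_def)
  show "swapping (image_mset enc {#u @ [i, i, j] @ v, u' @ [i, j, j] @ v'#})
      (image_mset enc {#u @ [i, j, j] @ v, u' @ [i, i, j] @ v'#}) \<subseteq> thmc_moves T"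
  proof (cases i)
    case True
    have "({#enc u @ [1, 1, 2] @ enc v, enc u' @ [1, 2, 2] @ enc v'#}, {#enc u @ [1, 2, 2] @ enc v, enc u' @ [1, 1, 2] @ enc v'#}) \<in> type4_pairs T"
      using assms(1-3) enc12 by (intro type4_swapping) simp_all
    then have "swapping {#enc u @ [1, 1, 2] @ enc v, enc u' @ [1, 2, 2] @ enc v'#} {#enc u @ [1, 2, 2] @ enc v, enc u' @ [1, 1, 2] @ enc v'#}
        \<subseteq> thmc_moves T" unfolding thmc_moves_def type4_moves_def using assms(3) by auto
    then show ?thesis using True assms(4) by simp
  next
    case False
    \<comment> \<open>The pairs of type (iv) have windows starting in state 1. The outer parts are
      negated beforehand, so that interchanging the labels of the whole pair restores them and only
      the windows are changed.\<close>
    let ?n = "\<lambda>x. enc (map Not x)"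
    have "({#?n u @ [1, 1, 2] @ ?n v, ?n u' @ [1, 2, 2] @ ?n v'#}, {#?n u @ [1, 2, 2] @ ?n v, ?n u' @ [1, 1, 2] @ ?n v'#}) \<in> type4_pairs T"
      using assms(1-3) enc12 by (intro type4_swapping) simp_all
    then have "swapping (image_mset flip_states {#?n u @ [1, 1, 2] @ ?n v, ?n u' @ [1, 2, 2] @ ?n v'#})
        (image_mset flip_states {#?n u @ [1, 2, 2] @ ?n v, ?n u' @ [1, 1, 2] @ ?n v'#})
        \<subseteq> thmc_moves T" unfolding thmc_moves_def type4_moves_def using assms(3) by auto
    moreover have "flip_states (?n x @ y @ ?n z) = enc x @ flip_states y @ enc z" for x y z
      using flip_enc[of "map Not x"] flip_enc[of "map Not z"] by (simp add: flip_states_def comp_def)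
    then have "flip_states (?n x @ [1, 1, 2] @ ?n z) = enc x @ [2, 2, 1] @ enc z"
      "flip_states (?n x @ [1, 2, 2] @ ?n z) = enc x @ [2, 1, 1] @ enc z" for x z
      by (simp_all only:) (simp_all add: flip_states_def)
    ultimately have "swapping {#enc u @ [2, 2, 1] @ enc v, enc u' @ [2, 1, 1] @ enc v'#}
        {#enc u @ [2, 1, 1] @ enc v, enc u' @ [2, 2, 1] @ enc v'#} \<subseteq> thmc_moves T"
      by (simp only: image_mset_add_mset image_mset_empty)
    then show ?thesis using False assms(4) by simp
  qed
qed

lemma sliding_pair:
  assumes "0 < a" "0 < b" "c < T" "d < T" "c + d + 1 = a + b + T" "a \<le> b"
  shows "({#replicate T 1, single_step T a, single_step T b#}, {#replicate T 2, single_step T c, single_step T d#}) \<in> sliding_pairs T"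
proof -
  \<comment> \<open>The parameter \<open>u\<close> of the sliding move is \<open>c - a\<close>; its
    lower bound comes from \<open>d < T\<close>, its upper bound from \<open>c < T\<close>.\<close>
  have "1 \<le> a" "a \<le> b" "b \<le> T - 1" "a + b \<le> T - 1" "b \<le> c - a" "c - a \<le> T - 1 - a" "c = a + (c - a)" "d = b + T - 1 - (c - a)"
    using assms by linarith+
  then show ?thesis unfolding sliding_pairs_def by blast
qed

lemma sliding_swapping:
  assumes "0 < a" "0 < b" "c < T" "d < T" "c + d + 1 = a + b + T"
  shows "swapping {#replicate T 1, single_step T a, single_step T b#} {#replicate T 2, single_step T c, single_step T d#} \<subseteq> thmc_moves T \<and>
    swapping {#replicate T 1, rev (single_step T a), rev (single_step T b)#} {#replicate T 2, rev (single_step T c), rev (single_step T d)#} \<subseteq> thmc_moves T"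
proof -
  have "({#replicate T 1, single_step T a, single_step T b#}, {#replicate T 2, single_step T c, single_step T d#}) \<in> sliding_pairs T"
  proof (cases "a \<le> b")
    case True
    then show ?thesis using sliding_pair assms by blast
  next
    case False
    then have "({#replicate T 1, single_step T b, single_step T a#}, {#replicate T 2, single_step T d, single_step T c#}) \<in> sliding_pairs T"
      using assms by (intro sliding_pair) simp_all
    then show ?thesis by (simp add: add_mset_commute)
  qed
  note p = this
  have "swapping (image_mset rev {#replicate T 1, single_step T a, single_step T b#}) (image_mset rev {#replicate T 2, single_step T c, single_step T d#}) \<subseteq> sliding_moves T"
    "swapping {#replicate T 1, single_step T a, single_step T b#} {#replicate T 2, single_step T c, single_step T d#} \<subseteq> sliding_moves T"
    unfolding sliding_moves_def using p by blast+
  then show ?thesis unfolding thmc_moves_def by auto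
qed

lemma slide_step:
  assumes "0 < a" "0 < b" "0 < c" "0 < d" "a < T" "b < T" "c < T" "d < T" "c + d + 1 = a + b + T" "i \<noteq> j"
  shows "(step T)\<^sup>*\<^sup>* (image_mset enc {#replicate T i, replicate a i @ replicate (T - a) j, replicate b i @ replicate (T - b) j#})
    (image_mset enc {#replicate T j, replicate c i @ replicate (T - c) j, replicate d i @ replicate (T - d) j#})"
proof (cases i)
  case True
  have "swapping {#replicate T 1, single_step T a, single_step T b#} {#replicate T 2, single_step T c, single_step T d#} \<subseteq> thmc_moves T"
    using sliding_swapping[of a b c T d] assms by blast
  from steps_swapping[OF this] show ?thesis using True assms(10) by (simp add: single_step_def)
next
  case False
  \<comment> \<open>A step word from 2 to 1 is a reversed single step with complementary exponent.
    In these exponents the two sides of the sliding relation change places, so the reversed move is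
    used backwards.\<close>
  have r: "rev (single_step T (T - k)) = replicate k 2 @ replicate (T - k) 1" if "k < T" for k
    using that by (simp add: single_step_def)
  have "(T - a) + (T - b) + 1 = (T - c) + (T - d) + T" using assms by linarith
  then have "swapping {#replicate T 1, rev (single_step T (T - c)), rev (single_step T (T - d))#}
      {#replicate T 2, rev (single_step T (T - a)), rev (single_step T (T - b))#} \<subseteq> thmc_moves T"
    using sliding_swapping[of "T - c" "T - d" "T - a" T "T - b"] assms by simp
  from steps_sym[OF steps_swapping[OF this]] show ?thesis using False assms(5-8,10) by (simp add: r)
qed

lemma eqv_steps:
  "eqv T M N \<Longrightarrow> (step T)\<^sup>*\<^sup>* (image_mset enc M) (image_mset enc N)"
proof (induction rule: eqv.induct)
  case (eqv_refl M)
  show ?case by simp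
next
  case (eqv_sym M N)
  show ?case by (rule steps_sym[OF eqv_sym.IH])
next
  case (eqv_trans M N P)
  show ?case by (rule rtranclp_trans[OF eqv_trans.IH])
next
  case (eqv_add M N K)
  show ?case using steps_add[OF eqv_add.IH] by simp
next
  case (eqv_loops u i x y v)
  have "(step T)\<^sup>*\<^sup>* {#enc u @ ((if i then 1 else 2) # enc x) @ ((if i then 1 else 2) # enc y) @ ((if i then 1 else 2) # enc v)#}
      {#enc u @ ((if i then 1 else 2) # enc y) @ ((if i then 1 else 2) # enc x) @ ((if i then 1 else 2) # enc v)#}"
    using eqv_loops by (intro loops_step) simp_all
  then show ?case by simp
next
  case (eqv_rotate i x j y)
  have "(step T)\<^sup>*\<^sup>* {#((if i then 1 else 2) # enc x) @ ((if j then 1 else 2) # enc y) @ [if i then 1 else 2]#}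
      {#((if j then 1 else 2) # enc y) @ ((if i then 1 else 2) # enc x) @ [if j then 1 else 2]#}"
    using eqv_rotate by (cases i; cases j; intro rotate_step; simp)
  then show ?case by simp
next
  case (eqv_cross u i v u' v')
  have "(step T)\<^sup>*\<^sup>* {#enc u @ (if i then 1 else 2) # enc v, enc u' @ (if i then 1 else 2) # enc v'#}
      {#enc u @ (if i then 1 else 2) # enc v', enc u' @ (if i then 1 else 2) # enc v#}"
    using eqv_cross by (intro cross_step) simp_all
  then show ?case by simp
next
  case (eqv_square u i j v u' v')
  have up: "(step T)\<^sup>*\<^sup>* {#enc u @ [1, 1, 2] @ enc v, enc u' @ [2, 2, 1] @ enc v'#} {#enc u @ [1, 2, 2] @ enc v, enc u' @ [2, 1, 1] @ enc v'#}"
    if "length u + 3 + length v = T" "length u' = length u" "length v' = length v" for u v u' v'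
    using that by (intro square_step_up) simp_all
  have len: "length u + 3 + length v = T" "length u' + 3 + length v' = T" "length u' = length u" "length v' = length v"
    using eqv_square(1-3) by simp_all
  show ?case
  proof (cases i)
    case True
    with eqv_square(4) have ij: "i = True" "j = False" by simp_all
    have "(step T)\<^sup>*\<^sup>* {#enc u @ [1, 1, 2] @ enc v, enc u' @ [2, 2, 1] @ enc v'#} {#enc u @ [1, 2, 2] @ enc v, enc u' @ [2, 1, 1] @ enc v'#}"
      by (rule up[OF len(1,3,4)])
    then show ?thesis unfolding ij by simp
  next
    case False
    with eqv_square(4) have ij: "i = False" "j = True" by simp_all
    have "(step T)\<^sup>*\<^sup>* {#enc u @ [2, 2, 1] @ enc v, enc u' @ [1, 1, 2] @ enc v'#} {#enc u @ [2, 1, 1] @ enc v, enc u' @ [1, 2, 2] @ enc v'#}"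
      by (subst (1 2) add_mset_commute) (rule up[OF len(2) len(3)[symmetric] len(4)[symmetric]])
    then show ?thesis unfolding ij by simp
  qed
next
  case (eqv_exchange u i j v u' v')
  then show ?case by (intro exchange_step)
next
  case (eqv_slide a b c d i j)
  then show ?case by (intro slide_step)
qed

text \<open>The initial table plus a partial sum of the moves is the table of an intermediate
  multiset, and therefore nonnegative.\<close>

lemma steps_moves:
  assumes "(step T)\<^sup>*\<^sup>* M N"
  shows "\<exists>(K::nat) (z :: nat \<Rightarrow> table). (\<forall>k\<in>{1..K}. z k \<in> thmc_moves T) \<and>
    (\<forall>w. table_of N w = table_of M w + (\<Sum>k=1..K. z k w)) \<and>
    (\<forall>l\<in>{1..K}. \<forall>w. 0 \<le> table_of M w + (\<Sum>k=1..l. z k w))"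
  using assms
proof (induction rule: rtranclp_induct)
  case base
  show ?case by (intro exI[of _ 0]) simp
next
  case (step N P)
  from step.IH obtain K :: nat and z :: "nat \<Rightarrow> table" where IH: "\<forall>k\<in>{1..K}. z k \<in> thmc_moves T"
    "\<forall>w. table_of N w = table_of M w + (\<Sum>k=1..K. z k w)"
    "\<forall>l\<in>{1..K}. \<forall>w. 0 \<le> table_of M w + (\<Sum>k=1..l. z k w)" by blast
  obtain A B R where AB: "N = A + R" "P = B + R" "swapping A B \<subseteq> thmc_moves T"
    using step.hyps(2) unfolding step_def by blast
  define y where "y = z (Suc K := \<lambda>w. table_of B w - table_of A w)"
  have y: "y k = z k" if "k \<le> K" for k using that by (simp add: y_def)
  have sum_y: "(\<Sum>k=1..l. y k w) = (\<Sum>k=1..l. z k w)" if "l \<le> K" for l w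
    using that y by (intro sum.cong) auto
  have P: "table_of P w = table_of M w + (\<Sum>k=1..Suc K. y k w)" for w
    using spec[OF IH(2), of w] sum_y[of K w] unfolding AB(1,2) by (simp add: table_of_union y_def)
  have "y k \<in> thmc_moves T" if "k \<in> {1..Suc K}" for k
  proof (cases "k = Suc K")
    case True
    then show ?thesis using AB(3) by (auto simp: y_def swapping_def)
  next
    case False
    then show ?thesis using IH(1) that y by simp
  qed
  moreover have "0 \<le> table_of M w + (\<Sum>k=1..l. y k w)" if "l \<in> {1..Suc K}" for l w
  proof (cases "l = Suc K")
    case True
    have "0 \<le> table_of P w" by (simp add: table_of_count)
    then show ?thesis unfolding P True .
  next
    case False
    then have l: "l \<in> {1..K}" using that by simp
    show ?thesis using spec[OF bspec[OF IH(3) l], of w] sum_y[of l w] l by simp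
  qed
  ultimately show ?case using P by blast
qed

lemma table_multiset:
  assumes "x \<in> integer_arrays T" "\<forall>w. 0 \<le> x w"
  shows "\<exists>M. (\<forall>w\<in>#M. length w = T) \<and> table_of (image_mset enc M) = x"
proof -
  define N where "N = (\<Sum>w\<in>paths T. replicate_mset (nat (x w)) w)"
  have "count N w = nat (x w)" for w
  proof -
    have "count N w = (\<Sum>v\<in>paths T. if w = v then nat (x v) else 0)"
      unfolding N_def by (simp add: count_sum)
    also have "\<dots> = (if w \<in> paths T then nat (x w) else 0)"
      using finite_paths by (rule sum.delta')
    also have "\<dots> = nat (x w)" using assms(1) by (simp add: integer_arrays_def)
    finally show ?thesis .
  qed
  then have N: "table_of N = x" using assms(2) by (intro ext) (simp add: table_of_count)
  have "w \<in> paths T" if "w \<in># N" for w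
  proof (rule ccontr)
    assume "w \<notin> paths T"
    then have "count N w = 0" using \<open>\<And>w. count N w = nat (x w)\<close> assms(1) by (simp add: integer_arrays_def)
    then have "w \<notin># N" by (simp only: count_eq_zero_iff not_False_eq_True)
    then show False using that by (rule notE)
  qed
  note path = this
  let ?M = "image_mset (map (\<lambda>s. s = 1)) N"
  have "image_mset enc ?M = image_mset (\<lambda>w. w) N"
    unfolding image_mset.compositionality by (intro image_mset_cong) (simp only: comp_apply path_enc[OF path])
  then have "image_mset enc ?M = N" by simp
  moreover have "\<forall>w\<in>#?M. length w = T" using path by (auto simp: paths_def)
  ultimately show ?thesis using N by metis
qed

theorem theorem1:
  fixes T :: nat
  assumes "T \<ge> 3"
  shows "markov_basis T (thmc_moves T)"
  unfolding markov_basis_def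
proof (intro conjI thmc_moves_subset allI ballI)
  fix b x y assume xy: "x \<in> fiber T b" "y \<in> fiber T b"
  obtain X where X: "\<forall>w\<in>#X. length w = T" "table_of (image_mset enc X) = x"
    using table_multiset[of x T] xy(1) unfolding fiber_def by blast
  obtain Y where Y: "\<forall>w\<in>#Y. length w = T" "table_of (image_mset enc Y) = y"
    using table_multiset[of y T] xy(2) unfolding fiber_def by blast
  have A: "A_mult T (table_of (image_mset enc Z)) (if p then 1 else 2) (if q then 1 else 2) = int (\<Sum>w\<in>#Z. tr p q w)"
    if "\<forall>w\<in>#Z. length w = T" for Z p q
  proof -
    have "set_mset (image_mset enc Z) \<subseteq> paths T" using that enc_path by auto
    from A_mult_table_of[OF this] show ?thesis
      by (simp only: image_mset.compositionality comp_def tr_enc)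
  qed
  have tr: "(\<Sum>w\<in>#X. tr p q w) = (\<Sum>w\<in>#Y. tr p q w)" for p q
  proof -
    have "A_mult T x (if p then 1 else 2) (if q then 1 else 2) = A_mult T y (if p then 1 else 2) (if q then 1 else 2)"
      using xy unfolding fiber_def by (cases p; cases q) simp_all
    then show ?thesis using A[OF X(1), of p q] A[OF Y(1), of p q] unfolding X(2) Y(2) by linarith
  qed
  have T1: "1 \<le> T" using assms by simp
  \<comment> \<open>The number of paths is not among the data of the fiber. It is recovered from the
    total of all four counts, since each path has \<open>T - 1 > 0\<close> transitions.\<close>
  have "T * size X = size X + (T - 1) * size X" "T * size Y = size Y + (T - 1) * size Y"
    using T1 by (simp_all add: mult_eq_if)
  then have "(T - 1) * size X = (T - 1) * size Y"
    using sum_tr_total[OF X(1) T1] sum_tr_total[OF Y(1) T1] tr by simp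
  then have "size X = size Y" using assms by simp
  from eqv_steps[OF eqv_fiber[OF assms X(1) Y(1) this tr]]
  show "\<exists>(K::nat) (z :: nat \<Rightarrow> table).
      (\<forall>k\<in>{1..K}. z k \<in> thmc_moves T) \<and>
      (\<forall>\<omega>. y \<omega> = x \<omega> + (\<Sum>k=1..K. z k \<omega>)) \<and>
      (\<forall>l\<in>{1..K}. \<forall>\<omega>. 0 \<le> x \<omega> + (\<Sum>k=1..l. z k \<omega>))"
    unfolding X(2)[symmetric] Y(2)[symmetric] by (rule steps_moves)
qed

end
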